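(* Let $\mu$ be a positive, finite Borel measure on $\mathbb{R}^2$, and suppose that the maximal function $$M_{\mu} g(x) := \sup_{t > 0} \, (|g|*\mu_t)(x)$$ is bounded from $L^r(\mathbb{R}^2)$ to $L^r(\mathbb{R}^2)$ for every $r > 2$. Let $1 \le p < \frac{4}{3}$ and let $1\le q\le\infty$ satisfy $p' \ge 3q$. Then there is a constant $C = C_{p,\mu}$ such that $$\|M_{\mu}(\widehat{f})\|_{L^q(\mathbb{S}^1)} \le C \|f\|_{L^p(\mathbb{R}^2)}$$ for all Schwartz functions $f \in \mathcal{S}(\mathbb{R}^2)$.
   Context: For $t>0$, the dilate $\mu_t$ of $\mu$ is defined by $\mu_t(E) := \mu(t^{-1}E)$, so that $(|g|*\mu_t)(x) = \int |g(x-ty)|\,d\mu(y)$. The Fourier transform is $\widehat{f}(\xi) = \int_{\mathbb{R}^d} e^{-2\pi i x\cdot \xi} f(x)\,dx$. The circle $\mathbb{S}^1\subset\mathbb{R}^2$ is equipped with arc-length measure. $p'$ denotes the conjugate exponent, $1/p+1/p'=1$. *)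

theory Defs
  imports "HOL-Analysis.Analysis" "HOL-Probability.Essential_Supremum"
begin

section \<open>Lebesgue norms\<close>

text \<open>Meant for exponents \<open>a > 0\<close>.\<close>

definition enn_powr :: "ennreal \<Rightarrow> real \<Rightarrow> ennreal" where
  "enn_powr x a = (if x = top then top else ennreal (enn2real x powr a))"

text \<open>
  The norm takes the modulus of a function as its argument, so that it also applies to maximal
  functions, which may be infinite at some points.  For a function \<open>F\<close> that is measurable
  for the completion of \<open>M\<close>, but not for \<open>M\<close> itself, \<open>nn_integral\<close> still gives the
  integral with respect to the completion.
\<close>

definition Lnorm :: "ennreal \<Rightarrow> 'a measure \<Rightarrow> ('a \<Rightarrow> ennreal) \<Rightarrow> ennreal" where
  "Lnorm p M F =
     (if p = top then esssup M F
      else enn_powr (\<integral>\<^sup>+x. enn_powr (F x) (enn2real p) \<partial>M) (1 / enn2real p))"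

abbreviation modulus :: "('a \<Rightarrow> complex) \<Rightarrow> 'a \<Rightarrow> ennreal" where
  "modulus f \<equiv> (\<lambda>x. ennreal (norm (f x)))"

section \<open>Schwartz functions and the Fourier transform\<close>

definition partial :: "'n \<Rightarrow> (real^'n::finite \<Rightarrow> complex) \<Rightarrow> (real^'n \<Rightarrow> complex)" where
  "partial i f = (\<lambda>x. frechet_derivative f (at x) (axis i 1))"

text \<open>
  A list of coordinates stands for an iterated partial derivative.  Smoothness is the
  differentiability of all iterated partial derivatives; the decay condition bounds
  \<open>x\<^sup>\<alpha> \<partial>\<^sup>\<beta> f(x)\<close> for all multi-indices.
\<close>

definition schwartz :: "(real^'n::finite \<Rightarrow> complex) \<Rightarrow> bool" where
  "schwartz f \<longleftrightarrow>
     (\<forall>js x. fold partial js f differentiable (at x)) \<and>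
     (\<forall>js (\<alpha>::'n \<Rightarrow> nat).
        bounded (range (\<lambda>x. (\<Prod>i\<in>UNIV. (x $ i) ^ \<alpha> i) *\<^sub>R fold partial js f x)))"

definition fourier :: "(real^'n::finite \<Rightarrow> complex) \<Rightarrow> (real^'n \<Rightarrow> complex)" where
  "fourier f \<xi> = (LINT x|lborel. exp (- 2 * of_real pi * \<i> * of_real (x \<bullet> \<xi>)) * f x)"

section \<open>Maximal functions\<close>

definition dilate :: "real \<Rightarrow> (real^'n::finite) measure \<Rightarrow> (real^'n) measure" where
  "dilate t \<mu> = distr \<mu> borel (\<lambda>y. t *\<^sub>R y)"

definition conv :: "(real^'n::finite \<Rightarrow> ennreal) \<Rightarrow> (real^'n) measure \<Rightarrow> (real^'n \<Rightarrow> ennreal)" where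
  "conv F \<nu> x = (\<integral>\<^sup>+y. F (x - y) \<partial>\<nu>)"

definition maximal :: "(real^'n::finite) measure \<Rightarrow> (real^'n \<Rightarrow> complex) \<Rightarrow> (real^'n \<Rightarrow> ennreal)" where
  "maximal \<mu> g x = (SUP t\<in>{0<..}. conv (modulus g) (dilate t \<mu>) x)"

lemma emeasure_dilate:
  assumes "sets \<mu> = sets borel" "t > 0" "E \<in> sets borel"
  shows "emeasure (dilate t \<mu>) E = emeasure \<mu> ((\<lambda>y. (1 / t) *\<^sub>R y) ` E)"
proof -
  have "(\<lambda>y. t *\<^sub>R y) -` E = (\<lambda>y. (1 / t) *\<^sub>R y) ` E"
  proof (intro set_eqI iffI)
    fix y assume "y \<in> (\<lambda>y. t *\<^sub>R y) -` E"
    then show "y \<in> (\<lambda>y. (1 / t) *\<^sub>R y) ` E"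
      using assms(2) by (intro image_eqI[where x = "t *\<^sub>R y"]) simp_all
  next
    fix y assume "y \<in> (\<lambda>y. (1 / t) *\<^sub>R y) ` E"
    then show "y \<in> (\<lambda>y. t *\<^sub>R y) -` E"
      using assms(2) by auto
  qed
  moreover have "space \<mu> = UNIV"
    using sets_eq_imp_space_eq[OF assms(1)] by simp
  moreover have "(\<lambda>y. t *\<^sub>R y) \<in> measurable \<mu> borel"
    by (simp add: measurable_cong_sets[OF assms(1) refl])
  ultimately show ?thesis
    using assms(3) by (simp add: dilate_def emeasure_distr)
qed

lemma conv_dilate:
  assumes [measurable_cong]: "sets \<mu> = sets borel" and [measurable]: "g \<in> borel_measurable borel"
  shows "conv (modulus g) (dilate t \<mu>) x = (\<integral>\<^sup>+y. ennreal (norm (g (x - t *\<^sub>R y))) \<partial>\<mu>)"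
  unfolding conv_def dilate_def by (subst nn_integral_distr) simp_all

text \<open>
  Elements of \<open>L\<^sup>r\<close> are represented by Borel functions, because \<open>\<mu>\<close> may be singular and the
  convolution with \<open>\<mu>\<close> need not make sense for a Lebesgue measurable representative.
\<close>

definition bounded_on_L ::
    "real \<Rightarrow> ((real^'n::finite \<Rightarrow> complex) \<Rightarrow> (real^'n \<Rightarrow> ennreal)) \<Rightarrow> bool" where
  "bounded_on_L r T \<longleftrightarrow>
     (\<exists>A::real. A \<ge> 0 \<and>
        (\<forall>g \<in> borel_measurable borel. Lnorm (ennreal r) lborel (modulus g) < top \<longrightarrow>
           Lnorm (ennreal r) lborel (T g) \<le> ennreal A * Lnorm (ennreal r) lborel (modulus g)))"

section \<open>Arc length on the circle\<close>

definition circle_measure :: "(real^2) measure" where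
  "circle_measure =
     distr (restrict_space lborel {0..<2 * pi}) (restrict_space borel (sphere 0 1))
       (\<lambda>\<theta>. vector [cos \<theta>, sin \<theta>])"

lemma measurable_circle_param:
  "(\<lambda>\<theta>. vector [cos \<theta>, sin \<theta>] :: real^2)
     \<in> measurable (restrict_space lborel {0..<2 * pi}) (restrict_space borel (sphere 0 1))"
proof -
  have "vector [cos \<theta>, sin \<theta>] = cos \<theta> *\<^sub>R axis 1 1 + sin \<theta> *\<^sub>R (axis 2 1 :: real^2)" for \<theta>
    by (simp add: vec_eq_iff forall_2 axis_def)
  then have "continuous_on UNIV (\<lambda>\<theta>. vector [cos \<theta>, sin \<theta>] :: real^2)"
    by (simp only:) (intro continuous_intros)
  then have "(\<lambda>\<theta>. vector [cos \<theta>, sin \<theta>] :: real^2) \<in> measurable lborel borel"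
    using borel_measurable_continuous_onI measurable_lborel2 by blast
  then have "(\<lambda>\<theta>. vector [cos \<theta>, sin \<theta>] :: real^2)
      \<in> measurable (restrict_space lborel {0..<2 * pi}) borel"
    by (rule measurable_restrict_space1)
  moreover have "vector [cos \<theta>, sin \<theta>] \<in> sphere (0 :: real^2) 1" for \<theta>
    by (simp add: norm_vec_def L2_set_def sum_2)
  ultimately show ?thesis
    by (intro measurable_restrict_space2) blast+
qed

lemma space_circle_measure: "space circle_measure = sphere 0 1"
  by (simp add: circle_measure_def space_restrict_space)

lemma emeasure_circle_measure_space: "emeasure circle_measure (sphere 0 1) = ennreal (2 * pi)"
proof -
  have "space circle_measure \<in> sets circle_measure"
    by (rule sets.top)
  then have "emeasure circle_measure (space circle_measure)
      = emeasure (restrict_space lborel {0..<2 * pi}) (space (restrict_space lborel {0..<2 * pi}))"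
    unfolding circle_measure_def space_distr sets_distr
    using measurable_space[OF measurable_circle_param]
    by (subst emeasure_distr[OF measurable_circle_param])
      (auto intro!: arg_cong[where f = "emeasure _"])
  then show ?thesis
    by (simp add: space_circle_measure emeasure_restrict_space space_restrict_space)
qed

end

theory Submission
  imports Defs "HOL-Probability.Characteristic_Functions" "HOL-Probability.Sinc_Integral"
begin

text \<open>
  The proof is the classical bilinear argument for the circle, in which the extension operator is
  squared, run with the maximal operator inside.
  For \<open>p > 1\<close> put \<open>r = p'/2\<close>; the condition \<open>p < 4/3\<close> says exactly that \<open>r > 2\<close>, and the critical exponent on
  the circle is \<open>q = p'/3 = 2r/3\<close>.

  Let the dilations first be restricted to a finite set.  For every point \<open>x\<close> of the circle choose a
  dilation \<open>\<tau>(x)\<close> that attains the maximum, and a factor \<open>a(x,y)\<close> of modulus at most one that cancels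
  the phase of the transform.  The maximal function becomes the linear expression
  \<open>\<integral> a(x,y) f^(x - \<tau>(x) y) d\<mu>(y)\<close>, and its transpose sends a function \<open>g\<close> on the circle to
  \<open>E(\<xi>) = \<integral>\<integral> g(x) a(x,y) exp(-2\<pi>i \<xi>\<bullet>(x - \<tau>(x) y)) d\<mu>(y) d\<sigma>(x)\<close>.  By duality it is
  enough to bound the \<open>L\<^sup>2\<^sup>r\<close> norm of \<open>E\<close> by the norm of \<open>g\<close> in the exponent \<open>q' = 2r/(2r - 3)\<close>
  (\<open>extension_bounded\<close>).

  The square of the \<open>L\<^sup>2\<^sup>r\<close> norm of \<open>E\<close> is the \<open>L\<^sup>r\<close> norm of \<open>E\<^sup>2\<close>.  Pairing \<open>E\<^sup>2\<close> with a function
  \<open>\<phi>\<close> produces \<open>\<phi>^\<close> at the points \<open>x + x' - \<tau>(x) y - \<tau>(x') y'\<close>.  Integration in \<open>y'\<close> and then in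
  \<open>y\<close> is dominated by two successive maximal averages, whatever \<open>\<tau>(x)\<close> and \<open>\<tau>(x')\<close> are, so that what
  remains is the integral of \<open>|g(x)| |g(x')| H(x + x')\<close> with \<open>H = M M |\<phi>^|\<close>.  Now \<open>H\<close> is controlled in
  \<open>L\<^sup>r\<close> by \<open>\<phi>^\<close>, because \<open>M\<close> is bounded on \<open>L\<^sup>r\<close> (\<open>maxavg_bounded\<close>), and \<open>\<phi>^\<close> by \<open>\<phi>\<close> in the conjugate
  exponent (\<open>Hausdorff_Young\<close>); both use \<open>r > 2\<close>.  In angles, \<open>(x, x') \<mapsto> x + x'\<close> is two-to-one with
  Jacobian \<open>|sin(\<theta> - \<theta>')|\<close>, so Hoelder's inequality with this weight leaves a
  Hardy--Littlewood--Sobolev integral of a power of \<open>|g|\<close> with the kernel \<open>|sin(\<theta> - \<theta>')|\<close> to the power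
  \<open>-1/(r - 1)\<close> (\<open>bilinear_circle_bounded\<close>).

  The constant depends on neither the set of dilations nor the choice of \<open>\<tau>\<close> and \<open>a\<close>.  Because
  \<open>f^\<close> is continuous, positive rational dilations already give the whole supremum, and monotone
  convergence finishes the critical case (\<open>maximal_restriction_critical\<close>).  Smaller \<open>q\<close> follow from
  Hoelder's inequality on the circle, and \<open>p = 1\<close> from the bound of \<open>f^\<close> by the \<open>L\<^sup>1\<close> norm of \<open>f\<close>.
\<close>

section \<open>Powers of extended non-negative reals and Hoelder's inequality\<close>

lemma enn_powr_top [simp]: "enn_powr top a = top"
  by (simp add: enn_powr_def)

lemma enn_powr_0 [simp]: "enn_powr 0 a = 0"
  by (simp add: enn_powr_def)

lemma enn_powr_ennreal [simp]: "x \<ge> 0 \<Longrightarrow> enn_powr (ennreal x) a = ennreal (x powr a)"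
  by (simp add: enn_powr_def)

lemma enn_powr_1 [simp]: "enn_powr x 1 = x"
  by (cases x) auto

lemma enn_powr_eq_0_iff [simp]: "enn_powr x a = 0 \<longleftrightarrow> x = 0"
  by (cases x) (auto simp: ennreal_eq_0_iff)

lemma enn_powr_eq_top_iff [simp]: "enn_powr x a = top \<longleftrightarrow> x = top"
  by (cases x) auto

lemma enn_powr_mono: "x \<le> y \<Longrightarrow> a \<ge> 0 \<Longrightarrow> enn_powr x a \<le> enn_powr y a"
  by (cases x; cases y) (auto simp: top_unique intro!: ennreal_leI powr_mono2)

lemma enn_powr_mult: "enn_powr (x * y) a = enn_powr x a * enn_powr y a"
  by (cases x; cases y)
    (auto simp: ennreal_mult[symmetric] powr_mult ennreal_top_mult ennreal_mult_top)

lemma enn_powr_powr: "enn_powr (enn_powr x a) b = enn_powr x (a * b)"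
  by (cases x) (auto simp: powr_powr)

lemma enn_powr_add: "enn_powr x (a + b) = enn_powr x a * enn_powr x b"
  by (cases x) (auto simp: ennreal_mult[symmetric] powr_add)

text \<open>
  Suprema and integrals are bounded below by moving the power to the other side, which spares any
  argument about continuity of powers.
\<close>

lemma enn_powr_le_iff:
  assumes "a > 0"
  shows "enn_powr x a \<le> y \<longleftrightarrow> x \<le> enn_powr y (1 / a)"
  using enn_powr_mono[of "enn_powr x a" y "1 / a"] enn_powr_mono[of x "enn_powr y (1 / a)" a] assms
  by (auto simp: enn_powr_powr)

lemma enn_powr_SUP:
  assumes "a > 0"
  shows "enn_powr (SUP i\<in>I. F i) a = (SUP i\<in>I. enn_powr (F i) a)"
proof (rule antisym)
  show "enn_powr (SUP i\<in>I. F i) a \<le> (SUP i\<in>I. enn_powr (F i) a)"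
    unfolding enn_powr_le_iff[OF assms]
    by (intro SUP_least) (metis SUP_upper enn_powr_le_iff[OF assms])
  show "(SUP i\<in>I. enn_powr (F i) a) \<le> enn_powr (SUP i\<in>I. F i) a"
    using assms by (intro SUP_least enn_powr_mono SUP_upper) auto
qed

lemma measurable_enn_powr [measurable (raw)]:
  assumes [measurable]: "f \<in> borel_measurable M"
  shows "(\<lambda>x. enn_powr (f x) a) \<in> borel_measurable M"
  unfolding enn_powr_def by measurable

lemma Young_enn_powr:
  assumes "p > 1" "q > 1" "1 / p + 1 / q = (1::real)"
  shows "x * y \<le> ennreal (1 / p) * enn_powr x p + ennreal (1 / q) * enn_powr y q"
proof (cases "x = top \<or> y = top")
  case True
  then show ?thesis
    using assms by (auto simp: ennreal_mult_top top_unique)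
next
  case False
  then obtain a b where ab: "x = ennreal a" "a \<ge> 0" "y = ennreal b" "b \<ge> 0"
    by (cases x; cases y) auto
  have "a * b \<le> (1 / p) * (a powr p) + (1 / q) * (b powr q)"
    using Youngs_inequality[OF assms ab(2,4)] by simp
  then show ?thesis
    using ab assms by (simp add: ennreal_mult[symmetric] ennreal_plus[symmetric] del: ennreal_plus)
qed

theorem Hoelder_nn_integral:
  assumes pq: "p > 1" "q > 1" "1 / p + 1 / q = (1::real)"
    and [measurable]: "f \<in> borel_measurable M" "g \<in> borel_measurable M"
  shows "(\<integral>\<^sup>+x. f x * g x \<partial>M)
    \<le> enn_powr (\<integral>\<^sup>+x. enn_powr (f x) p \<partial>M) (1 / p) * enn_powr (\<integral>\<^sup>+x. enn_powr (g x) q \<partial>M) (1 / q)"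
    (is "_ \<le> ?A * ?B")
proof -
  \<comment> \<open>In the last case both functions are normalised and Young's inequality is integrated.\<close>
  consider "?A = 0 \<or> ?B = 0" | "?A \<noteq> 0" "?B \<noteq> 0" "?A = top \<or> ?B = top"
    | "?A \<noteq> 0" "?B \<noteq> 0" "?A \<noteq> top" "?B \<noteq> top"
    by blast
  then show ?thesis
  proof cases
    case 1
    then have "AE x in M. f x * g x = 0"
      by (auto simp: nn_integral_0_iff_AE)
    then have "(\<integral>\<^sup>+x. f x * g x \<partial>M) = 0"
      by (simp add: nn_integral_0_iff_AE)
    then show ?thesis
      by simp
  next
    case 2
    then show ?thesis
      by (auto simp: ennreal_top_mult ennreal_mult_top)
  next
    case 3
    then obtain A B where A: "?A = ennreal A" "A > 0" and B: "?B = ennreal B" "B > 0"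
      by (cases ?A; cases ?B) (auto simp del: enn_powr_eq_0_iff enn_powr_eq_top_iff simp: less_le)
    define f' where "f' x = ennreal (1 / A) * f x" for x
    define g' where "g' x = ennreal (1 / B) * g x" for x
    have [measurable]: "f' \<in> borel_measurable M" "g' \<in> borel_measurable M"
      unfolding f'_def g'_def by simp_all
    have "(\<integral>\<^sup>+x. enn_powr (f x) p \<partial>M) = enn_powr ?A p" "(\<integral>\<^sup>+x. enn_powr (g x) q \<partial>M) = enn_powr ?B q"
      using pq by (simp_all add: enn_powr_powr)
    then have AB: "(\<integral>\<^sup>+x. enn_powr (f x) p \<partial>M) = ennreal (A powr p)"
      "(\<integral>\<^sup>+x. enn_powr (g x) q \<partial>M) = ennreal (B powr q)"
      unfolding A(1) B(1) using A(2) B(2) by simp_all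
    have 1: "(\<integral>\<^sup>+x. enn_powr (f' x) p \<partial>M) = 1" "(\<integral>\<^sup>+x. enn_powr (g' x) q \<partial>M) = 1"
      using AB A(2) B(2)
      by (simp_all add: f'_def g'_def enn_powr_mult nn_integral_cmult ennreal_mult[symmetric]
          powr_divide)
    have "(\<integral>\<^sup>+x. f' x * g' x \<partial>M)
      \<le> (\<integral>\<^sup>+x. ennreal (1 / p) * enn_powr (f' x) p + ennreal (1 / q) * enn_powr (g' x) q \<partial>M)"
      by (intro nn_integral_mono Young_enn_powr pq)
    also have "\<dots> = 1"
      using pq by (simp add: nn_integral_add nn_integral_cmult 1 ennreal_plus[symmetric] del: ennreal_plus)
    finally have le: "(\<integral>\<^sup>+x. f' x * g' x \<partial>M) \<le> 1" .
    have "f x * g x = ennreal (A * B) * (f' x * g' x)" for x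
    proof -
      have "ennreal (A * B) * (f' x * g' x) = (ennreal A * ennreal (1 / A)) * (ennreal B * ennreal (1 / B)) * (f x * g x)"
        using A B by (simp add: f'_def g'_def ennreal_mult mult_ac)
      also have "\<dots> = f x * g x"
        using A(2) B(2) by (simp add: ennreal_mult[symmetric])
      finally show ?thesis ..
    qed
    then have "(\<integral>\<^sup>+x. f x * g x \<partial>M) = ennreal (A * B) * (\<integral>\<^sup>+x. f' x * g' x \<partial>M)"
      by (simp add: nn_integral_cmult)
    also have "\<dots> \<le> ennreal (A * B) * 1"
      by (intro mult_left_mono le) simp
    also have "\<dots> = ?A * ?B"
      unfolding A(1) B(1) using A(2) B(2) by (simp add: ennreal_mult)
    finally show ?thesis .
  qed
qed


section \<open>Integrals on the line and on the plane\<close>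

lemma lborel_plane:
  "(lborel :: (real^2) measure) = distr (lborel \<Otimes>\<^sub>M lborel) borel (\<lambda>(x, y). vector [x, y])"
proof (rule lborel_eqI)
  fix l u :: "real^2"
  assume lu: "\<And>b. b \<in> Basis \<Longrightarrow> l \<bullet> b \<le> u \<bullet> b"
  have B: "Basis = {axis 1 1, axis 2 1 :: real^2}"
    unfolding Basis_vec_def UNIV_2 by auto
  have ne: "axis 1 1 \<noteq> (axis 2 1 :: real^2)"
    by (simp add: axis_eq_axis)
  have le: "l $ 1 \<le> u $ 1" "l $ 2 \<le> u $ 2"
    using lu[of "axis 1 1"] lu[of "axis 2 1"] by (auto simp: B inner_axis)
  have eq: "(\<lambda>(x, y). vector [x, y]) -` box l u = box (l $ 1) (u $ 1) \<times> box (l $ 2) (u $ 2)"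
    by (auto simp: mem_box_cart forall_2)
  have "(\<lambda>(x, y). vector [x, y] :: real^2) = (\<lambda>z. fst z *\<^sub>R axis 1 1 + snd z *\<^sub>R axis 2 1)"
    by (auto simp: vec_eq_iff forall_2 axis_def)
  then have "(\<lambda>(x, y). vector [x, y] :: real^2) \<in> borel_measurable (lborel \<Otimes>\<^sub>M lborel)"
    by simp
  then show "emeasure (distr (lborel \<Otimes>\<^sub>M lborel) borel (\<lambda>(x, y). vector [x, y])) (box l u)
      = ennreal (\<Prod>b\<in>Basis. (u - l) \<bullet> b)"
    using le by (subst emeasure_distr)
      (simp_all add: eq space_pair_measure lborel.emeasure_pair_measure_Times B ne inner_axis
        ennreal_mult[symmetric])
qed simp

lemma measurable_vector2 [measurable (raw)]:
  assumes [measurable]: "f \<in> borel_measurable M" "g \<in> borel_measurable M"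
  shows "(\<lambda>x. vector [f x, g x] :: real^2) \<in> borel_measurable M"
proof -
  have "(\<lambda>x. vector [f x, g x] :: real^2) = (\<lambda>x. f x *\<^sub>R axis 1 1 + g x *\<^sub>R axis 2 1)"
    by (auto simp: vec_eq_iff forall_2 axis_def)
  then show ?thesis
    by simp
qed

lemma nn_integral_plane:
  assumes [measurable]: "f \<in> borel_measurable borel"
  shows "(\<integral>\<^sup>+z. f (z :: real^2) \<partial>lborel) = (\<integral>\<^sup>+x. \<integral>\<^sup>+y. f (vector [x, y]) \<partial>lborel \<partial>lborel)"
  by (subst lborel_plane)
    (simp add: nn_integral_distr lborel.nn_integral_fst[symmetric] split_beta')

lemma nn_integral_translate:
  fixes f :: "'a::euclidean_space \<Rightarrow> ennreal"
  assumes [measurable]: "f \<in> borel_measurable borel"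
  shows "(\<integral>\<^sup>+x. f (c + x) \<partial>lborel) = (\<integral>\<^sup>+x. f x \<partial>lborel)"
  using nn_integral_distr[of "(+) c" lborel borel f] by (simp add: lborel_distr_plus)

lemma nn_integral_powr_from_0:
  assumes "a > -1" "c \<ge> (0::real)"
  shows "(\<integral>\<^sup>+x\<in>{0..c}. ennreal (x powr a) \<partial>lborel) = ennreal (c powr (a + 1) / (a + 1))"
proof -
  have "((\<lambda>x. x powr a * indicator {0..c} x) has_integral (c powr (a + 1) / (a + 1))) UNIV"
    using has_integral_powr_from_0[OF assms]
    by (subst (asm) has_integral_restrict_UNIV[symmetric])
      (simp add: indicator_def of_bool_def if_distrib cong: if_cong)
  then have "(\<integral>\<^sup>+x. ennreal (x powr a * indicator {0..c} x) \<partial>lborel) = ennreal (c powr (a + 1) / (a + 1))"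
    by (intro nn_integral_has_integral_lborel) auto
  then show ?thesis
    by (simp add: ennreal_mult' indicator_def of_bool_def if_distrib cong: if_cong)
qed

lemma nn_integral_powr_to_inf:
  assumes "a < -1" "c > (0::real)"
  shows "(\<integral>\<^sup>+x\<in>{c..}. ennreal (x powr a) \<partial>lborel) = ennreal (- (c powr (a + 1)) / (a + 1))"
proof -
  have "((\<lambda>x. x powr a * indicator {c..} x) has_integral (- (c powr (a + 1)) / (a + 1))) UNIV"
    using has_integral_powr_to_inf[OF assms]
    by (subst (asm) has_integral_restrict_UNIV[symmetric])
      (simp add: indicator_def of_bool_def if_distrib cong: if_cong)
  then have "(\<integral>\<^sup>+x. ennreal (x powr a * indicator {c..} x) \<partial>lborel) = ennreal (- (c powr (a + 1)) / (a + 1))"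
    by (intro nn_integral_has_integral_lborel) auto
  then show ?thesis
    by (simp add: ennreal_mult' indicator_def of_bool_def if_distrib cong: if_cong)
qed

text \<open>
  Moving \<open>y\<close> to the origin leaves an even function, twice its half-line integral.
\<close>

lemma nn_integral_even_centred:
  fixes f :: "real \<Rightarrow> ennreal"
  assumes [measurable]: "f \<in> borel_measurable borel"
  shows "(\<integral>\<^sup>+y. f \<bar>x - y\<bar> \<partial>lborel) \<le> 2 * (\<integral>\<^sup>+u\<in>{0..}. f u \<partial>lborel)"
proof -
  have "(\<integral>\<^sup>+y. f \<bar>x - y\<bar> \<partial>lborel) = (\<integral>\<^sup>+u. f \<bar>u\<bar> \<partial>lborel)"
    using nn_integral_real_affine[of "\<lambda>u. f \<bar>u\<bar>" "-1" x] by simp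
  also have "\<dots> \<le> (\<integral>\<^sup>+u. f u * indicator {0..} u + f (- u) * indicator {0..} (- u) \<partial>lborel)"
    by (intro nn_integral_mono) (auto simp: indicator_def abs_if)
  also have "\<dots> = (\<integral>\<^sup>+u\<in>{0..}. f u \<partial>lborel) + (\<integral>\<^sup>+u. f (- u) * indicator {0..} (- u) \<partial>lborel)"
    by (subst nn_integral_add) auto
  also have "(\<integral>\<^sup>+u. f (- u) * indicator {0..} (- u) \<partial>lborel) = (\<integral>\<^sup>+u\<in>{0..}. f u \<partial>lborel)"
    using nn_integral_real_affine[of "\<lambda>u. f u * indicator {0..} u" "-1" 0] by simp
  finally show ?thesis
    by (simp add: mult_2)
qed

section \<open>The Hardy--Littlewood--Sobolev inequality with equal exponents\<close>

text \<open>
  On the part of the plane where \<open>h(y) \<le> f(x)\<close> the inequality can be proved pointwise in \<open>x\<close>.  Close to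
  \<open>x\<close>, within distance \<open>R\<close>, replace \<open>h(y)\<close> by \<open>f(x)\<close> and integrate the kernel; far from \<open>x\<close>, apply
  Hoelder's inequality with the exponent \<open>2/\<kappa>\<close> conjugate to \<open>s\<close>, which turns the kernel into
  \<open>|x - y|\<close> to the power \<open>-2\<close>.  The \<open>R\<close> that balances them makes both parts a multiple of \<open>f(x)\<close> to the power \<open>s - 1\<close>, so
  that the integral in \<open>x\<close> is again that of \<open>f\<close> to the power \<open>s\<close>.
\<close>

lemma HLS_half:
  fixes f h :: "real \<Rightarrow> real"
  assumes \<kappa>: "0 < \<kappa>" "\<kappa> < 1" and N: "N > 0"
  defines "s \<equiv> 2 / (2 - \<kappa>)"
  assumes [measurable]: "f \<in> borel_measurable borel" "h \<in> borel_measurable borel"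
    and nn: "\<And>x. f x \<ge> 0" "\<And>x. h x \<ge> 0"
    and fN: "(\<integral>\<^sup>+x. ennreal (f x powr s) \<partial>lborel) \<le> ennreal N"
    and hN: "(\<integral>\<^sup>+x. ennreal (h x powr s) \<partial>lborel) \<le> ennreal N"
  shows "(\<integral>\<^sup>+x. \<integral>\<^sup>+y. ennreal (f x * h y * \<bar>x - y\<bar> powr - \<kappa>) * indicator {..f x} (h y) \<partial>lborel \<partial>lborel)
    \<le> ennreal ((2 / (1 - \<kappa>) + 2 powr (\<kappa> / 2)) * N powr (2 - \<kappa>))"
proof -
  define K where "K = 2 / (1 - \<kappa>) + 2 powr (\<kappa> / 2)"
  have K: "K \<ge> 0"
    using \<kappa> by (simp add: K_def)
  have s: "s > 1" "s * \<kappa> = 2 * s - 2"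
    using \<kappa> by (simp_all add: s_def field_simps)
  have inner: "(\<integral>\<^sup>+y. ennreal (h y * \<bar>x - y\<bar> powr - \<kappa>) * indicator {..f x} (h y) \<partial>lborel)
      \<le> ennreal (K * N powr (1 - \<kappa>) * f x powr (s - 1))" if pos: "f x > 0" for x
  proof -
    define a where "a = f x"
    \<comment> \<open>The radius at which the near and the far contribution balance.\<close>
    define R where "R = N * a powr - s"
    have a: "a > 0" and R: "R > 0"
      using pos N by (simp_all add: a_def R_def)
    define k1 where "k1 u = ennreal (u powr - \<kappa>) * indicator {..R} u" for u :: real
    define k2 where "k2 u = ennreal (u powr - \<kappa>) * indicator {R..} u" for u :: real
    have [measurable]: "k1 \<in> borel_measurable borel" "k2 \<in> borel_measurable borel"
      unfolding k1_def k2_def by simp_all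
    have near: "(\<integral>\<^sup>+y. k1 \<bar>x - y\<bar> \<partial>lborel) \<le> ennreal (2 * (R powr (1 - \<kappa>) / (1 - \<kappa>)))"
    proof -
      have "(\<integral>\<^sup>+u\<in>{0..}. k1 u \<partial>lborel) = (\<integral>\<^sup>+u\<in>{0..R}. ennreal (u powr - \<kappa>) \<partial>lborel)"
        by (intro nn_integral_cong) (auto simp: k1_def indicator_def)
      also have "\<dots> = ennreal (R powr (1 - \<kappa>) / (1 - \<kappa>))"
        using nn_integral_powr_from_0[of "- \<kappa>" R] \<kappa> R by simp
      finally show ?thesis
        using nn_integral_even_centred[of k1 x] \<kappa>
        by (simp add: ennreal_mult[symmetric] ennreal_numeral[symmetric] del: ennreal_numeral)
    qed
    have far: "(\<integral>\<^sup>+y. enn_powr (k2 \<bar>x - y\<bar>) (2 / \<kappa>) \<partial>lborel) \<le> ennreal (2 / R)"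
    proof -
      have "(\<integral>\<^sup>+u\<in>{0..}. enn_powr (k2 u) (2 / \<kappa>) \<partial>lborel) = (\<integral>\<^sup>+u\<in>{R..}. ennreal (u powr - 2) \<partial>lborel)"
        using R \<kappa> by (intro nn_integral_cong) (auto simp: k2_def indicator_def powr_powr)
      also have "\<dots> = ennreal (1 / R)"
        using nn_integral_powr_to_inf[of "- 2" R] R by (simp add: powr_minus_divide)
      finally show ?thesis
        using nn_integral_even_centred[of "\<lambda>u. enn_powr (k2 u) (2 / \<kappa>)" x] R
        by (simp add: ennreal_mult[symmetric] ennreal_numeral[symmetric] del: ennreal_numeral)
    qed
    have "ennreal (h y * \<bar>x - y\<bar> powr - \<kappa>) * indicator {..f x} (h y)
        \<le> ennreal a * k1 \<bar>x - y\<bar> + ennreal (h y) * k2 \<bar>x - y\<bar>" for y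
      using a nn(2)[of y]
      by (auto simp: k1_def k2_def a_def indicator_def ennreal_mult[symmetric]
          intro!: ennreal_leI mult_right_mono)
    then have "(\<integral>\<^sup>+y. ennreal (h y * \<bar>x - y\<bar> powr - \<kappa>) * indicator {..f x} (h y) \<partial>lborel)
        \<le> (\<integral>\<^sup>+y. ennreal a * k1 \<bar>x - y\<bar> + ennreal (h y) * k2 \<bar>x - y\<bar> \<partial>lborel)"
      by (intro nn_integral_mono)
    also have "\<dots> = ennreal a * (\<integral>\<^sup>+y. k1 \<bar>x - y\<bar> \<partial>lborel) + (\<integral>\<^sup>+y. ennreal (h y) * k2 \<bar>x - y\<bar> \<partial>lborel)"
      by (simp add: nn_integral_add nn_integral_cmult)
    also have "(\<integral>\<^sup>+y. ennreal (h y) * k2 \<bar>x - y\<bar> \<partial>lborel)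
        \<le> enn_powr (\<integral>\<^sup>+y. enn_powr (ennreal (h y)) s \<partial>lborel) (1 / s)
          * enn_powr (\<integral>\<^sup>+y. enn_powr (k2 \<bar>x - y\<bar>) (2 / \<kappa>) \<partial>lborel) (1 / (2 / \<kappa>))"
      using s \<kappa> by (intro Hoelder_nn_integral) (simp_all add: s_def field_simps)
    also have "\<dots> \<le> enn_powr (ennreal N) (1 / s) * enn_powr (ennreal (2 / R)) (1 / (2 / \<kappa>))"
      using s \<kappa> far hN nn(2) by (intro mult_mono enn_powr_mono) simp_all
    also have "\<dots> = ennreal (N powr (1 / s) * (2 / R) powr (\<kappa> / 2))"
      using N R by (simp add: ennreal_mult)
    also have "ennreal a * (\<integral>\<^sup>+y. k1 \<bar>x - y\<bar> \<partial>lborel) \<le> ennreal a * ennreal (2 * (R powr (1 - \<kappa>) / (1 - \<kappa>)))"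
      by (intro mult_left_mono near) simp
    also have "ennreal a * ennreal (2 * (R powr (1 - \<kappa>) / (1 - \<kappa>))) + ennreal (N powr (1 / s) * (2 / R) powr (\<kappa> / 2))
        = ennreal (a * (2 * (R powr (1 - \<kappa>) / (1 - \<kappa>))) + N powr (1 / s) * (2 / R) powr (\<kappa> / 2))"
      using a \<kappa> R N by (simp add: ennreal_mult[symmetric] ennreal_plus[symmetric] del: ennreal_plus)
    also have "a * (2 * (R powr (1 - \<kappa>) / (1 - \<kappa>))) + N powr (1 / s) * (2 / R) powr (\<kappa> / 2)
        = K * N powr (1 - \<kappa>) * a powr (s - 1)"
    proof -
      have "R powr (1 - \<kappa>) = N powr (1 - \<kappa>) * a powr (s - 2)"
      proof -
        have "R powr (1 - \<kappa>) = N powr (1 - \<kappa>) * a powr (- s * (1 - \<kappa>))"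
          using N a by (simp add: R_def powr_mult powr_powr)
        also have "- s * (1 - \<kappa>) = s - 2"
          using s(2) by (simp add: algebra_simps)
        finally show ?thesis .
      qed
      moreover have "a * a powr (s - 2) = a powr (s - 1)"
        using a powr_add[of a 1 "s - 2"] by simp
      moreover have "N powr (1 / s) * (2 / R) powr (\<kappa> / 2) = 2 powr (\<kappa> / 2) * N powr (1 - \<kappa>) * a powr (s - 1)"
      proof -
        have "2 / R = 2 * N powr - 1 * a powr s"
          using N a by (simp add: R_def powr_minus field_simps)
        then have "(2 / R) powr (\<kappa> / 2) = 2 powr (\<kappa> / 2) * N powr (- (\<kappa> / 2)) * a powr (s * (\<kappa> / 2))"
          using N a by (simp only: powr_mult powr_powr) simp
        then have "N powr (1 / s) * (2 / R) powr (\<kappa> / 2)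
            = (N powr (1 / s) * N powr (- (\<kappa> / 2))) * (2 powr (\<kappa> / 2) * a powr (s * (\<kappa> / 2)))"
          by (simp only: mult_ac)
        also have "N powr (1 / s) * N powr (- (\<kappa> / 2)) = N powr (1 - \<kappa>)"
        proof -
          have "1 / s + - (\<kappa> / 2) = 1 - \<kappa>"
            by (simp add: s_def diff_divide_distrib)
          then show ?thesis
            by (metis powr_add)
        qed
        also have "s * (\<kappa> / 2) = s - 1"
          using s(2) by simp
        finally show ?thesis
          by (simp only: mult_ac)
      qed
      ultimately show ?thesis
        by (simp add: K_def algebra_simps add_divide_distrib)
    qed
    finally show ?thesis
      by (simp add: a_def)
  qed
  have "(\<integral>\<^sup>+y. ennreal (f x * h y * \<bar>x - y\<bar> powr - \<kappa>) * indicator {..f x} (h y) \<partial>lborel)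
      \<le> ennreal (K * N powr (1 - \<kappa>)) * ennreal (f x powr s)" for x
  proof (cases "f x = 0")
    case False
    then have pos: "f x > 0"
      using nn(1)[of x] by simp
    have "(\<integral>\<^sup>+y. ennreal (f x * h y * \<bar>x - y\<bar> powr - \<kappa>) * indicator {..f x} (h y) \<partial>lborel)
        = ennreal (f x) * (\<integral>\<^sup>+y. ennreal (h y * \<bar>x - y\<bar> powr - \<kappa>) * indicator {..f x} (h y) \<partial>lborel)"
      using pos nn by (subst nn_integral_cmult[symmetric]) (simp_all add: ennreal_mult mult_ac)
    also have "\<dots> \<le> ennreal (f x) * ennreal (K * N powr (1 - \<kappa>) * f x powr (s - 1))"
      by (intro mult_left_mono inner pos) simp
    also have "\<dots> = ennreal (K * N powr (1 - \<kappa>)) * ennreal (f x powr s)"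
      using pos K powr_add[of "f x" 1 "s - 1"] by (simp add: ennreal_mult[symmetric] mult_ac)
    finally show ?thesis .
  qed simp
  then have "(\<integral>\<^sup>+x. \<integral>\<^sup>+y. ennreal (f x * h y * \<bar>x - y\<bar> powr - \<kappa>) * indicator {..f x} (h y) \<partial>lborel \<partial>lborel)
      \<le> (\<integral>\<^sup>+x. ennreal (K * N powr (1 - \<kappa>)) * ennreal (f x powr s) \<partial>lborel)"
    by (intro nn_integral_mono)
  also have "\<dots> \<le> ennreal (K * N powr (1 - \<kappa>)) * ennreal N"
    by (simp add: nn_integral_cmult mult_left_mono fN)
  also have "\<dots> = ennreal (K * N powr (2 - \<kappa>))"
    using N K powr_add[of N 1 "1 - \<kappa>"] by (simp add: ennreal_mult[symmetric] mult_ac)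
  finally show ?thesis
    by (simp add: K_def)
qed

text \<open>
  Either \<open>h(y) \<le> f(x)\<close> or \<open>f(x) \<le> h(y)\<close>, and the kernel is symmetric, so two applications of
  \<open>HLS_half\<close> cover the plane.
\<close>

theorem HLS_diagonal:
  fixes f h :: "real \<Rightarrow> real"
  assumes \<kappa>: "0 < \<kappa>" "\<kappa> < 1" and N: "N > 0"
    and [measurable]: "f \<in> borel_measurable borel" "h \<in> borel_measurable borel"
    and nn: "\<And>x. f x \<ge> 0" "\<And>x. h x \<ge> 0"
    and fN: "(\<integral>\<^sup>+x. ennreal (f x powr (2 / (2 - \<kappa>))) \<partial>lborel) \<le> ennreal N"
    and hN: "(\<integral>\<^sup>+x. ennreal (h x powr (2 / (2 - \<kappa>))) \<partial>lborel) \<le> ennreal N"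
  shows "(\<integral>\<^sup>+x. \<integral>\<^sup>+y. ennreal (f x * h y * \<bar>x - y\<bar> powr - \<kappa>) \<partial>lborel \<partial>lborel)
    \<le> ennreal (2 * (2 / (1 - \<kappa>) + 2 powr (\<kappa> / 2)) * N powr (2 - \<kappa>))"
    (is "?L \<le> ennreal (2 * ?K * ?N)")
proof -
  define F where "F f h x y = ennreal (f x * h y * \<bar>x - y\<bar> powr - \<kappa>) * indicator {..f x} (h y)"
    for f h :: "real \<Rightarrow> real" and x y
  have meas: "(\<lambda>(x, y). F f h x y) \<in> borel_measurable (lborel \<Otimes>\<^sub>M lborel)"
    if [measurable]: "f \<in> borel_measurable borel" "h \<in> borel_measurable borel"
    for f h :: "real \<Rightarrow> real"
    unfolding F_def indicator_def of_bool_def atMost_iff by measurable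
  have [measurable]: "(\<lambda>(x, y). F f h x y) \<in> borel_measurable (lborel \<Otimes>\<^sub>M lborel)"
    "(\<lambda>(x, y). F h f x y) \<in> borel_measurable (lborel \<Otimes>\<^sub>M lborel)"
    by (intro meas; measurable)+
  have K: "?K \<ge> 0"
    using \<kappa> by simp
  have "?L \<le> (\<integral>\<^sup>+x. \<integral>\<^sup>+y. F f h x y + F h f y x \<partial>lborel \<partial>lborel)"
    using nn by (intro nn_integral_mono) (auto simp: F_def indicator_def abs_minus_commute mult_ac)
  also have "\<dots> = (\<integral>\<^sup>+x. \<integral>\<^sup>+y. F f h x y \<partial>lborel \<partial>lborel) + (\<integral>\<^sup>+x. \<integral>\<^sup>+y. F h f y x \<partial>lborel \<partial>lborel)"
    by (simp add: nn_integral_add)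
  also have "(\<integral>\<^sup>+x. \<integral>\<^sup>+y. F h f y x \<partial>lborel \<partial>lborel) = (\<integral>\<^sup>+y. \<integral>\<^sup>+x. F h f y x \<partial>lborel \<partial>lborel)"
    by (rule lborel_pair.Fubini') measurable
  also have "(\<integral>\<^sup>+x. \<integral>\<^sup>+y. F f h x y \<partial>lborel \<partial>lborel) + (\<integral>\<^sup>+y. \<integral>\<^sup>+x. F h f y x \<partial>lborel \<partial>lborel)
      \<le> ennreal (?K * ?N) + ennreal (?K * ?N)"
    unfolding F_def using assms by (intro add_mono HLS_half) simp_all
  also have "\<dots> = ennreal (2 * ?K * ?N)"
    using K by (simp add: ennreal_plus[symmetric] del: ennreal_plus)
  finally show ?thesis .
qed


lemma half_le_sin:
  assumes "\<bar>v\<bar> \<le> pi / 2"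
  shows "\<bar>v\<bar> \<le> 2 * \<bar>sin v\<bar>"
proof -
  \<comment> \<open>The Taylor remainder is at most half of the main term, since \<open>v\<^sup>2 \<le> 3\<close>.\<close>
  have "\<bar>sin v - (\<Sum>m<3. sin_coeff m * v ^ m)\<bar> \<le> inverse (fact 3) * \<bar>v\<bar> ^ 3"
    by (rule Maclaurin_sin_bound)
  moreover have "(\<Sum>m<3. sin_coeff m * v ^ m) = v"
    by (simp add: sin_coeff_def numeral_3_eq_3)
  moreover have "\<bar>v\<bar> ^ 3 \<le> 3 * \<bar>v\<bar>"
  proof -
    have "\<bar>v\<bar> \<le> 17 / 10"
      using assms pi_approx by simp
    then have "\<bar>v\<bar>\<^sup>2 \<le> (17 / 10)\<^sup>2"
      by (rule power_mono) simp
    then have "\<bar>v\<bar>\<^sup>2 \<le> 3"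
      by (simp add: power_divide)
    then have "\<bar>v\<bar>\<^sup>2 * \<bar>v\<bar> \<le> 3 * \<bar>v\<bar>"
      by (rule mult_right_mono) simp
    then show ?thesis
      by (simp add: power3_eq_cube power2_eq_square)
  qed
  ultimately have "\<bar>sin v - v\<bar> \<le> \<bar>v\<bar> / 2"
    by (simp add: fact_numeral)
  then show ?thesis
    by (smt (verit) field_sum_of_halves)
qed

text \<open>
  The sine vanishes on the multiples of \<open>\<pi>\<close>, to first order.  Differences of two angles in a period
  lie within \<open>2\<pi>\<close> of the origin, so the zeros \<open>-2\<pi>, \<dots>, 2\<pi>\<close> are the only ones that can be nearest.
\<close>

lemma sin_powr_le_sum_shifts:
  assumes "\<bar>u\<bar> < 2 * pi" "0 < \<kappa>" "\<kappa> < 1"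
  shows "\<bar>sin u\<bar> powr - \<kappa> \<le> (\<Sum>k\<in>{-2..2::int}. 2 * \<bar>u - k * pi\<bar> powr - \<kappa>)"
proof (cases "sin u = 0")
  case True
  then show ?thesis
    by (simp add: sum_nonneg)
next
  case False
  define k where "k = round (u / pi)"
  define v where "v = u - k * pi"
  have "\<bar>u / pi - k\<bar> \<le> 1 / 2"
    unfolding k_def using of_int_round_abs_le[of "u / pi"] by (simp add: abs_minus_commute)
  then have "\<bar>u / pi - k\<bar> * pi \<le> 1 / 2 * pi"
    by (rule mult_right_mono) simp
  moreover have "\<bar>u / pi - k\<bar> * pi = \<bar>v\<bar>"
    by (simp add: v_def abs_mult_pos left_diff_distrib)
  ultimately have v: "\<bar>v\<bar> \<le> pi / 2"
    by simp
  have "\<bar>k * pi\<bar> < 3 * pi"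
    using v assms(1) pi_gt_zero unfolding v_def by linarith
  then have "\<bar>real_of_int k\<bar> < 3"
    by (simp add: abs_mult)
  then have k: "k \<in> {-2..2}"
    by auto
  have "\<bar>sin u\<bar> = \<bar>sin v\<bar>"
  proof -
    have "sin u = sin v * cos (k * pi) + cos v * sin (k * pi)"
      using sin_add[of v "k * pi"] by (simp add: v_def)
    moreover have "sin (k * pi) = 0"
      by (simp add: sin_zero_iff_int2)
    moreover from this have "\<bar>cos (k * pi)\<bar> = 1"
      using sin_cos_squared_add[of "k * pi"] by (simp add: power2_eq_1_iff abs_if) linarith
    ultimately show ?thesis
      by (simp add: abs_mult)
  qed
  then have sv: "sin v \<noteq> 0"
    using False by auto
  then have v0: "v \<noteq> 0"
    by auto
  have "\<bar>sin u\<bar> powr - \<kappa> \<le> (\<bar>v\<bar> / 2) powr - \<kappa>"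
    unfolding \<open>\<bar>sin u\<bar> = \<bar>sin v\<bar>\<close> using half_le_sin[OF v] v0 assms
    by (intro powr_mono2') auto
  also have "\<dots> = 2 powr \<kappa> * \<bar>v\<bar> powr - \<kappa>"
    by (simp add: powr_divide powr_minus field_simps)
  also have "\<dots> \<le> 2 powr 1 * \<bar>v\<bar> powr - \<kappa>"
    using assms by (intro mult_right_mono powr_mono) auto
  also have "\<dots> \<le> (\<Sum>k\<in>{-2..2::int}. 2 * \<bar>u - k * pi\<bar> powr - \<kappa>)"
    unfolding v_def using k by (subst powr_one) (auto intro!: member_le_sum)
  finally show ?thesis .
qed

text \<open>
  Translating one of the two functions by \<open>k\<pi>\<close> does not change its norm, so every summand of
  \<open>sin_powr_le_sum_shifts\<close> is an instance of \<open>HLS_diagonal\<close>; the factor 20 is five shifts, times 2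
  from that lemma, times 2 from the sum of two halves.
\<close>

theorem HLS_circle:
  fixes f :: "real \<Rightarrow> real"
  assumes \<kappa>: "0 < \<kappa>" "\<kappa> < 1" and N: "N > 0"
    and [measurable]: "f \<in> borel_measurable borel" and nn: "\<And>x. f x \<ge> 0"
    and fN: "(\<integral>\<^sup>+x\<in>{0..<2 * pi}. ennreal (f x powr (2 / (2 - \<kappa>))) \<partial>lborel) \<le> ennreal N"
  shows "(\<integral>\<^sup>+x\<in>{0..<2 * pi}. (\<integral>\<^sup>+y\<in>{0..<2 * pi}.
        ennreal (f x * f y * \<bar>sin (x - y)\<bar> powr - \<kappa>) \<partial>lborel) \<partial>lborel)
    \<le> ennreal (20 * (2 / (1 - \<kappa>) + 2 powr (\<kappa> / 2)) * N powr (2 - \<kappa>))"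
    (is "?L \<le> ennreal (20 * ?K * ?N)")
proof -
  define g where "g x = f x * indicator {0..<2 * pi} x" for x
  define h where "h k x = g (x - of_int k * pi)" for k :: int and x
  have [measurable]: "g \<in> borel_measurable borel"
    unfolding g_def by measurable
  have [measurable]: "h k \<in> borel_measurable borel" for k
    unfolding h_def by measurable
  have gnn: "g x \<ge> 0" for x
    using nn by (simp add: g_def)
  have gN: "(\<integral>\<^sup>+x. ennreal (g x powr (2 / (2 - \<kappa>))) \<partial>lborel) \<le> ennreal N"
    using fN by (rule order.trans[rotated]) (auto simp: g_def indicator_def intro!: nn_integral_mono)
  have hN: "(\<integral>\<^sup>+x. ennreal (h k x powr (2 / (2 - \<kappa>))) \<partial>lborel) \<le> ennreal N" for k
    using gN nn_integral_translate[of "\<lambda>x. ennreal (g x powr (2 / (2 - \<kappa>)))" "- (k * pi)"]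
    by (simp add: h_def)
  have bd: "(\<integral>\<^sup>+x. \<integral>\<^sup>+y. ennreal (g x * g y * \<bar>x - y - k * pi\<bar> powr - \<kappa>) \<partial>lborel \<partial>lborel)
      \<le> ennreal (2 * ?K * ?N)" for k :: int
  proof -
    have "(\<integral>\<^sup>+y. ennreal (g x * g y * \<bar>x - y - k * pi\<bar> powr - \<kappa>) \<partial>lborel)
        = (\<integral>\<^sup>+y. ennreal (g x * h k y * \<bar>x - y\<bar> powr - \<kappa>) \<partial>lborel)" for x
      using nn_integral_translate[of "\<lambda>y. ennreal (g x * h k y * \<bar>x - y\<bar> powr - \<kappa>)" "k * pi"]
      by (simp add: h_def algebra_simps)
    then show ?thesis
      using HLS_diagonal[of \<kappa> N g "h k"] \<kappa> N gnn gN hN by (simp add: h_def)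
  qed
  have "?L = (\<integral>\<^sup>+x. \<integral>\<^sup>+y. ennreal (g x * g y * \<bar>sin (x - y)\<bar> powr - \<kappa>) \<partial>lborel \<partial>lborel)"
    by (auto intro!: nn_integral_cong simp: g_def indicator_def)
  also have "\<dots> \<le> (\<integral>\<^sup>+x. \<integral>\<^sup>+y. (\<Sum>k\<in>{-2..2::int}. 2 * ennreal (g x * g y * \<bar>x - y - k * pi\<bar> powr - \<kappa>)) \<partial>lborel \<partial>lborel)"
  proof (intro nn_integral_mono)
    fix x y
    show "ennreal (g x * g y * \<bar>sin (x - y)\<bar> powr - \<kappa>)
        \<le> (\<Sum>k\<in>{-2..2::int}. 2 * ennreal (g x * g y * \<bar>x - y - k * pi\<bar> powr - \<kappa>))"
    proof (cases "x \<in> {0..<2 * pi} \<and> y \<in> {0..<2 * pi}")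
      case True
      then have "\<bar>sin (x - y)\<bar> powr - \<kappa> \<le> (\<Sum>k\<in>{-2..2::int}. 2 * \<bar>x - y - k * pi\<bar> powr - \<kappa>)"
        using \<kappa> by (intro sin_powr_le_sum_shifts) auto
      then have "g x * g y * \<bar>sin (x - y)\<bar> powr - \<kappa> \<le> g x * g y * (\<Sum>k\<in>{-2..2::int}. 2 * \<bar>x - y - k * pi\<bar> powr - \<kappa>)"
        by (intro mult_left_mono) (simp_all add: gnn)
      also have "\<dots> = (\<Sum>k\<in>{-2..2::int}. 2 * (g x * g y * \<bar>x - y - k * pi\<bar> powr - \<kappa>))"
        by (simp only: sum_distrib_left mult_ac)
      finally have "ennreal (g x * g y * \<bar>sin (x - y)\<bar> powr - \<kappa>)
          \<le> ennreal (\<Sum>k\<in>{-2..2::int}. 2 * (g x * g y * \<bar>x - y - k * pi\<bar> powr - \<kappa>))"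
        by (rule ennreal_leI)
      then show ?thesis
        by (simp add: sum_ennreal[symmetric] gnn ennreal_mult' del: sum_ennreal)
    qed (auto simp: g_def)
  qed
  also have "\<dots> = (\<Sum>k\<in>{-2..2::int}. 2 * (\<integral>\<^sup>+x. \<integral>\<^sup>+y. ennreal (g x * g y * \<bar>x - y - k * pi\<bar> powr - \<kappa>) \<partial>lborel \<partial>lborel))"
    by (simp add: nn_integral_sum nn_integral_cmult)
  also have "\<dots> \<le> (\<Sum>k\<in>{-2..2::int}. 2 * ennreal (2 * ?K * ?N))"
    by (intro sum_mono mult_left_mono bd) simp
  also have "\<dots> = ennreal (20 * ?K * ?N)"
    using \<kappa> by (simp add: ennreal_mult'[symmetric] ennreal_numeral[symmetric] del: ennreal_numeral)
  finally show ?thesis .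
qed


section \<open>Sums of two points of the circle\<close>

definition circ :: "real \<Rightarrow> real^2" where
  "circ \<theta> = vector [cos \<theta>, sin \<theta>]"

lemma measurable_circ [measurable]: "circ \<in> borel_measurable borel"
  unfolding circ_def by measurable

lemma nn_integral_mono_emeasure:
  assumes sets: "sets M = sets N" and le: "\<And>A. A \<in> sets M \<Longrightarrow> emeasure M A \<le> emeasure N A"
    and f: "f \<in> borel_measurable M"
  shows "(\<integral>\<^sup>+x. f x \<partial>M) \<le> (\<integral>\<^sup>+x. f x \<partial>N)"
  using f
proof (induction rule: borel_measurable_induct)
  case (cong f g)
  then show ?case
    using sets_eq_imp_space_eq[OF sets]
    by (metis nn_integral_cong)
next
  case (set A)
  then show ?case
    using sets le by simp
next
  case (mult u v)
  then have "u \<in> borel_measurable N"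
    using sets by (simp cong: measurable_cong_sets)
  with mult show ?case
    by (simp add: nn_integral_cmult mult_left_mono)
next
  case (add u v)
  then have "u \<in> borel_measurable N" "v \<in> borel_measurable N"
    using sets by (simp_all cong: measurable_cong_sets)
  with add show ?case
    by (simp add: nn_integral_add add_mono)
next
  case (seq U)
  then have "U i \<in> borel_measurable N" for i
    using sets by (simp cong: measurable_cong_sets)
  with seq show ?case
    by (simp add: nn_integral_monotone_convergence_SUP image_comp SUP_mono')
qed

lemma cis_inj_on_period:
  assumes "cis a = cis b" "a \<in> {0..<2 * pi}" "b \<in> {0..<2 * pi}"
  shows "a = b"
proof -
  have "sin a = sin b \<and> cos a = cos b"
    using assms(1) by (simp add: complex_eq_iff)
  then obtain n :: int where n: "a = b + 2 * pi * n"
    unfolding sin_cos_eq_iff by blast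
  then have "\<bar>2 * pi * n\<bar> < 2 * pi * 1"
    using assms(2,3) by auto
  then have "\<bar>real_of_int n\<bar> < 1"
    unfolding abs_mult by simp
  then show ?thesis
    using n by simp
qed

text \<open>
  For unimodular \<open>z\<close> and \<open>z'\<close> one has \<open>z z' cnj(z + z') = z + z'\<close>.  A nonzero sum thus determines the
  product, and the two numbers are the roots of one quadratic polynomial.
\<close>

lemma unit_pair_determined_by_sum:
  fixes z z' u u' :: complex
  assumes "norm z = 1" "norm z' = 1" "norm u = 1" "norm u' = 1"
    and eq: "z + z' = u + u'" and ne: "z + z' \<noteq> 0"
  shows "z = u \<and> z' = u' \<or> z = u' \<and> z' = u"
proof -
  have *: "z * z' * cnj (z + z') = z + z'" if "norm z = 1" "norm z' = 1" for z z' :: complex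
  proof -
    have "z * cnj z = 1" "z' * cnj z' = 1"
      using that by (simp_all add: complex_norm_square[symmetric])
    moreover have "z * z' * cnj (z + z') = (z * cnj z) * z' + (z' * cnj z') * z"
      by (simp add: algebra_simps)
    ultimately show ?thesis
      by simp
  qed
  have "z * z' * cnj (z + z') = u * u' * cnj (z + z')"
    using *[of z z'] *[of u u'] assms by metis
  moreover have "cnj (z + z') \<noteq> 0"
    using ne complex_cnj_zero_iff by blast
  ultimately have "z * z' = u * u'"
    using mult_right_cancel by blast
  then have "(z - u) * (z - u') = 0"
    using eq by algebra
  then show ?thesis
    using eq by auto
qed

text \<open>
  Half of the torus, without the antipodal pairs: their sum is zero and does not determine the pair.
\<close>

definition ordered_angles :: "(real^2) set" where
  "ordered_angles = {p. 0 \<le> p $ 2 \<and> p $ 2 < p $ 1 \<and> p $ 1 < 2 * pi \<and> p $ 1 - p $ 2 \<noteq> pi}"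

definition circ_sum :: "real^2 \<Rightarrow> real^2" where
  "circ_sum p = circ (p $ 1) + circ (p $ 2)"

lemma inj_on_circ_sum: "inj_on circ_sum ordered_angles"
proof (rule inj_onI)
  fix p q
  assume p: "p \<in> ordered_angles" and q: "q \<in> ordered_angles" and eq: "circ_sum p = circ_sum q"
  have sum_eq: "cis (p $ 1) + cis (p $ 2) = cis (q $ 1) + cis (q $ 2)"
    using eq by (simp add: circ_sum_def circ_def complex_eq_iff vec_eq_iff forall_2)
  have ne: "cis (p $ 1) + cis (p $ 2) \<noteq> 0"
  proof
    assume "cis (p $ 1) + cis (p $ 2) = 0"
    then have "cis (p $ 1) = cis (p $ 2 + pi)"
      by (simp add: complex_eq_iff)
    then have "sin (p $ 1) = sin (p $ 2 + pi) \<and> cos (p $ 1) = cos (p $ 2 + pi)"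
      by (auto simp: complex_eq_iff)
    then obtain n :: int where n: "p $ 1 = p $ 2 + pi + 2 * pi * n"
      unfolding sin_cos_eq_iff by blast
    then have "pi * (1 + 2 * real_of_int n) = p $ 1 - p $ 2"
      by (simp add: algebra_simps)
    then have "0 < pi * (1 + 2 * real_of_int n)" "pi * (1 + 2 * real_of_int n) < pi * 2"
      using p by (auto simp: ordered_angles_def)
    then have "0 < 1 + 2 * real_of_int n" "1 + 2 * real_of_int n < 2"
      by (simp_all add: zero_less_mult_iff)
    then have "n = 0"
      by linarith
    then show False
      using n p by (simp add: ordered_angles_def)
  qed
  have "cis (p $ 1) = cis (q $ 1) \<and> cis (p $ 2) = cis (q $ 2)
      \<or> cis (p $ 1) = cis (q $ 2) \<and> cis (p $ 2) = cis (q $ 1)"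
    by (rule unit_pair_determined_by_sum[OF _ _ _ _ sum_eq ne]) simp_all
  moreover have "p $ i \<in> {0..<2 * pi}" "q $ i \<in> {0..<2 * pi}" for i
    using p q exhaust_2[of i] by (auto simp: ordered_angles_def)
  ultimately have "p $ 1 = q $ 1 \<and> p $ 2 = q $ 2 \<or> p $ 1 = q $ 2 \<and> p $ 2 = q $ 1"
    using cis_inj_on_period by blast
  then show "p = q"
    using p q by (auto simp: ordered_angles_def vec_eq_iff forall_2)
qed

lemma measurable_vec_nth_borel [measurable]: "(\<lambda>p. p $ i) \<in> borel_measurable (borel :: (real^'n::finite) measure)"
  by (intro borel_measurable_continuous_onI continuous_intros)

lemma ordered_angles_sets [measurable]: "ordered_angles \<in> sets borel"
  unfolding ordered_angles_def by measurable

lemma measurable_circ_sum [measurable]: "circ_sum \<in> borel_measurable borel"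
  unfolding circ_sum_def[abs_def] by measurable

text \<open>
  The change of variables theorem computes the measure of the image of \<open>circ_sum\<close>, on a set where
  it is injective, as the integral of the Jacobian; the image is contained in \<open>B\<close>.
\<close>

lemma emeasure_circ_sum_le:
  assumes [measurable]: "B \<in> sets borel"
  shows "(\<integral>\<^sup>+p\<in>ordered_angles \<inter> circ_sum -` B. ennreal \<bar>sin (p $ 1 - p $ 2)\<bar> \<partial>lborel) \<le> emeasure lborel B"
proof -
  define S where "S = ordered_angles \<inter> circ_sum -` B"
  \<comment> \<open>The derivative of \<open>circ_sum\<close>; its determinant is the sine of the difference of the angles.\<close>
  define D :: "real^2 \<Rightarrow> real^2 \<Rightarrow> real^2" where
    "D p h = vector [- sin (p $ 1) * h $ 1 - sin (p $ 2) * h $ 2, cos (p $ 1) * h $ 1 + cos (p $ 2) * h $ 2]" for p h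
  have S_borel [measurable]: "S \<in> sets borel"
    using measurable_sets[OF measurable_circ_sum assms] by (simp add: S_def)
  have S_leb: "S \<in> sets lebesgue"
    using S_borel by simp
  have der: "(circ_sum has_derivative D p) (at p within S)" for p
  proof -
    have "((\<lambda>p. (cos (p $ 1) + cos (p $ 2)) *\<^sub>R axis 1 1 + (sin (p $ 1) + sin (p $ 2)) *\<^sub>R (axis 2 1 :: real^2))
        has_derivative (\<lambda>h. (- sin (p $ 1) * h $ 1 - sin (p $ 2) * h $ 2) *\<^sub>R axis 1 1
          + (cos (p $ 1) * h $ 1 + cos (p $ 2) * h $ 2) *\<^sub>R axis 2 1)) (at p within S)"
    proof -
      have nth: "((\<lambda>p. p $ i) has_derivative (\<lambda>h. h $ i)) (at p within S)" for i :: 2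
        by (intro bounded_linear_imp_has_derivative bounded_linear_vec_nth)
      have cos: "((\<lambda>p. cos (p $ i)) has_derivative (\<lambda>h. h $ i * - sin (p $ i))) (at p within S)"
        and sin: "((\<lambda>p. sin (p $ i)) has_derivative (\<lambda>h. h $ i * cos (p $ i))) (at p within S)" for i :: 2
        by (rule DERIV_compose_FDERIV[OF DERIV_cos nth] DERIV_compose_FDERIV[OF DERIV_sin nth])+
      show ?thesis
        by (rule has_derivative_eq_rhs[OF has_derivative_add[OF
              has_derivative_scaleR_left[OF has_derivative_add[OF cos cos]]
              has_derivative_scaleR_left[OF has_derivative_add[OF sin sin]]]])
          (simp add: fun_eq_iff mult.commute)
    qed
    moreover have "circ_sum = (\<lambda>p. (cos (p $ 1) + cos (p $ 2)) *\<^sub>R axis 1 1 + (sin (p $ 1) + sin (p $ 2)) *\<^sub>R (axis 2 1 :: real^2))"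
      by (auto simp: circ_sum_def circ_def vec_eq_iff forall_2 axis_def)
    moreover have "D p = (\<lambda>h. (- sin (p $ 1) * h $ 1 - sin (p $ 2) * h $ 2) *\<^sub>R axis 1 1
          + (cos (p $ 1) * h $ 1 + cos (p $ 2) * h $ 2) *\<^sub>R axis 2 1)"
      by (auto simp: D_def vec_eq_iff forall_2 axis_def)
    ultimately show ?thesis
      by simp
  qed
  have det: "\<bar>det (matrix (D p))\<bar> = \<bar>sin (p $ 1 - p $ 2)\<bar>" for p
  proof -
    have "det (matrix (D p)) = - sin (p $ 1 - p $ 2)"
      by (simp add: D_def det_2 matrix_def axis_def sin_diff)
    then show ?thesis
      by simp
  qed
  have "S \<subseteq> cbox 0 (vec (2 * pi))"
    by (auto simp: S_def ordered_angles_def mem_box_cart forall_2)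
  then have Sfin: "emeasure lborel S < \<infinity>"
    using emeasure_mono[of S "cbox 0 (vec (2 * pi))" lborel] emeasure_lborel_cbox_finite
    by (metis (no_types, lifting) borel_closed closed_cbox infinity_ennreal_def order.strict_trans1 sets_lborel)
  have fin: "(\<integral>\<^sup>+p\<in>S. ennreal \<bar>sin (p $ 1 - p $ 2)\<bar> \<partial>lborel) < \<infinity>"
  proof -
    have "(\<integral>\<^sup>+p\<in>S. ennreal \<bar>sin (p $ 1 - p $ 2)\<bar> \<partial>lborel) \<le> (\<integral>\<^sup>+p. indicator S p \<partial>lborel)"
      by (intro nn_integral_mono) (auto simp: indicator_def)
    then show ?thesis
      using Sfin by (simp add: order.strict_trans1)
  qed
  have inj: "inj_on circ_sum S"
    using inj_on_circ_sum by (rule inj_on_subset) (auto simp: S_def)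
  have int: "(\<lambda>p. \<bar>sin (p $ 1 - p $ 2)\<bar>) integrable_on S"
    and val: "(\<integral>\<^sup>+p\<in>S. ennreal \<bar>sin (p $ 1 - p $ 2)\<bar> \<partial>lborel) = ennreal (integral S (\<lambda>p. \<bar>sin (p $ 1 - p $ 2)\<bar>))"
  proof -
    define f where "f p = \<bar>sin (p $ 1 - p $ 2)\<bar> * indicator S p" for p
    have f: "f \<in> borel_measurable borel" "f p \<ge> 0" for p
      unfolding f_def by simp_all
    have f_if: "f = (\<lambda>p. if p \<in> S then \<bar>sin (p $ 1 - p $ 2)\<bar> else 0)"
      by (auto simp: f_def)
    have nn: "(\<integral>\<^sup>+p. ennreal (f p) \<partial>lborel) = (\<integral>\<^sup>+p\<in>S. ennreal \<bar>sin (p $ 1 - p $ 2)\<bar> \<partial>lborel)"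
      by (auto intro!: nn_integral_cong simp: f_def indicator_def)
    have fin': "(\<integral>\<^sup>+p. ennreal (f p) \<partial>lborel) < \<infinity>"
      using fin by (simp only: nn)
    have "f integrable_on UNIV"
      by (rule nn_integral_integrable_on[OF f fin'])
    then show "(\<lambda>p. \<bar>sin (p $ 1 - p $ 2)\<bar>) integrable_on S"
      unfolding f_if integrable_restrict_UNIV .
    show "(\<integral>\<^sup>+p\<in>S. ennreal \<bar>sin (p $ 1 - p $ 2)\<bar> \<partial>lborel) = ennreal (integral S (\<lambda>p. \<bar>sin (p $ 1 - p $ 2)\<bar>))"
      using nn_integral_lborel_eq_integral[OF f fin'] unfolding nn unfolding f_if integral_restrict_UNIV .
  qed
  have int': "(\<lambda>p. \<bar>det (matrix (D p))\<bar>) integrable_on S"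
    by (simp only: det int)
  have lm: "circ_sum ` S \<in> lmeasurable"
    using measurable_differentiable_image_eq[OF S_leb der inj] int' by blast
  have "(\<integral>\<^sup>+p\<in>S. ennreal \<bar>sin (p $ 1 - p $ 2)\<bar> \<partial>lborel) = ennreal (measure lebesgue (circ_sum ` S))"
    by (simp only: val measure_differentiable_image_eq[OF S_leb der inj int'] det)
  also have "\<dots> = emeasure lebesgue (circ_sum ` S)"
    by (rule emeasure_eq_measure2[OF lm, symmetric])
  also have "\<dots> \<le> emeasure lebesgue B"
    by (rule emeasure_mono) (auto simp: S_def)
  also have "\<dots> = emeasure lborel B"
    by simp
  finally show ?thesis
    by (simp add: S_def)
qed

lemma nn_integral_circ_sum_le:
  assumes [measurable]: "F \<in> borel_measurable borel"
  shows "(\<integral>\<^sup>+p\<in>ordered_angles. F (circ_sum p) * ennreal \<bar>sin (p $ 1 - p $ 2)\<bar> \<partial>lborel) \<le> (\<integral>\<^sup>+w. F w \<partial>lborel)"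
proof -
  define M where "M = distr (density lborel (\<lambda>p. ennreal \<bar>sin (p $ 1 - p $ 2)\<bar> * indicator ordered_angles p)) borel circ_sum"
  have le: "(\<integral>\<^sup>+w. F w \<partial>M) \<le> (\<integral>\<^sup>+w. F w \<partial>lborel)"
  proof (rule nn_integral_mono_emeasure)
    fix A assume "A \<in> sets M"
    then have [measurable]: "A \<in> sets borel"
      by (simp add: M_def)
    have [measurable]: "circ_sum -` A \<in> sets borel"
      using measurable_sets[OF measurable_circ_sum \<open>A \<in> sets borel\<close>] by simp
    have "emeasure M A = (\<integral>\<^sup>+p\<in>ordered_angles \<inter> circ_sum -` A. ennreal \<bar>sin (p $ 1 - p $ 2)\<bar> \<partial>lborel)"
      by (simp add: M_def emeasure_distr emeasure_density indicator_inter_arith mult.assoc)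
    also have "\<dots> \<le> emeasure lborel A"
      by (rule emeasure_circ_sum_le) measurable
    finally show "emeasure M A \<le> emeasure lborel A" .
  qed (simp_all add: M_def)
  then show ?thesis
    by (simp add: M_def nn_integral_distr nn_integral_density mult_ac)
qed

text \<open>
  The diagonal and the antipodal pairs are harmless because the Jacobian vanishes there.  The rest
  of the torus is \<open>ordered_angles\<close> and its reflection, which explains the factor 2.
\<close>

theorem nn_integral_sum_circle_le:
  assumes [measurable]: "F \<in> borel_measurable borel"
  shows "(\<integral>\<^sup>+x\<in>{0..<2 * pi}. (\<integral>\<^sup>+y\<in>{0..<2 * pi}.
      F (circ x + circ y) * ennreal \<bar>sin (x - y)\<bar> \<partial>lborel) \<partial>lborel) \<le> 2 * (\<integral>\<^sup>+w. F w \<partial>lborel)"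
proof -
  define G where "G x y = F (circ x + circ y) * ennreal \<bar>sin (x - y)\<bar> * indicator ordered_angles (vector [x, y] :: real^2)" for x y
  have [measurable]: "(\<lambda>(x, y). G x y) \<in> borel_measurable (lborel \<Otimes>\<^sub>M lborel)"
    unfolding G_def by measurable
  have half: "(\<integral>\<^sup>+x. \<integral>\<^sup>+y. G x y \<partial>lborel \<partial>lborel) \<le> (\<integral>\<^sup>+w. F w \<partial>lborel)"
    using nn_integral_circ_sum_le[OF assms]
    by (subst (asm) nn_integral_plane) (simp_all add: G_def circ_sum_def)
  have "(\<integral>\<^sup>+x\<in>{0..<2 * pi}. (\<integral>\<^sup>+y\<in>{0..<2 * pi}.
      F (circ x + circ y) * ennreal \<bar>sin (x - y)\<bar> \<partial>lborel) \<partial>lborel)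
    = (\<integral>\<^sup>+x. \<integral>\<^sup>+y. F (circ x + circ y) * ennreal \<bar>sin (x - y)\<bar> * indicator {0..<2 * pi} x * indicator {0..<2 * pi} y \<partial>lborel \<partial>lborel)"
    by (auto intro!: nn_integral_cong simp: indicator_def)
  also have "\<dots> \<le> (\<integral>\<^sup>+x. \<integral>\<^sup>+y. G x y + G y x \<partial>lborel \<partial>lborel)"
  proof (intro nn_integral_mono)
    fix x y
    consider "x \<notin> {0..<2 * pi} \<or> y \<notin> {0..<2 * pi} \<or> sin (x - y) = 0"
      | "x \<in> {0..<2 * pi}" "y \<in> {0..<2 * pi}" "sin (x - y) \<noteq> 0"
      by blast
    then show "F (circ x + circ y) * ennreal \<bar>sin (x - y)\<bar> * indicator {0..<2 * pi} x * indicator {0..<2 * pi} y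
        \<le> G x y + G y x"
    proof cases
      case 2
      have ne: "x - y \<noteq> pi" "y - x \<noteq> pi" "x \<noteq> y"
      proof -
        show "x - y \<noteq> pi" "x \<noteq> y"
          using 2(3) by auto
        have "sin (y - x) \<noteq> 0"
          using 2(3) sin_minus[of "x - y"] by simp
        then show "y - x \<noteq> pi"
          by auto
      qed
      have abs_sin: "\<bar>sin (y - x)\<bar> = \<bar>sin (x - y)\<bar>"
        using sin_minus[of "x - y"] by simp
      show ?thesis
      proof (cases "y < x")
        case True
        then have "vector [x, y] \<in> ordered_angles"
          using 2 ne by (simp add: ordered_angles_def)
        then show ?thesis
          using 2 by (simp add: G_def)
      next
        case False
        then have "vector [y, x] \<in> ordered_angles"
          using 2 ne by (simp add: ordered_angles_def)
        then show ?thesis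
          using 2 by (simp add: G_def abs_sin add.commute)
      qed
    qed auto
  qed
  also have "\<dots> = (\<integral>\<^sup>+x. \<integral>\<^sup>+y. G x y \<partial>lborel \<partial>lborel) + (\<integral>\<^sup>+x. \<integral>\<^sup>+y. G y x \<partial>lborel \<partial>lborel)"
    by (simp add: nn_integral_add)
  also have "(\<integral>\<^sup>+x. \<integral>\<^sup>+y. G y x \<partial>lborel \<partial>lborel) = (\<integral>\<^sup>+y. \<integral>\<^sup>+x. G y x \<partial>lborel \<partial>lborel)"
    by (rule lborel_pair.Fubini') measurable
  also have "(\<integral>\<^sup>+x. \<integral>\<^sup>+y. G x y \<partial>lborel \<partial>lborel) + (\<integral>\<^sup>+y. \<integral>\<^sup>+x. G y x \<partial>lborel \<partial>lborel)
      \<le> (\<integral>\<^sup>+w. F w \<partial>lborel) + (\<integral>\<^sup>+w. F w \<partial>lborel)"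
    by (intro add_mono half)
  finally show ?thesis
    unfolding mult_2 .
qed


section \<open>The Fourier transform of an integrable function\<close>

definition character :: "real^'n::finite \<Rightarrow> real^'n \<Rightarrow> complex" where
  "character x \<xi> = exp (- 2 * of_real pi * \<i> * of_real (x \<bullet> \<xi>))"

text \<open>
  The Fourier transform of the image of \<open>b \<nu>\<close> under \<open>z\<close>: the Fourier extension operator, with a
  parametrised frequency set.
\<close>

definition extension :: "'a measure \<Rightarrow> ('a \<Rightarrow> complex) \<Rightarrow> ('a \<Rightarrow> real^'n::finite) \<Rightarrow> real^'n \<Rightarrow> complex" where
  "extension \<nu> b z \<xi> = (LINT \<omega>|\<nu>. character (z \<omega>) \<xi> * b \<omega>)"

lemma character_cis: "character x \<xi> = cis (- 2 * pi * (x \<bullet> \<xi>))"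
  by (simp add: character_def cis_conv_exp mult_ac)

lemma norm_character [simp]: "norm (character x \<xi>) = 1"
  by (simp add: character_cis)

lemma character_add: "character (x + y) \<xi> = character x \<xi> * character y \<xi>"
  by (simp add: character_cis cis_mult inner_add_left algebra_simps)

lemma character_minus: "character (- x) \<xi> = cnj (character x \<xi>)"
  by (simp add: character_cis cis_cnj)

lemma character_commute: "character x \<xi> = character \<xi> x"
  by (simp add: character_def inner_commute)

lemma measurable_character [measurable (raw)]:
  assumes [measurable]: "f \<in> borel_measurable M" "g \<in> borel_measurable M"
  shows "(\<lambda>x. character (f x) (g x)) \<in> borel_measurable M"
  unfolding character_def by measurable

lemma measurable_cnj [measurable]: "cnj \<in> borel_measurable borel"
  by (intro borel_measurable_continuous_onI continuous_intros)

lemma fourier_eq: "fourier f \<xi> = (LINT x|lborel. character x \<xi> * f x)"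
  by (simp add: fourier_def character_def)

lemma norm_fourier_le: "norm (fourier f \<xi>) \<le> (LINT x|lborel. norm (f x))"
  unfolding fourier_eq by (rule order.trans[OF integral_norm_bound]) (simp add: norm_mult)

lemma norm_integral_le_nn_integral:
  fixes f :: "'a \<Rightarrow> complex"
  shows "ennreal (norm (integral\<^sup>L M f)) \<le> (\<integral>\<^sup>+x. ennreal (norm (f x)) \<partial>M)"
  by (cases "integrable M f") (auto simp: integral_norm_bound_ennreal not_integrable_integral_eq)

lemma integrable_character_mult:
  assumes "integrable M b" and [measurable]: "z \<in> borel_measurable M"
  shows "integrable M (\<lambda>\<omega>. character (z \<omega>) \<xi> * b \<omega>)"
  using assms(1)
proof (rule Bochner_Integration.integrable_bound)
  show "(\<lambda>\<omega>. character (z \<omega>) \<xi> * b \<omega>) \<in> borel_measurable M"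
    using assms(1) by measurable
qed (simp add: norm_mult)

lemma continuous_fourier:
  fixes f :: "real^'n::finite \<Rightarrow> complex"
  assumes f: "integrable lborel f"
  shows "continuous_on UNIV (fourier f)"
  unfolding continuous_on_sequentially comp_def fourier_eq
proof (intro ballI allI impI, elim conjE)
  fix u :: "nat \<Rightarrow> real^'n" and \<xi>
  assume u: "u \<longlonglongrightarrow> \<xi>"
  have [measurable]: "f \<in> borel_measurable lborel"
    using f by simp
  show "(\<lambda>n. LINT x|lborel. character x (u n) * f x) \<longlonglongrightarrow> (LINT x|lborel. character x \<xi> * f x)"
  proof (rule integral_dominated_convergence)
    show "integrable lborel (\<lambda>x. norm (f x))"
      using f by simp
    show "AE x in lborel. (\<lambda>n. character x (u n) * f x) \<longlonglongrightarrow> character x \<xi> * f x"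
      unfolding character_def by (intro AE_I2 tendsto_intros u)
  qed (simp_all add: norm_mult)
qed

lemma measurable_fourier [measurable]:
  assumes "integrable lborel f"
  shows "fourier f \<in> borel_measurable borel"
  by (rule borel_measurable_continuous_onI[OF continuous_fourier[OF assms]])

text \<open>
  By Fubini's theorem, extension is the transpose of evaluating the Fourier transform at the
  frequencies \<open>z\<close>.
\<close>

lemma integral_mult_extension:
  fixes f :: "real^'n::finite \<Rightarrow> complex"
  assumes "finite_measure \<nu>" and f: "integrable lborel f"
    and [measurable]: "b \<in> borel_measurable \<nu>" "z \<in> borel_measurable \<nu>"
    and B: "\<And>\<omega>. norm (b \<omega>) \<le> B"
  shows "(LINT \<xi>|lborel. f \<xi> * extension \<nu> b z \<xi>) = (LINT \<omega>|\<nu>. b \<omega> * fourier f (z \<omega>))"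
proof -
  interpret finite_measure \<nu> by fact
  interpret pair_sigma_finite lborel \<nu> ..
  have [measurable]: "f \<in> borel_measurable lborel"
    using f by simp
  have b: "integrable \<nu> b"
    by (rule integrable_const_bound[where B = B]) (use B in auto)
  have "integrable (lborel \<Otimes>\<^sub>M \<nu>) (\<lambda>(\<xi>, \<omega>). f \<xi> * (character (z \<omega>) \<xi> * b \<omega>))"
  proof (rule Fubini_integrable)
    have "norm (f \<xi>) * (LINT \<omega>|\<nu>. norm (b \<omega>)) = (LINT \<omega>|\<nu>. norm (f \<xi> * (character (z \<omega>) \<xi> * b \<omega>)))" for \<xi>
      by (simp add: norm_mult)
    then show "integrable lborel (\<lambda>\<xi>. LINT \<omega>|\<nu>. norm (case (\<xi>, \<omega>) of (\<xi>, \<omega>) \<Rightarrow> f \<xi> * (character (z \<omega>) \<xi> * b \<omega>)))"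
      using integrable_mult_left[OF integrable_norm[OF f], of "LINT \<omega>|\<nu>. norm (b \<omega>)"] by simp
    show "AE \<xi> in lborel. integrable \<nu> (\<lambda>\<omega>. case (\<xi>, \<omega>) of (\<xi>, \<omega>) \<Rightarrow> f \<xi> * (character (z \<omega>) \<xi> * b \<omega>))"
      by (intro AE_I2) (simp add: integrable_character_mult b)
  qed measurable
  then have "(LINT \<omega>|\<nu>. LINT \<xi>|lborel. f \<xi> * (character (z \<omega>) \<xi> * b \<omega>))
      = (LINT \<xi>|lborel. LINT \<omega>|\<nu>. f \<xi> * (character (z \<omega>) \<xi> * b \<omega>))"
    by (rule Fubini_integral)
  moreover have "(LINT \<xi>|lborel. f \<xi> * (character (z \<omega>) \<xi> * b \<omega>)) = b \<omega> * fourier f (z \<omega>)" for \<omega>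
    unfolding fourier_eq by (subst integral_mult_right_zero[symmetric]) (simp add: mult_ac character_commute)
  moreover have "(LINT \<omega>|\<nu>. f \<xi> * (character (z \<omega>) \<xi> * b \<omega>)) = f \<xi> * extension \<nu> b z \<xi>" for \<xi>
    by (simp only: extension_def integral_mult_right_zero)
  ultimately show ?thesis
    by (simp only:)
qed

section \<open>Gaussians\<close>

definition gauss :: "real \<Rightarrow> real^2 \<Rightarrow> real" where
  "gauss \<sigma> x = normal_density 0 \<sigma> (x $ 1) * normal_density 0 \<sigma> (x $ 2)"

lemma measurable_gauss [measurable]: "gauss \<sigma> \<in> borel_measurable borel"
  unfolding gauss_def by measurable

lemma gauss_nonneg [simp]: "gauss \<sigma> x \<ge> 0"
  by (simp add: gauss_def)

lemma gauss_eq: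
  assumes "\<sigma> > 0"
  shows "gauss \<sigma> x = exp (- (norm x)\<^sup>2 / (2 * \<sigma>\<^sup>2)) / (2 * pi * \<sigma>\<^sup>2)"
proof -
  have "(norm x)\<^sup>2 = (x $ 1)\<^sup>2 + (x $ 2)\<^sup>2"
    by (simp add: norm_vec_def L2_set_def sum_2)
  then show ?thesis
    by (simp add: gauss_def normal_density_def exp_add[symmetric] add_divide_distrib diff_divide_distrib)
qed

lemma nn_integral_normal_density:
  "\<sigma> > 0 \<Longrightarrow> (\<integral>\<^sup>+x. ennreal (normal_density 0 \<sigma> x) \<partial>lborel) = 1"
  by (simp add: nn_integral_eq_integral)

lemma nn_integral_gauss:
  assumes "\<sigma> > 0"
  shows "(\<integral>\<^sup>+x. ennreal (gauss \<sigma> x) \<partial>lborel) = 1"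
  using assms
  by (subst nn_integral_plane)
    (simp_all add: gauss_def ennreal_mult nn_integral_cmult nn_integral_multc nn_integral_normal_density)

lemma fourier_normal_density:
  assumes \<sigma>: "\<sigma> > 0"
  shows "(LINT x|lborel. cis (- 2 * pi * (t * x)) * of_real (normal_density 0 \<sigma> x))
    = of_real (exp (- (2 * pi * \<sigma> * t)\<^sup>2 / 2))"
proof -
  define s where "s = - 2 * pi * \<sigma> * t"
  have "(LINT x|lborel. cis (- 2 * pi * (t * x)) * of_real (normal_density 0 \<sigma> x))
      = \<bar>\<sigma>\<bar> *\<^sub>R (LINT x|lborel. cis (- 2 * pi * (t * (0 + \<sigma> * x))) * of_real (normal_density 0 \<sigma> (0 + \<sigma> * x)))"
    using \<sigma> by (intro lborel_integral_real_affine) simp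
  also have "\<dots> = (LINT x|lborel. std_normal_density x *\<^sub>R iexp (s * x))"
  proof -
    have "\<sigma> * normal_density 0 \<sigma> (\<sigma> * x) = std_normal_density x" for x
      using \<sigma> by (simp add: normal_density_def real_sqrt_mult power_mult_distrib)
    then have 1: "of_real \<sigma> * (cis a * of_real (normal_density 0 \<sigma> (\<sigma> * x)))
        = of_real (std_normal_density x) * cis a" for x a
      by (metis (no_types, lifting) mult.assoc mult.commute of_real_mult)
    have 2: "cis (- 2 * pi * (t * (\<sigma> * x))) = iexp (s * x)" for x
      by (simp add: s_def cis_conv_exp mult_ac)
    have "of_real \<sigma> * (cis (- 2 * pi * (t * (\<sigma> * x))) * of_real (normal_density 0 \<sigma> (\<sigma> * x)))
        = std_normal_density x *\<^sub>R iexp (s * x)" for x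
      unfolding 1 unfolding 2 scaleR_conv_of_real ..
    then show ?thesis
      using \<sigma> by (simp add: scaleR_conv_of_real flip: integral_mult_right_zero)
  qed
  also have "\<dots> = char std_normal_distribution s"
    unfolding char_def by (subst integral_density) simp_all
  also have "\<dots> = of_real (exp (- (s\<^sup>2) / 2))"
    by (simp add: char_std_normal_distribution)
  finally show ?thesis
    by (simp add: s_def)
qed

text \<open>
  The Fourier integral factors into two one-dimensional ones, which are rescaled values of the
  characteristic function of the standard normal distribution.
\<close>

lemma fourier_gauss:
  assumes \<sigma>: "\<sigma> > 0"
  shows "(LINT \<xi>|lborel. character u \<xi> * of_real (gauss \<sigma> \<xi>))
    = of_real (exp (- (2 * pi * \<sigma> * norm u)\<^sup>2 / 2))"
proof -
  define F where "F i x = cis (- 2 * pi * (u $ i * x)) * of_real (normal_density 0 \<sigma> x)" for i :: 2 and x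
  have [measurable]: "F i \<in> borel_measurable borel" for i
    unfolding F_def cis_conv_exp by measurable
  have F_int: "integrable lborel (F i)" for i
    by (rule Bochner_Integration.integrable_bound[OF integrable_normal_density[OF \<sigma>, of 0]])
      (simp_all add: F_def norm_mult)
  have split: "character u (vector [x, y]) * of_real (gauss \<sigma> (vector [x, y])) = F 1 x * F 2 y" for x y
  proof -
    have "- 2 * pi * (u \<bullet> vector [x, y]) = - 2 * pi * (u $ 1 * x) + - 2 * pi * (u $ 2 * y)"
      by (simp add: inner_vec_def sum_2 algebra_simps)
    then have "character u (vector [x, y]) = cis (- 2 * pi * (u $ 1 * x)) * cis (- 2 * pi * (u $ 2 * y))"
      unfolding character_cis cis_mult by (simp only:)
    then show ?thesis
      by (simp add: F_def gauss_def)
  qed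
  have int: "integrable (lborel \<Otimes>\<^sub>M lborel) (\<lambda>(x, y). F 1 x * F 2 y)"
    by (rule lborel_pair.Fubini_integrable) (auto simp: norm_mult intro!: integrable_mult_left integrable_mult_right integrable_norm F_int)
  have "(LINT \<xi>|lborel. character u \<xi> * of_real (gauss \<sigma> \<xi>)) = integral\<^sup>L (lborel \<Otimes>\<^sub>M lborel) (\<lambda>(x, y). F 1 x * F 2 y)"
    by (subst lborel_plane) (simp add: integral_distr split_beta' split)
  also have "\<dots> = (LINT x|lborel. LINT y|lborel. F 1 x * F 2 y)"
    using lborel_pair.integral_fst'[OF int] by simp
  also have "\<dots> = (LINT x|lborel. F 1 x) * (LINT y|lborel. F 2 y)"
    by simp
  also have "\<dots> = of_real (exp (- (2 * pi * \<sigma> * u $ 1)\<^sup>2 / 2) * exp (- (2 * pi * \<sigma> * u $ 2)\<^sup>2 / 2))"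
    unfolding F_def fourier_normal_density[OF \<sigma>] by simp
  also have "exp (- (2 * pi * \<sigma> * u $ 1)\<^sup>2 / 2) * exp (- (2 * pi * \<sigma> * u $ 2)\<^sup>2 / 2) = exp (- (2 * pi * \<sigma> * norm u)\<^sup>2 / 2)"
  proof -
    have "(norm u)\<^sup>2 = (u $ 1)\<^sup>2 + (u $ 2)\<^sup>2"
      by (simp add: norm_vec_def L2_set_def sum_2)
    then show ?thesis
      by (simp add: exp_add[symmetric] power_mult_distrib distrib_left add_divide_distrib)
  qed
  finally show ?thesis .
qed

section \<open>The Hausdorff--Young inequality\<close>

text \<open>
  Without the weight this is Plancherel's theorem, but the integrals that appear when the square is
  multiplied out need not converge.  With the Gaussian weight they do: the left-hand side becomes
  the quadratic form of \<open>\<phi>\<close> with the transform of the Gaussian as its kernel, a Gaussian whose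
  integral cancels the normalisation, and \<open>2 |\<phi>(x) \<phi>(y)| \<le> |\<phi>(x)|\<^sup>2 + |\<phi>(y)|\<^sup>2\<close> concludes.  The expansion is
  done by \<open>integral_mult_extension\<close>, applied to each factor in turn.
\<close>

lemma gauss_weighted_Bessel:
  fixes \<phi> :: "real^2 \<Rightarrow> complex"
  assumes \<phi>: "integrable lborel \<phi>" and \<sigma>: "\<sigma> > 0"
  shows "(\<integral>\<^sup>+\<xi>. ennreal ((norm (fourier \<phi> \<xi>))\<^sup>2 * exp (- (norm \<xi>)\<^sup>2 / (2 * \<sigma>\<^sup>2))) \<partial>lborel)
    \<le> (\<integral>\<^sup>+x. ennreal ((norm (\<phi> x))\<^sup>2) \<partial>lborel)"
proof -
  define \<gamma> where "\<gamma> = density lborel (\<lambda>\<xi>. ennreal (gauss \<sigma> \<xi>))"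
  define \<tau> where "\<tau> = 1 / (2 * pi * \<sigma>)"
  define E where "E u = exp (- (2 * pi * \<sigma> * norm u)\<^sup>2 / 2)" for u :: "real^2"
  define B where "B = (LINT x|lborel. norm (\<phi> x))"
  have \<tau>: "\<tau> > 0"
    using \<sigma> by (simp add: \<tau>_def)
  have [measurable]: "\<phi> \<in> borel_measurable borel"
    using borel_measurable_integrable[OF \<phi>] by simp
  have [measurable]: "fourier \<phi> \<in> borel_measurable borel" "E \<in> borel_measurable borel"
    using \<phi> unfolding E_def by measurable
  have sets_\<gamma> [measurable_cong]: "sets \<gamma> = sets borel"
    by (simp add: \<gamma>_def)
  interpret finite_measure \<gamma>
    by (rule finite_measureI) (simp add: \<gamma>_def emeasure_density nn_integral_gauss[OF \<sigma>])
  have E_gauss: "E u = gauss \<tau> u / (2 * pi * \<sigma>\<^sup>2)" for u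
  proof -
    have "- (norm u)\<^sup>2 / (2 * \<tau>\<^sup>2) = - (2 * pi * \<sigma> * norm u)\<^sup>2 / 2"
      using \<sigma> by (simp add: \<tau>_def power_divide power_mult_distrib)
    moreover have "(2 * pi * \<tau>\<^sup>2) * (2 * pi * \<sigma>\<^sup>2) = 1"
      using \<sigma> by (simp add: \<tau>_def power_divide power_mult_distrib power2_eq_square)
    ultimately show ?thesis
      unfolding gauss_eq[OF \<tau>] E_def divide_divide_eq_left by simp
  qed
  have nn_E: "(\<integral>\<^sup>+u. ennreal (E u) \<partial>lborel) = ennreal (1 / (2 * pi * \<sigma>\<^sup>2))"
  proof -
    have "(\<integral>\<^sup>+u. ennreal (E u) \<partial>lborel) = (\<integral>\<^sup>+u. ennreal (1 / (2 * pi * \<sigma>\<^sup>2)) * ennreal (gauss \<tau> u) \<partial>lborel)"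
      by (intro nn_integral_cong) (simp add: E_gauss ennreal_mult[symmetric])
    then show ?thesis
      by (simp add: nn_integral_cmult nn_integral_gauss[OF \<tau>])
  qed
  have bd: "norm (fourier \<phi> \<xi>) \<le> B" for \<xi>
    unfolding B_def by (rule norm_fourier_le)
  have kernel: "extension \<gamma> (\<lambda>\<omega>. cnj (character x \<omega>)) (\<lambda>\<omega>. \<omega>) y = of_real (E (y - x))" for x y
  proof -
    have "extension \<gamma> (\<lambda>\<omega>. cnj (character x \<omega>)) (\<lambda>\<omega>. \<omega>) y = (LINT \<omega>|\<gamma>. character (y - x) \<omega>)"
      using character_add[of y "- x"]
      by (simp add: extension_def character_minus character_commute[of _ y])
    also have "\<dots> = (LINT \<omega>|lborel. character (y - x) \<omega> * of_real (gauss \<sigma> \<omega>))"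
      unfolding \<gamma>_def by (subst integral_density) (simp_all add: scaleR_conv_of_real mult.commute)
    also have "\<dots> = of_real (E (y - x))"
      unfolding E_def by (rule fourier_gauss[OF \<sigma>])
    finally show ?thesis .
  qed
  have ext: "norm (extension \<gamma> (\<lambda>\<omega>. cnj (fourier \<phi> \<omega>)) (\<lambda>\<omega>. \<omega>) x)
      \<le> (\<integral>\<^sup>+y. ennreal (norm (\<phi> y) * E (y - x)) \<partial>lborel)" for x
  proof -
    have "cnj (extension \<gamma> (\<lambda>\<omega>. cnj (fourier \<phi> \<omega>)) (\<lambda>\<omega>. \<omega>) x) = (LINT \<omega>|\<gamma>. cnj (character x \<omega>) * fourier \<phi> \<omega>)"
      unfolding extension_def Bochner_Integration.integral_cnj[symmetric]
      by (intro Bochner_Integration.integral_cong refl) (simp add: character_commute[of x])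
    also have "\<dots> = (LINT y|lborel. \<phi> y * extension \<gamma> (\<lambda>\<omega>. cnj (character x \<omega>)) (\<lambda>\<omega>. \<omega>) y)"
    proof (rule integral_mult_extension[symmetric, where B = 1])
      show "(\<lambda>\<omega>. cnj (character x \<omega>)) \<in> borel_measurable \<gamma>"
        by measurable
    qed (simp_all add: finite_measure_axioms \<phi>)
    finally have *: "norm (extension \<gamma> (\<lambda>\<omega>. cnj (fourier \<phi> \<omega>)) (\<lambda>\<omega>. \<omega>) x) = norm (LINT y|lborel. \<phi> y * of_real (E (y - x)))"
      unfolding kernel by (metis complex_mod_cnj)
    show ?thesis
      unfolding * by (rule order.trans[OF norm_integral_le_nn_integral])
        (simp_all add: norm_mult E_def)
  qed
  have "(\<integral>\<^sup>+\<xi>. ennreal ((norm (fourier \<phi> \<xi>))\<^sup>2) \<partial>\<gamma>) = ennreal (LINT \<xi>|\<gamma>. (norm (fourier \<phi> \<xi>))\<^sup>2)"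
    using bd by (intro nn_integral_eq_integral integrable_const_bound[where B = "B\<^sup>2"])
      (auto intro!: power_mono)
  also have "(LINT \<xi>|\<gamma>. (norm (fourier \<phi> \<xi>))\<^sup>2) = norm (LINT \<xi>|\<gamma>. of_real ((norm (fourier \<phi> \<xi>))\<^sup>2) :: complex)"
    unfolding integral_complex_of_real by simp
  also have "(LINT \<xi>|\<gamma>. of_real ((norm (fourier \<phi> \<xi>))\<^sup>2) :: complex) = (LINT \<xi>|\<gamma>. cnj (fourier \<phi> \<xi>) * fourier \<phi> \<xi>)"
    by (simp only: complex_norm_square mult.commute)
  also have "\<dots> = (LINT x|lborel. \<phi> x * extension \<gamma> (\<lambda>\<omega>. cnj (fourier \<phi> \<omega>)) (\<lambda>\<omega>. \<omega>) x)"
    by (rule integral_mult_extension[symmetric, where B = B]) (simp_all add: finite_measure_axioms \<phi> bd)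
  also have "ennreal (norm \<dots>) \<le> (\<integral>\<^sup>+x. ennreal (norm (\<phi> x)) * (\<integral>\<^sup>+y. ennreal (norm (\<phi> y) * E (y - x)) \<partial>lborel) \<partial>lborel)"
    by (rule order.trans[OF norm_integral_le_nn_integral])
      (auto simp: norm_mult ennreal_mult intro!: nn_integral_mono mult_left_mono ext)
  also have "\<dots> \<le> (\<integral>\<^sup>+x. \<integral>\<^sup>+y. ennreal ((norm (\<phi> x))\<^sup>2 / 2 * E (y - x)) + ennreal ((norm (\<phi> y))\<^sup>2 / 2 * E (x - y)) \<partial>lborel \<partial>lborel)"
  proof (rule nn_integral_mono)
    fix x
    have "norm (\<phi> x) * (norm (\<phi> y) * E (y - x)) \<le> (norm (\<phi> x))\<^sup>2 / 2 * E (y - x) + (norm (\<phi> y))\<^sup>2 / 2 * E (x - y)" for y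
    proof -
      have "norm (\<phi> x) * norm (\<phi> y) \<le> (norm (\<phi> x))\<^sup>2 / 2 + (norm (\<phi> y))\<^sup>2 / 2"
        using sum_squares_bound[of "norm (\<phi> x)" "norm (\<phi> y)"] by simp
      then have "norm (\<phi> x) * norm (\<phi> y) * E (y - x) \<le> ((norm (\<phi> x))\<^sup>2 / 2 + (norm (\<phi> y))\<^sup>2 / 2) * E (y - x)"
        by (rule mult_right_mono) (simp add: E_def)
      moreover have "E (x - y) = E (y - x)"
        by (simp add: E_def norm_minus_commute)
      ultimately show ?thesis
        by (simp add: algebra_simps)
    qed
    then show "ennreal (norm (\<phi> x)) * (\<integral>\<^sup>+y. ennreal (norm (\<phi> y) * E (y - x)) \<partial>lborel)
        \<le> (\<integral>\<^sup>+y. ennreal ((norm (\<phi> x))\<^sup>2 / 2 * E (y - x)) + ennreal ((norm (\<phi> y))\<^sup>2 / 2 * E (x - y)) \<partial>lborel)"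
      by (subst nn_integral_cmult[symmetric])
        (auto intro!: nn_integral_mono ennreal_leI simp: ennreal_mult'[symmetric] E_def simp flip: ennreal_plus)
  qed
  also have "\<dots> = (\<integral>\<^sup>+x. \<integral>\<^sup>+y. ennreal ((norm (\<phi> x))\<^sup>2 / 2 * E (y - x)) \<partial>lborel \<partial>lborel)
      + (\<integral>\<^sup>+x. \<integral>\<^sup>+y. ennreal ((norm (\<phi> y))\<^sup>2 / 2 * E (x - y)) \<partial>lborel \<partial>lborel)"
    by (simp add: nn_integral_add)
  also have "(\<integral>\<^sup>+x. \<integral>\<^sup>+y. ennreal ((norm (\<phi> y))\<^sup>2 / 2 * E (x - y)) \<partial>lborel \<partial>lborel)
      = (\<integral>\<^sup>+y. \<integral>\<^sup>+x. ennreal ((norm (\<phi> y))\<^sup>2 / 2 * E (x - y)) \<partial>lborel \<partial>lborel)"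
    by (rule lborel_pair.Fubini') measurable
  also have "(\<integral>\<^sup>+x. \<integral>\<^sup>+y. ennreal ((norm (\<phi> x))\<^sup>2 / 2 * E (y - x)) \<partial>lborel \<partial>lborel)
      = (\<integral>\<^sup>+x. ennreal ((norm (\<phi> x))\<^sup>2 / 2) * ennreal (1 / (2 * pi * \<sigma>\<^sup>2)) \<partial>lborel)"
  proof (rule nn_integral_cong)
    fix x
    have "(\<integral>\<^sup>+y. ennreal (E (y - x)) \<partial>lborel) = ennreal (1 / (2 * pi * \<sigma>\<^sup>2))"
      using nn_integral_translate[of "\<lambda>u. ennreal (E u)" "- x"] nn_E by simp
    then show "(\<integral>\<^sup>+y. ennreal ((norm (\<phi> x))\<^sup>2 / 2 * E (y - x)) \<partial>lborel)
        = ennreal ((norm (\<phi> x))\<^sup>2 / 2) * ennreal (1 / (2 * pi * \<sigma>\<^sup>2))"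
      by (simp only: ennreal_mult' nn_integral_cmult divide_nonneg_nonneg zero_le_power2) (simp add: nn_integral_cmult ennreal_mult')
  qed
  also have "(\<integral>\<^sup>+x. ennreal ((norm (\<phi> x))\<^sup>2 / 2) * ennreal (1 / (2 * pi * \<sigma>\<^sup>2)) \<partial>lborel)
      + (\<integral>\<^sup>+x. ennreal ((norm (\<phi> x))\<^sup>2 / 2) * ennreal (1 / (2 * pi * \<sigma>\<^sup>2)) \<partial>lborel)
      = ennreal (1 / (2 * pi * \<sigma>\<^sup>2)) * (\<integral>\<^sup>+x. ennreal ((norm (\<phi> x))\<^sup>2) \<partial>lborel)"
  proof -
    have "ennreal (b / 2) * c + ennreal (b / 2) * c = c * ennreal b" if "b \<ge> 0" for b c
      unfolding distrib_right[symmetric] using that by (simp add: mult.commute flip: ennreal_plus)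
    then show ?thesis
      by (subst nn_integral_add[symmetric]) (simp_all add: nn_integral_cmult)
  qed
  finally have main: "(\<integral>\<^sup>+\<xi>. ennreal ((norm (fourier \<phi> \<xi>))\<^sup>2) \<partial>\<gamma>)
      \<le> ennreal (1 / (2 * pi * \<sigma>\<^sup>2)) * (\<integral>\<^sup>+x. ennreal ((norm (\<phi> x))\<^sup>2) \<partial>lborel)" .
  have "(\<integral>\<^sup>+\<xi>. ennreal ((norm (fourier \<phi> \<xi>))\<^sup>2 * exp (- (norm \<xi>)\<^sup>2 / (2 * \<sigma>\<^sup>2))) \<partial>lborel)
      = (\<integral>\<^sup>+\<xi>. ennreal (2 * pi * \<sigma>\<^sup>2) * (ennreal (gauss \<sigma> \<xi>) * ennreal ((norm (fourier \<phi> \<xi>))\<^sup>2)) \<partial>lborel)"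
    using \<sigma> by (intro nn_integral_cong) (simp add: gauss_eq[OF \<sigma>] ennreal_mult[symmetric])
  also have "\<dots> = ennreal (2 * pi * \<sigma>\<^sup>2) * (\<integral>\<^sup>+\<xi>. ennreal ((norm (fourier \<phi> \<xi>))\<^sup>2) \<partial>\<gamma>)"
    by (simp add: \<gamma>_def nn_integral_density nn_integral_cmult)
  also have "\<dots> \<le> ennreal (2 * pi * \<sigma>\<^sup>2) * (ennreal (1 / (2 * pi * \<sigma>\<^sup>2)) * (\<integral>\<^sup>+x. ennreal ((norm (\<phi> x))\<^sup>2) \<partial>lborel))"
    by (intro mult_left_mono main) simp
  also have "\<dots> = (\<integral>\<^sup>+x. ennreal ((norm (\<phi> x))\<^sup>2) \<partial>lborel)"
    using \<sigma> by (simp add: mult.assoc[symmetric] ennreal_mult[symmetric])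
  finally show ?thesis .
qed

text \<open>
  As \<open>\<sigma>\<close> grows the Gaussian weights tend to one, and Fatou's lemma applies.
\<close>

theorem Bessel_fourier:
  fixes \<phi> :: "real^2 \<Rightarrow> complex"
  assumes \<phi>: "integrable lborel \<phi>"
  shows "(\<integral>\<^sup>+\<xi>. ennreal ((norm (fourier \<phi> \<xi>))\<^sup>2) \<partial>lborel) \<le> (\<integral>\<^sup>+x. ennreal ((norm (\<phi> x))\<^sup>2) \<partial>lborel)"
proof -
  have [measurable]: "fourier \<phi> \<in> borel_measurable borel"
    using \<phi> by measurable
  define F where "F n \<xi> = ennreal ((norm (fourier \<phi> \<xi>))\<^sup>2 * exp (- (norm \<xi>)\<^sup>2 / (2 * (real (Suc n))\<^sup>2)))" for n and \<xi> :: "real^2"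
  have lim: "(\<lambda>n. F n \<xi>) \<longlonglongrightarrow> ennreal ((norm (fourier \<phi> \<xi>))\<^sup>2)" for \<xi>
  proof -
    have "(\<lambda>n. (norm (fourier \<phi> \<xi>))\<^sup>2 * exp (- (norm \<xi>)\<^sup>2 / 2 * (inverse (real (Suc n)))\<^sup>2)) \<longlonglongrightarrow> (norm (fourier \<phi> \<xi>))\<^sup>2 * exp (- (norm \<xi>)\<^sup>2 / 2 * 0\<^sup>2)"
      by (intro tendsto_intros LIMSEQ_inverse_real_of_nat)
    then show ?thesis
      unfolding F_def by (intro tendsto_ennrealI) (simp add: field_simps)
  qed
  have "(\<integral>\<^sup>+\<xi>. ennreal ((norm (fourier \<phi> \<xi>))\<^sup>2) \<partial>lborel) = (\<integral>\<^sup>+\<xi>. liminf (\<lambda>n. F n \<xi>) \<partial>lborel)"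
    by (intro nn_integral_cong) (simp add: lim_imp_Liminf[OF sequentially_bot lim])
  also have "\<dots> \<le> liminf (\<lambda>n. \<integral>\<^sup>+\<xi>. F n \<xi> \<partial>lborel)"
    by (rule nn_integral_liminf) (simp add: F_def)
  also have "\<dots> \<le> liminf (\<lambda>n. \<integral>\<^sup>+x. ennreal ((norm (\<phi> x))\<^sup>2) \<partial>lborel)"
    unfolding F_def by (intro Liminf_mono always_eventually allI gauss_weighted_Bessel \<phi>) simp
  also have "\<dots> = (\<integral>\<^sup>+x. ennreal ((norm (\<phi> x))\<^sup>2) \<partial>lborel)"
    by (rule lim_imp_Liminf) simp_all
  finally show ?thesis .
qed


text \<open>
  The level set of the transform at height \<open>\<alpha>\<close> depends only on the small values of \<open>\<phi>\<close>: cut \<open>\<phi>\<close> at a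
  height \<open>s\<close> so large that the part above it has \<open>L\<^sup>1\<close> norm at most \<open>\<alpha>/2\<close>, hence a transform below
  \<open>\<alpha>/2\<close>.  Chebyshev's inequality and \<open>Bessel_fourier\<close> take care of the part below \<open>s\<close>.
\<close>

lemma Hausdorff_Young_level:
  fixes \<phi> :: "real^2 \<Rightarrow> complex"
  assumes r: "r > 2" and \<phi>: "integrable lborel \<phi>" and N: "N > 0" and \<alpha>: "\<alpha> > 0"
    and \<phi>N: "(\<integral>\<^sup>+x. ennreal (norm (\<phi> x) powr (r / (r - 1))) \<partial>lborel) \<le> ennreal N"
  shows "(\<integral>\<^sup>+\<xi>. indicator {\<alpha>..} (norm (fourier \<phi> \<xi>)) \<partial>lborel)
    \<le> (\<integral>\<^sup>+x. ennreal (4 / \<alpha>\<^sup>2 * (norm (\<phi> x))\<^sup>2) * indicator {..(2 * N / \<alpha>) powr (r - 1)} (norm (\<phi> x)) \<partial>lborel)"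
proof -
  define s where "s = (2 * N / \<alpha>) powr (r - 1)"
  define \<phi>1 where "\<phi>1 x = (if norm (\<phi> x) > s then \<phi> x else 0)" for x
  define \<phi>2 where "\<phi>2 x = (if norm (\<phi> x) > s then 0 else \<phi> x)" for x
  have s: "s > 0"
    using N \<alpha> by (simp add: s_def)
  have [measurable]: "\<phi> \<in> borel_measurable borel"
    using borel_measurable_integrable[OF \<phi>] by simp
  have [measurable]: "\<phi>1 \<in> borel_measurable borel" "\<phi>2 \<in> borel_measurable borel"
    unfolding \<phi>1_def[abs_def] \<phi>2_def[abs_def] by measurable
  have int: "integrable lborel \<phi>1" "integrable lborel \<phi>2"
    by (rule Bochner_Integration.integrable_bound[OF \<phi>]; (measurable)?; simp add: \<phi>1_def \<phi>2_def)+
  have [measurable]: "fourier \<phi>2 \<in> borel_measurable borel"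
    using int by measurable
  have split: "fourier \<phi> \<xi> = fourier \<phi>1 \<xi> + fourier \<phi>2 \<xi>" for \<xi>
  proof -
    have "character x \<xi> * \<phi> x = character x \<xi> * \<phi>1 x + character x \<xi> * \<phi>2 x" for x
      by (simp add: \<phi>1_def \<phi>2_def)
    then have "fourier \<phi> \<xi> = (LINT x|lborel. character x \<xi> * \<phi>1 x + character x \<xi> * \<phi>2 x)"
      by (simp only: fourier_eq)
    also have "\<dots> = fourier \<phi>1 \<xi> + fourier \<phi>2 \<xi>"
      unfolding fourier_eq
      by (intro Bochner_Integration.integral_add integrable_character_mult int) simp_all
    finally show ?thesis .
  qed
  have "ennreal (norm (fourier \<phi>1 \<xi>)) \<le> ennreal (\<alpha> / 2)" for \<xi>
  proof -
    have "ennreal (norm (fourier \<phi>1 \<xi>)) \<le> (\<integral>\<^sup>+x. ennreal (norm (\<phi>1 x)) \<partial>lborel)"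
      unfolding fourier_eq by (rule order.trans[OF norm_integral_le_nn_integral]) (simp add: norm_mult)
    also have "\<dots> \<le> (\<integral>\<^sup>+x. ennreal (\<alpha> / (2 * N)) * ennreal (norm (\<phi> x) powr (r / (r - 1))) \<partial>lborel)"
    proof (rule nn_integral_mono)
      fix x
      show "ennreal (norm (\<phi>1 x)) \<le> ennreal (\<alpha> / (2 * N)) * ennreal (norm (\<phi> x) powr (r / (r - 1)))"
      proof (cases "norm (\<phi> x) > s")
        case True
        \<comment> \<open>Above the height \<open>s\<close> the missing power of the modulus is at least \<open>2N/\<alpha>\<close>.\<close>
        have "s powr (1 / (r - 1)) = 2 * N / \<alpha>"
          using r N \<alpha> by (simp add: s_def powr_powr)
        moreover have "s powr (1 / (r - 1)) \<le> norm (\<phi> x) powr (1 / (r - 1))"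
          using True r s by (intro powr_mono2) auto
        ultimately have "2 * N / \<alpha> \<le> norm (\<phi> x) powr (1 / (r - 1))"
          by (simp only:)
        then have "1 \<le> \<alpha> / (2 * N) * norm (\<phi> x) powr (1 / (r - 1))"
          using N \<alpha> by (simp add: field_simps)
        then have "norm (\<phi> x) * 1 \<le> norm (\<phi> x) * (\<alpha> / (2 * N) * norm (\<phi> x) powr (1 / (r - 1)))"
          by (rule mult_left_mono) simp
        also have "\<dots> = \<alpha> / (2 * N) * (norm (\<phi> x) powr 1 * norm (\<phi> x) powr (1 / (r - 1)))"
          by simp
        also have "norm (\<phi> x) powr 1 * norm (\<phi> x) powr (1 / (r - 1)) = norm (\<phi> x) powr (r / (r - 1))"
        proof -
          have "1 + 1 / (r - 1) = r / (r - 1)"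
            using r by (simp add: field_simps)
          then show ?thesis
            unfolding powr_add[symmetric] by simp
        qed
        finally show ?thesis
          using True N \<alpha> by (simp add: \<phi>1_def ennreal_mult[symmetric] ennreal_leI)
      qed (simp add: \<phi>1_def)
    qed
    also have "\<dots> \<le> ennreal (\<alpha> / (2 * N)) * ennreal N"
      by (simp add: nn_integral_cmult mult_left_mono \<phi>N)
    also have "\<dots> = ennreal (\<alpha> / 2)"
      using N \<alpha> by (simp add: ennreal_mult[symmetric])
    finally show ?thesis .
  qed
  then have small: "norm (fourier \<phi>1 \<xi>) \<le> \<alpha> / 2" for \<xi>
    using \<alpha> by simp
  have "(\<integral>\<^sup>+\<xi>. indicator {\<alpha>..} (norm (fourier \<phi> \<xi>)) \<partial>lborel)
      \<le> (\<integral>\<^sup>+\<xi>. ennreal (4 / \<alpha>\<^sup>2) * ennreal ((norm (fourier \<phi>2 \<xi>))\<^sup>2) \<partial>lborel)"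
  proof (rule nn_integral_mono)
    fix \<xi>
    show "indicator {\<alpha>..} (norm (fourier \<phi> \<xi>)) \<le> ennreal (4 / \<alpha>\<^sup>2) * ennreal ((norm (fourier \<phi>2 \<xi>))\<^sup>2)"
    proof (cases "\<alpha> \<le> norm (fourier \<phi> \<xi>)")
      case True
      then have "\<alpha> / 2 \<le> norm (fourier \<phi>2 \<xi>)"
        using small[of \<xi>] norm_triangle_ineq[of "fourier \<phi>1 \<xi>" "fourier \<phi>2 \<xi>"] by (simp add: split)
      then have "(\<alpha> / 2)\<^sup>2 \<le> (norm (fourier \<phi>2 \<xi>))\<^sup>2"
        using \<alpha> by (intro power_mono) auto
      then have "1 \<le> 4 / \<alpha>\<^sup>2 * (norm (fourier \<phi>2 \<xi>))\<^sup>2"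
        using \<alpha> by (simp add: power_divide field_simps)
      then show ?thesis
        using True by (simp add: ennreal_mult[symmetric])
    qed simp
  qed
  also have "\<dots> = ennreal (4 / \<alpha>\<^sup>2) * (\<integral>\<^sup>+\<xi>. ennreal ((norm (fourier \<phi>2 \<xi>))\<^sup>2) \<partial>lborel)"
    by (simp add: nn_integral_cmult)
  also have "\<dots> \<le> ennreal (4 / \<alpha>\<^sup>2) * (\<integral>\<^sup>+x. ennreal ((norm (\<phi>2 x))\<^sup>2) \<partial>lborel)"
    by (intro mult_left_mono Bessel_fourier int) simp
  also have "\<dots> = (\<integral>\<^sup>+x. ennreal (4 / \<alpha>\<^sup>2 * (norm (\<phi> x))\<^sup>2) * indicator {..s} (norm (\<phi> x)) \<partial>lborel)"
    by (subst nn_integral_cmult[symmetric])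
      (auto intro!: nn_integral_cong simp: \<phi>2_def ennreal_mult[symmetric])
  finally show ?thesis
    by (simp add: s_def)
qed

text \<open>
  Marcinkiewicz interpolation between the \<open>L\<^sup>1\<close> bound and Bessel's inequality: integrate
  \<open>Hausdorff_Young_level\<close> over the heights \<open>\<alpha>\<close> with weight \<open>r * \<alpha> powr (r - 1)\<close> and exchange the integrals.
  The condition \<open>|\<phi>(x)| \<le> (2N/\<alpha>) powr (r - 1)\<close> then bounds \<open>\<alpha>\<close> in terms of \<open>|\<phi>(x)|\<close>, and the inner integral
  converges at the origin because \<open>r > 2\<close>.
\<close>

theorem Hausdorff_Young:
  fixes \<phi> :: "real^2 \<Rightarrow> complex"
  assumes r: "r > 2" and \<phi>: "integrable lborel \<phi>"
  shows "(\<integral>\<^sup>+\<xi>. enn_powr (modulus (fourier \<phi>) \<xi>) r \<partial>lborel)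
    \<le> ennreal (4 * r * 2 powr (r - 2) / (r - 2))
      * enn_powr (\<integral>\<^sup>+x. enn_powr (modulus \<phi> x) (r / (r - 1)) \<partial>lborel) (r - 1)"
    (is "_ \<le> ennreal ?K * enn_powr ?I _")
proof -
  have [measurable]: "\<phi> \<in> borel_measurable borel"
    using borel_measurable_integrable[OF \<phi>] by simp
  have [measurable]: "fourier \<phi> \<in> borel_measurable borel"
    using \<phi> by measurable
  have K: "?K > 0"
    using r by simp
  consider "?I = top" | "?I = 0" | N where "?I = ennreal N" "N > 0"
    by (cases ?I) (auto simp: less_le)
  then show ?thesis
  proof cases
    case 1
    then show ?thesis
      using K r by (simp add: ennreal_mult_top)
  next
    case 2
    then have "AE x in lborel. \<phi> x = 0"
      by (simp add: nn_integral_0_iff_AE)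
    then have "AE x in lborel. character x \<xi> * \<phi> x = 0" for \<xi>
      by auto
    then have "fourier \<phi> \<xi> = 0" for \<xi>
      unfolding fourier_eq by (rule integral_eq_zero_AE)
    then show ?thesis
      by simp
  next
    case 3
    define J where "J \<alpha> x = ennreal (4 * r * \<alpha> powr (r - 3)) * ennreal ((norm (\<phi> x))\<^sup>2)
      * (indicator {0<..} \<alpha> * indicator {..(2 * N / \<alpha>) powr (r - 1)} (norm (\<phi> x)))" for \<alpha> x
    \<comment> \<open>The largest height \<open>\<alpha>\<close> whose truncation of \<open>\<phi>\<close> still keeps the value at \<open>x\<close>.\<close>
    define b where "b x = 2 * N * norm (\<phi> x) powr (- 1 / (r - 1))" for x
    have [measurable]: "(\<lambda>(\<alpha>, x). J \<alpha> x) \<in> borel_measurable (lborel \<Otimes>\<^sub>M lborel)"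
      unfolding J_def indicator_def of_bool_def greaterThan_iff atMost_iff by measurable
    have "(\<integral>\<^sup>+\<xi>. enn_powr (modulus (fourier \<phi>) \<xi>) r \<partial>lborel)
        = (\<integral>\<^sup>+\<xi>. \<integral>\<^sup>+\<alpha>. ennreal (r * \<alpha> powr (r - 1)) * (indicator {0<..} \<alpha> * indicator {\<alpha>..} (norm (fourier \<phi> \<xi>))) \<partial>lborel \<partial>lborel)"
    proof (rule nn_integral_cong)
      fix \<xi>
      have "(\<integral>\<^sup>+\<alpha>. ennreal (r * \<alpha> powr (r - 1)) * (indicator {0<..} \<alpha> * indicator {\<alpha>..} (norm (fourier \<phi> \<xi>))) \<partial>lborel)
          = (\<integral>\<^sup>+\<alpha>. ennreal r * (ennreal (\<alpha> powr (r - 1)) * indicator {0..norm (fourier \<phi> \<xi>)} \<alpha>) \<partial>lborel)"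
        using r by (intro nn_integral_cong) (auto simp: indicator_def ennreal_mult)
      also have "\<dots> = ennreal r * ennreal (norm (fourier \<phi> \<xi>) powr r / r)"
        using r nn_integral_powr_from_0[of "r - 1" "norm (fourier \<phi> \<xi>)"] by (simp add: nn_integral_cmult)
      also have "\<dots> = enn_powr (modulus (fourier \<phi>) \<xi>) r"
        using r by (simp add: ennreal_mult[symmetric])
      finally show "enn_powr (modulus (fourier \<phi>) \<xi>) r
          = (\<integral>\<^sup>+\<alpha>. ennreal (r * \<alpha> powr (r - 1)) * (indicator {0<..} \<alpha> * indicator {\<alpha>..} (norm (fourier \<phi> \<xi>))) \<partial>lborel)" ..
    qed
    also have "\<dots> = (\<integral>\<^sup>+\<alpha>. \<integral>\<^sup>+\<xi>. ennreal (r * \<alpha> powr (r - 1)) * (indicator {0<..} \<alpha> * indicator {\<alpha>..} (norm (fourier \<phi> \<xi>))) \<partial>lborel \<partial>lborel)"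
      unfolding indicator_def of_bool_def greaterThan_iff atLeast_iff
      by (rule lborel_pair.Fubini') measurable
    also have "\<dots> \<le> (\<integral>\<^sup>+\<alpha>. \<integral>\<^sup>+x. J \<alpha> x \<partial>lborel \<partial>lborel)"
    proof (rule nn_integral_mono)
      fix \<alpha> :: real
      show "(\<integral>\<^sup>+\<xi>. ennreal (r * \<alpha> powr (r - 1)) * (indicator {0<..} \<alpha> * indicator {\<alpha>..} (norm (fourier \<phi> \<xi>))) \<partial>lborel) \<le> (\<integral>\<^sup>+x. J \<alpha> x \<partial>lborel)"
      proof (cases "\<alpha> > 0")
        case True
        have "(\<integral>\<^sup>+\<xi>. indicator {\<alpha>..} (norm (fourier \<phi> \<xi>)) \<partial>lborel)
          \<le> (\<integral>\<^sup>+x. ennreal (4 / \<alpha>\<^sup>2 * (norm (\<phi> x))\<^sup>2) * indicator {..(2 * N / \<alpha>) powr (r - 1)} (norm (\<phi> x)) \<partial>lborel)"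
          using 3 by (intro Hausdorff_Young_level r \<phi> True) simp_all
        then have "ennreal (r * \<alpha> powr (r - 1)) * (\<integral>\<^sup>+\<xi>. indicator {\<alpha>..} (norm (fourier \<phi> \<xi>)) \<partial>lborel)
          \<le> ennreal (r * \<alpha> powr (r - 1)) * (\<integral>\<^sup>+x. ennreal (4 / \<alpha>\<^sup>2 * (norm (\<phi> x))\<^sup>2) * indicator {..(2 * N / \<alpha>) powr (r - 1)} (norm (\<phi> x)) \<partial>lborel)"
          by (rule mult_left_mono) simp
        also have "\<dots> = (\<integral>\<^sup>+x. J \<alpha> x \<partial>lborel)"
        proof (subst nn_integral_cmult[symmetric], measurable, rule nn_integral_cong)
          fix x
          have "\<alpha> powr (r - 1) / \<alpha>\<^sup>2 = \<alpha> powr (r - 3)"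
            using True powr_diff[of \<alpha> "r - 1" 2] by simp
          moreover have "r * \<alpha> powr (r - 1) * (4 / \<alpha>\<^sup>2 * (norm (\<phi> x))\<^sup>2) = 4 * r * (\<alpha> powr (r - 1) / \<alpha>\<^sup>2) * (norm (\<phi> x))\<^sup>2"
            by simp
          ultimately have "r * \<alpha> powr (r - 1) * (4 / \<alpha>\<^sup>2 * (norm (\<phi> x))\<^sup>2) = 4 * r * \<alpha> powr (r - 3) * (norm (\<phi> x))\<^sup>2"
            by (simp only:)
          note coeff = this
          have "ennreal (r * \<alpha> powr (r - 1)) * ennreal (4 / \<alpha>\<^sup>2 * (norm (\<phi> x))\<^sup>2) = ennreal (r * \<alpha> powr (r - 1) * (4 / \<alpha>\<^sup>2 * (norm (\<phi> x))\<^sup>2))"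
            using r True by (intro ennreal_mult[symmetric]) simp_all
          also have "\<dots> = ennreal (4 * r * \<alpha> powr (r - 3)) * ennreal ((norm (\<phi> x))\<^sup>2)"
            unfolding coeff using r True by (intro ennreal_mult) simp_all
          finally have "ennreal (r * \<alpha> powr (r - 1)) * ennreal (4 / \<alpha>\<^sup>2 * (norm (\<phi> x))\<^sup>2) = ennreal (4 * r * \<alpha> powr (r - 3)) * ennreal ((norm (\<phi> x))\<^sup>2)" .
          then show "ennreal (r * \<alpha> powr (r - 1)) * (ennreal (4 / \<alpha>\<^sup>2 * (norm (\<phi> x))\<^sup>2) * indicator {..(2 * N / \<alpha>) powr (r - 1)} (norm (\<phi> x))) = J \<alpha> x"
            using True by (simp add: J_def mult.assoc[symmetric])
        qed
        finally show ?thesis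
          using True by (simp add: nn_integral_cmult)
      qed (simp add: J_def)
    qed
    also have "\<dots> = (\<integral>\<^sup>+x. \<integral>\<^sup>+\<alpha>. J \<alpha> x \<partial>lborel \<partial>lborel)"
      by (rule lborel_pair.Fubini'[symmetric]) measurable
    also have "\<dots> \<le> (\<integral>\<^sup>+x. ennreal (?K * N powr (r - 2)) * ennreal (norm (\<phi> x) powr (r / (r - 1))) \<partial>lborel)"
    proof (rule nn_integral_mono)
      fix x
      show "(\<integral>\<^sup>+\<alpha>. J \<alpha> x \<partial>lborel) \<le> ennreal (?K * N powr (r - 2)) * ennreal (norm (\<phi> x) powr (r / (r - 1)))"
      proof (cases "\<phi> x = 0")
        case True
        then show ?thesis
          by (simp add: J_def)
      next
        case False
        define m where "m = norm (\<phi> x)"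
        have m: "m > 0"
          using False by (simp add: m_def)
        have b: "b x > 0"
          using 3 False by (simp add: b_def)
        have J_le: "J \<alpha> x \<le> ennreal (4 * r * m\<^sup>2) * (ennreal (\<alpha> powr (r - 3)) * indicator {0..b x} \<alpha>)" for \<alpha>
        proof (cases "\<alpha> > 0 \<and> m \<le> (2 * N / \<alpha>) powr (r - 1)")
          case True
          then have "m powr (1 / (r - 1)) \<le> ((2 * N / \<alpha>) powr (r - 1)) powr (1 / (r - 1))"
            using m r by (intro powr_mono2) auto
          also have "\<dots> = 2 * N / \<alpha>"
            using r True 3 by (simp add: powr_powr)
          finally have "\<alpha> \<le> b x"
            using True m 3 by (simp add: b_def m_def[symmetric] powr_minus field_simps)
          then show ?thesis
            using True r by (simp add: J_def m_def ennreal_mult mult_ac)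
        qed (auto simp: J_def m_def)
        have "(\<integral>\<^sup>+\<alpha>. J \<alpha> x \<partial>lborel) \<le> (\<integral>\<^sup>+\<alpha>. ennreal (4 * r * m\<^sup>2) * (ennreal (\<alpha> powr (r - 3)) * indicator {0..b x} \<alpha>) \<partial>lborel)"
          by (intro nn_integral_mono J_le)
        also have "\<dots> = ennreal (4 * r * m\<^sup>2) * ennreal (b x powr (r - 2) / (r - 2))"
          using r b nn_integral_powr_from_0[of "r - 3" "b x"] by (simp add: nn_integral_cmult)
        also have "\<dots> = ennreal (4 * r * m\<^sup>2 * (b x powr (r - 2) / (r - 2)))"
        using r by (intro ennreal_mult[symmetric]) simp_all
        also have "4 * r * m\<^sup>2 * (b x powr (r - 2) / (r - 2)) = ?K * N powr (r - 2) * m powr (r / (r - 1))"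
        proof -
          have "b x powr (r - 2) = 2 powr (r - 2) * N powr (r - 2) * m powr (- 1 / (r - 1) * (r - 2))"
            using 3 m by (simp only: b_def m_def[symmetric] powr_mult powr_powr)
          moreover have "m\<^sup>2 * m powr (- 1 / (r - 1) * (r - 2)) = m powr (r / (r - 1))"
          proof -
            have e: "2 + - 1 / (r - 1) * (r - 2) = r / (r - 1)"
              using r by (simp add: field_simps)
            have "m\<^sup>2 * m powr (- 1 / (r - 1) * (r - 2)) = m powr 2 * m powr (- 1 / (r - 1) * (r - 2))"
              using m by simp
            also have "\<dots> = m powr (r / (r - 1))"
              unfolding powr_add[symmetric] e ..
            finally show ?thesis .
          qed
          moreover have "4 * r * m\<^sup>2 * (a * c * d / (r - 2)) = (4 * r * a / (r - 2)) * c * (m\<^sup>2 * d)" for a c d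
            by simp
          ultimately show ?thesis
            by (simp only:)
        qed
        also have "ennreal (?K * N powr (r - 2) * m powr (r / (r - 1))) = ennreal (?K * N powr (r - 2)) * ennreal (m powr (r / (r - 1)))"
          using K by (intro ennreal_mult mult_nonneg_nonneg) (simp_all only: less_imp_le powr_ge_zero)
        finally show ?thesis
          by (simp only: m_def)
      qed
    qed
    also have "\<dots> = ennreal (?K * N powr (r - 2)) * ?I"
      by (simp add: nn_integral_cmult)
    also have "\<dots> = ennreal ?K * enn_powr ?I (r - 1)"
    proof -
      have "N powr (r - 2) * N = N powr (r - 1)"
        using 3(2) powr_add[of N "r - 2" 1] by simp
      moreover have "ennreal (?K * N powr (r - 2)) * ennreal N = ennreal ?K * ennreal (N powr (r - 2) * N)"
        using K 3(2) by (simp only: ennreal_mult[symmetric] less_imp_le mult_nonneg_nonneg powr_ge_zero mult.assoc)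
      ultimately show ?thesis
        unfolding 3(1) using 3(2) by simp
    qed
    finally show ?thesis .
  qed
qed


section \<open>Maximal averages over a set of dilations\<close>

text \<open>
  The maximal function over a set \<open>T\<close> of dilations.  A countable \<open>T\<close> makes it measurable for every
  Borel function \<open>h\<close>, so that it can be iterated; extended values spare the proof that averages
  are finite.
\<close>

definition maxavg :: "real set \<Rightarrow> (real^'n::finite) measure \<Rightarrow> (real^'n \<Rightarrow> ennreal) \<Rightarrow> real^'n \<Rightarrow> ennreal" where
  "maxavg T \<mu> h x = (SUP t\<in>T. \<integral>\<^sup>+y. h (x - t *\<^sub>R y) \<partial>\<mu>)"

lemma measurable_maxavg:
  assumes "finite_measure \<mu>" and [measurable_cong]: "sets \<mu> = sets borel" and "countable T"
    and [measurable]: "h \<in> borel_measurable borel"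
  shows "maxavg T \<mu> h \<in> borel_measurable borel"
proof -
  interpret finite_measure \<mu> by fact
  have "(\<lambda>x. \<integral>\<^sup>+y. h (x - t *\<^sub>R y) \<partial>\<mu>) \<in> borel_measurable borel" for t
    by measurable
  then show ?thesis
    unfolding maxavg_def[abs_def] by (intro borel_measurable_SUP assms(3))
qed

lemma maxavg_le:
  assumes "\<And>x. h x \<le> B"
  shows "maxavg T \<mu> h x \<le> B * emeasure \<mu> (space \<mu>)"
  unfolding maxavg_def
proof (rule SUP_least)
  fix t
  have "(\<integral>\<^sup>+y. h (x - t *\<^sub>R y) \<partial>\<mu>) \<le> (\<integral>\<^sup>+y. B \<partial>\<mu>)"
    by (intro nn_integral_mono assms)
  then show "(\<integral>\<^sup>+y. h (x - t *\<^sub>R y) \<partial>\<mu>) \<le> B * emeasure \<mu> (space \<mu>)"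
    by simp
qed

lemma average_le_maxavg: "t \<in> T \<Longrightarrow> (\<integral>\<^sup>+y. h (x - t *\<^sub>R y) \<partial>\<mu>) \<le> maxavg T \<mu> h x"
  unfolding maxavg_def by (rule SUP_upper)

lemma maxavg_le_maximal:
  assumes "sets \<mu> = sets borel" "g \<in> borel_measurable borel" "T \<subseteq> {0<..}"
  shows "maxavg T \<mu> (modulus g) x \<le> maximal \<mu> g x"
  unfolding maxavg_def maximal_def conv_dilate[OF assms(1,2)] by (rule SUP_subset_mono) (use assms in auto)

lemma Lnorm_ennreal:
  "r > 0 \<Longrightarrow> Lnorm (ennreal r) M F = enn_powr (\<integral>\<^sup>+x. enn_powr (F x) r \<partial>M) (1 / r)"
  by (simp add: Lnorm_def)

text \<open>
  \<open>A\<close> is made positive so that the right-hand side is infinite whenever the integral of \<open>h\<close> to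
  the power \<open>r\<close> is.
\<close>

lemma maxavg_bounded:
  fixes \<mu> :: "(real^'n::finite) measure"
  assumes "sets \<mu> = sets borel" "r > 0" "bounded_on_L r (maximal \<mu>)"
  obtains A :: real where "A > 0"
    "\<And>T h. T \<subseteq> {0<..} \<Longrightarrow> h \<in> borel_measurable borel \<Longrightarrow> (\<And>x. h x < top) \<Longrightarrow>
      (\<integral>\<^sup>+x. enn_powr (maxavg T \<mu> h x) r \<partial>lborel) \<le> ennreal A * (\<integral>\<^sup>+x. enn_powr (h x) r \<partial>lborel)"
proof -
  obtain A0 :: real where A0: "A0 \<ge> 0" and
    bd: "\<And>g. g \<in> borel_measurable borel \<Longrightarrow> Lnorm (ennreal r) lborel (modulus g) < top \<Longrightarrow>
      Lnorm (ennreal r) lborel (maximal \<mu> g) \<le> ennreal A0 * Lnorm (ennreal r) lborel (modulus g)"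
    using assms(3) unfolding bounded_on_L_def by blast
  show ?thesis
  proof (rule that)
    show "(A0 + 1) powr r > 0"
      using A0 by simp
    fix T :: "real set" and h :: "real^'n \<Rightarrow> ennreal"
    assume T: "T \<subseteq> {0<..}" and [measurable]: "h \<in> borel_measurable borel" and h: "\<And>x. h x < top"
    define g where "g x = complex_of_real (enn2real (h x))" for x
    have [measurable]: "g \<in> borel_measurable borel"
      unfolding g_def[abs_def] by measurable
    have mg: "modulus g = h"
      using h by (simp add: g_def fun_eq_iff)
    define I where "I = (\<integral>\<^sup>+x. enn_powr (h x) r \<partial>lborel)"
    show "(\<integral>\<^sup>+x. enn_powr (maxavg T \<mu> h x) r \<partial>lborel) \<le> ennreal ((A0 + 1) powr r) * (\<integral>\<^sup>+x. enn_powr (h x) r \<partial>lborel)"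
    proof (cases "I = top")
      case True
      then show ?thesis
        using A0 by (simp add: I_def[symmetric] ennreal_mult_top)
    next
      case False
      have "(\<integral>\<^sup>+x. enn_powr (maxavg T \<mu> h x) r \<partial>lborel) \<le> (\<integral>\<^sup>+x. enn_powr (maximal \<mu> g x) r \<partial>lborel)"
        using maxavg_le_maximal[OF assms(1), of g T] T assms(2)
        by (intro nn_integral_mono enn_powr_mono) (simp_all add: mg)
      also have "\<dots> = enn_powr (Lnorm (ennreal r) lborel (maximal \<mu> g)) r"
        using assms(2) by (simp add: Lnorm_ennreal enn_powr_powr)
      also have "\<dots> \<le> enn_powr (ennreal A0 * enn_powr I (1 / r)) r"
        using bd[of g] False assms(2)
        by (intro enn_powr_mono) (simp_all add: mg Lnorm_ennreal I_def[symmetric] less_top[symmetric])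
      also have "\<dots> = ennreal (A0 powr r) * I"
        using A0 assms(2) by (simp add: enn_powr_mult enn_powr_powr)
      also have "\<dots> \<le> ennreal ((A0 + 1) powr r) * I"
        using A0 assms(2) by (intro mult_right_mono ennreal_leI powr_mono2) auto
      finally show ?thesis
        by (simp add: I_def)
    qed
  qed
qed

section \<open>A bilinear estimate on the circle\<close>

text \<open>
  Arc length on the circle in terms of the angle, as a measure on all Borel sets of the line.
\<close>

definition arc :: "real measure" where
  "arc = density lborel (indicator {0..<2 * pi})"

lemma sets_arc [simp, measurable_cong]: "sets arc = sets borel"
  by (simp add: arc_def)

lemma space_arc [simp]: "space arc = UNIV"
  by (simp add: arc_def)

lemma nn_integral_arc:
  "f \<in> borel_measurable borel \<Longrightarrow> (\<integral>\<^sup>+x. f x \<partial>arc) = (\<integral>\<^sup>+x\<in>{0..<2 * pi}. f x \<partial>lborel)"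
  unfolding arc_def by (subst nn_integral_density) (simp_all add: mult.commute)

lemma emeasure_arc: "emeasure arc UNIV = ennreal (2 * pi)"
  by (simp add: arc_def emeasure_density)

lemma finite_measure_arc: "finite_measure arc"
  by (rule finite_measureI) (simp add: emeasure_arc)

lemma sigma_finite_measure_arc: "sigma_finite_measure arc"
  using finite_measure_arc by (simp add: finite_measure_def)

lemma nn_integral_arc_arc:
  assumes [measurable]: "(\<lambda>(x, y). F x y) \<in> borel_measurable (borel \<Otimes>\<^sub>M borel)"
  shows "(\<integral>\<^sup>+x. \<integral>\<^sup>+y. F x y \<partial>arc \<partial>arc) = (\<integral>\<^sup>+x\<in>{0..<2 * pi}. (\<integral>\<^sup>+y\<in>{0..<2 * pi}. F x y \<partial>lborel) \<partial>lborel)"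
proof -
  interpret sigma_finite_measure arc by (rule sigma_finite_measure_arc)
  have "(\<lambda>x. \<integral>\<^sup>+y. F x y \<partial>arc) \<in> borel_measurable borel"
    by measurable
  then have "(\<integral>\<^sup>+x. \<integral>\<^sup>+y. F x y \<partial>arc \<partial>arc) = (\<integral>\<^sup>+x\<in>{0..<2 * pi}. (\<integral>\<^sup>+y. F x y \<partial>arc) \<partial>lborel)"
    by (rule nn_integral_arc)
  also have "\<dots> = (\<integral>\<^sup>+x\<in>{0..<2 * pi}. (\<integral>\<^sup>+y\<in>{0..<2 * pi}. F x y \<partial>lborel) \<partial>lborel)"
    by (simp add: nn_integral_arc)
  finally show ?thesis .
qed

lemma HLS_arc:
  fixes f :: "real \<Rightarrow> real"
  assumes \<kappa>: "0 < \<kappa>" "\<kappa> < 1"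
    and [measurable]: "f \<in> borel_measurable borel" and nn: "\<And>x. f x \<ge> 0"
  shows "(\<integral>\<^sup>+x. \<integral>\<^sup>+y. ennreal (f x * f y * \<bar>sin (x - y)\<bar> powr - \<kappa>) \<partial>arc \<partial>arc)
    \<le> ennreal (20 * (2 / (1 - \<kappa>) + 2 powr (\<kappa> / 2)))
      * enn_powr (\<integral>\<^sup>+x. ennreal (f x powr (2 / (2 - \<kappa>))) \<partial>arc) (2 - \<kappa>)"
    (is "?L \<le> ennreal ?K * enn_powr ?I _")
proof -
  have K: "?K > 0"
    using \<kappa> by (intro mult_pos_pos add_pos_pos) auto
  consider "?I = top" | "?I = 0" | N where "?I = ennreal N" "N > 0"
    by (cases ?I) (auto simp: less_le)
  then show ?thesis
  proof cases
    case 1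
    then show ?thesis
      using K by (simp only: enn_powr_top) (simp add: ennreal_mult_top del: ennreal_plus)
  next
    case 2
    then have "AE x in arc. f x = 0"
      by (simp add: nn_integral_0_iff_AE)
    then have "?L = (\<integral>\<^sup>+x. 0 \<partial>arc)"
      by (intro nn_integral_cong_AE) auto
    then show ?thesis
      by simp
  next
    case 3
    have "?L \<le> ennreal (?K * N powr (2 - \<kappa>))"
      using HLS_circle[of \<kappa> N f] \<kappa> 3 nn by (subst nn_integral_arc_arc) (simp_all add: nn_integral_arc)
    also have "\<dots> = ennreal ?K * enn_powr ?I (2 - \<kappa>)"
      unfolding 3(1) using K 3(2) by (subst enn_powr_ennreal) (simp_all only: ennreal_mult less_imp_le powr_ge_zero)
    finally show ?thesis .
  qed
qed

lemma AE_arc_sin_diff_nonzero: "AE y in arc. sin (x - y) \<noteq> 0"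
proof -
  have "{y. sin (x - y) = 0} \<subseteq> range (\<lambda>k::int. x - k * pi)"
  proof
    fix y assume "y \<in> {y. sin (x - y) = 0}"
    then obtain k :: int where "x - y = k * pi"
      by (auto simp: sin_zero_iff_int2)
    then show "y \<in> range (\<lambda>k::int. x - k * pi)"
      by (intro image_eqI[of _ _ k]) auto
  qed
  then have "countable {y. sin (x - y) = 0}"
    by (rule countable_subset) simp
  then have "{y. sin (x - y) = 0} \<in> null_sets lborel"
    by (rule countable_imp_null_set_lborel)
  then have "AE y in lborel. sin (x - y) \<noteq> 0"
    by (rule AE_I') auto
  then show ?thesis
    unfolding arc_def by (subst AE_density) auto
qed

text \<open>
  Multiply and divide by \<open>|sin(x - y)|\<close> to the power \<open>1/r\<close> and apply Hoelder's inequality.  The factor with \<open>H\<close>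
  acquires exactly the Jacobian of \<open>circ_sum\<close>, and the factor with \<open>g\<close> the singular kernel of
  exponent \<open>\<kappa> = r'/r = 1/(r - 1)\<close>, which is less than one because \<open>r > 2\<close>.
\<close>

lemma bilinear_circle_bounded:
  assumes r: "r > (2::real)"
  obtains C :: real where "C > 0"
    "\<And>g H. g \<in> borel_measurable borel \<Longrightarrow> (\<And>x. g x \<ge> (0::real)) \<Longrightarrow> H \<in> borel_measurable borel \<Longrightarrow>
      (\<integral>\<^sup>+x. \<integral>\<^sup>+y. ennreal (g x * g y) * H (circ x + circ y) \<partial>arc \<partial>arc)
      \<le> ennreal C * enn_powr (\<integral>\<^sup>+x. ennreal (g x powr (2 * r / (2 * r - 3))) \<partial>arc) ((2 * r - 3) / r)
        * enn_powr (\<integral>\<^sup>+w. enn_powr (H w) r \<partial>lborel) (1 / r)"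
proof -
  define \<kappa> where "\<kappa> = 1 / (r - 1)"
  define r' where "r' = r / (r - 1)"
  define K where "K = 20 * (2 / (1 - \<kappa>) + 2 powr (\<kappa> / 2))"
  have \<kappa>: "0 < \<kappa>" "\<kappa> < 1"
    using r by (simp_all add: \<kappa>_def)
  have K: "K > 0"
    unfolding K_def using \<kappa> by (intro mult_pos_pos add_pos_pos) auto
  have r': "r' > 1" "1 / r' + 1 / r = 1" "r' * (- 1 / r) = - \<kappa>"
    using r by (simp_all add: r'_def \<kappa>_def field_simps)
  show ?thesis
  proof (rule that)
    show "K powr (1 / r') * 2 powr (1 / r) > 0"
      using K by simp
    fix g :: "real \<Rightarrow> real" and H :: "real^2 \<Rightarrow> ennreal"
    assume [measurable]: "g \<in> borel_measurable borel" "H \<in> borel_measurable borel" and g: "\<And>x. g x \<ge> 0"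
    define \<Gamma> where "\<Gamma> = (\<integral>\<^sup>+x. ennreal (g x powr (2 * r / (2 * r - 3))) \<partial>arc)"
    define F1 where "F1 p = ennreal (g (fst p) * g (snd p) * \<bar>sin (fst p - snd p)\<bar> powr (- 1 / r))" for p
    define F2 where "F2 p = H (circ (fst p) + circ (snd p)) * ennreal (\<bar>sin (fst p - snd p)\<bar> powr (1 / r))" for p
    interpret arc: sigma_finite_measure arc by (rule sigma_finite_measure_arc)
    have [measurable]: "F1 \<in> borel_measurable (arc \<Otimes>\<^sub>M arc)" "F2 \<in> borel_measurable (arc \<Otimes>\<^sub>M arc)"
      unfolding F1_def[abs_def] F2_def[abs_def] by measurable
    have "(\<integral>\<^sup>+x. \<integral>\<^sup>+y. ennreal (g x * g y) * H (circ x + circ y) \<partial>arc \<partial>arc)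
        = (\<integral>\<^sup>+x. \<integral>\<^sup>+y. F1 (x, y) * F2 (x, y) \<partial>arc \<partial>arc)"
    proof (rule nn_integral_cong, rule nn_integral_cong_AE)
      fix x
      show "AE y in arc. ennreal (g x * g y) * H (circ x + circ y) = F1 (x, y) * F2 (x, y)"
        using AE_arc_sin_diff_nonzero[of x]
      proof eventually_elim
        case (elim y)
        have "\<bar>sin (x - y)\<bar> powr (- 1 / r) * \<bar>sin (x - y)\<bar> powr (1 / r) = 1"
          using elim by (simp add: powr_add[symmetric])
        then have one: "ennreal (\<bar>sin (x - y)\<bar> powr (- 1 / r)) * ennreal (\<bar>sin (x - y)\<bar> powr (1 / r)) = 1"
          by (simp add: ennreal_mult[symmetric])
        have "F1 (x, y) * F2 (x, y) = ennreal (g x * g y) * H (circ x + circ y)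
            * (ennreal (\<bar>sin (x - y)\<bar> powr (- 1 / r)) * ennreal (\<bar>sin (x - y)\<bar> powr (1 / r)))"
          using g by (simp add: F1_def F2_def ennreal_mult mult_ac)
        then show ?case
          unfolding one by simp
      qed
    qed
    also have "\<dots> = (\<integral>\<^sup>+p. F1 p * F2 p \<partial>(arc \<Otimes>\<^sub>M arc))"
      by (rule arc.nn_integral_fst) measurable
    also have "\<dots> \<le> enn_powr (\<integral>\<^sup>+p. enn_powr (F1 p) r' \<partial>(arc \<Otimes>\<^sub>M arc)) (1 / r')
        * enn_powr (\<integral>\<^sup>+p. enn_powr (F2 p) r \<partial>(arc \<Otimes>\<^sub>M arc)) (1 / r)"
      using r r' by (intro Hoelder_nn_integral) simp_all
    also have "\<dots> \<le> enn_powr (ennreal K * enn_powr \<Gamma> (2 - \<kappa>)) (1 / r')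
        * enn_powr (2 * (\<integral>\<^sup>+w. enn_powr (H w) r \<partial>lborel)) (1 / r)"
    proof (intro mult_mono enn_powr_mono)
      have "(\<integral>\<^sup>+p. enn_powr (F1 p) r' \<partial>(arc \<Otimes>\<^sub>M arc)) = (\<integral>\<^sup>+x. \<integral>\<^sup>+y. enn_powr (F1 (x, y)) r' \<partial>arc \<partial>arc)"
        by (rule arc.nn_integral_fst[symmetric]) measurable
      also have "\<dots> = (\<integral>\<^sup>+x. \<integral>\<^sup>+y. ennreal (g x powr r' * g y powr r' * \<bar>sin (x - y)\<bar> powr - \<kappa>) \<partial>arc \<partial>arc)"
        using g r'(3) by (intro nn_integral_cong) (simp add: F1_def powr_mult powr_powr mult.commute)
      also have "\<dots> \<le> ennreal K * enn_powr (\<integral>\<^sup>+x. ennreal ((g x powr r') powr (2 / (2 - \<kappa>))) \<partial>arc) (2 - \<kappa>)"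
        unfolding K_def by (rule HLS_arc[OF \<kappa>]) simp_all
      also have "(\<integral>\<^sup>+x. ennreal ((g x powr r') powr (2 / (2 - \<kappa>))) \<partial>arc) = \<Gamma>"
      proof -
        have "2 - \<kappa> = (2 * r - 3) / (r - 1)"
          using r by (simp add: \<kappa>_def field_simps)
        then have "r' * (2 / (2 - \<kappa>)) = 2 * r / (2 * r - 3)"
          using r \<kappa> by (simp add: r'_def divide_simps) (simp add: algebra_simps)
        then show ?thesis
          by (simp add: \<Gamma>_def powr_powr)
      qed
      finally show "(\<integral>\<^sup>+p. enn_powr (F1 p) r' \<partial>(arc \<Otimes>\<^sub>M arc)) \<le> ennreal K * enn_powr \<Gamma> (2 - \<kappa>)" .
      have "(\<integral>\<^sup>+p. enn_powr (F2 p) r \<partial>(arc \<Otimes>\<^sub>M arc)) = (\<integral>\<^sup>+x. \<integral>\<^sup>+y. enn_powr (F2 (x, y)) r \<partial>arc \<partial>arc)"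
        by (rule arc.nn_integral_fst[symmetric]) measurable
      also have "\<dots> = (\<integral>\<^sup>+x. \<integral>\<^sup>+y. enn_powr (H (circ x + circ y)) r * ennreal \<bar>sin (x - y)\<bar> \<partial>arc \<partial>arc)"
        using r by (intro nn_integral_cong) (simp add: F2_def enn_powr_mult powr_powr)
      also have "\<dots> \<le> 2 * (\<integral>\<^sup>+w. enn_powr (H w) r \<partial>lborel)"
        using nn_integral_sum_circle_le[of "\<lambda>w. enn_powr (H w) r"] by (subst nn_integral_arc_arc) simp_all
      finally show "(\<integral>\<^sup>+p. enn_powr (F2 p) r \<partial>(arc \<Otimes>\<^sub>M arc)) \<le> 2 * (\<integral>\<^sup>+w. enn_powr (H w) r \<partial>lborel)" .
    qed (use r r' in simp_all)
    also have "\<dots> = ennreal (K powr (1 / r') * 2 powr (1 / r)) * enn_powr \<Gamma> ((2 * r - 3) / r)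
        * enn_powr (\<integral>\<^sup>+w. enn_powr (H w) r \<partial>lborel) (1 / r)"
    proof -
      have "(2 - \<kappa>) * (1 / r') = (2 * r - 3) / r"
        using r by (simp add: \<kappa>_def r'_def field_simps)
      moreover have "enn_powr 2 (1 / r) = ennreal (2 powr (1 / r))"
        using enn_powr_ennreal[of 2 "1 / r"] by (simp del: enn_powr_ennreal)
      ultimately show ?thesis
        using K by (simp only: enn_powr_mult enn_powr_powr enn_powr_ennreal less_imp_le ennreal_mult powr_ge_zero mult_ac)
    qed
    finally show "(\<integral>\<^sup>+x. \<integral>\<^sup>+y. ennreal (g x * g y) * H (circ x + circ y) \<partial>arc \<partial>arc)
      \<le> ennreal (K powr (1 / r') * 2 powr (1 / r)) * enn_powr (\<integral>\<^sup>+x. ennreal (g x powr (2 * r / (2 * r - 3))) \<partial>arc) ((2 * r - 3) / r)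
        * enn_powr (\<integral>\<^sup>+w. enn_powr (H w) r \<partial>lborel) (1 / r)"
      by (simp only: \<Gamma>_def)
  qed
qed


section \<open>The extension estimate\<close>

text \<open>
  Finiteness of \<open>J\<close> is essential; the applications truncate first in order to have it.
\<close>

lemma enn_powr_absorb:
  assumes "J < top" "J \<le> c * enn_powr J a" "a < 1"
  shows "enn_powr J (1 - a) \<le> c"
proof (cases "J = 0")
  case False
  then obtain x where x: "J = ennreal x" "x > 0"
    using assms(1) by (cases J) (auto simp: less_le)
  have "enn_powr J (1 - a) = J * enn_powr J (- a)"
    using enn_powr_add[of J 1 "- a"] by simp
  also have "\<dots> \<le> c * enn_powr J a * enn_powr J (- a)"
    by (intro mult_right_mono assms) simp
  also have "\<dots> = c"
    using x enn_powr_add[of J a "- a"] by (simp add: mult.assoc)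
  finally show ?thesis .
qed simp

lemma norm_extension_le:
  assumes "\<And>\<omega>. norm (b \<omega>) \<le> B"
  shows "ennreal (norm (extension \<nu> b z \<xi>)) \<le> ennreal B * emeasure \<nu> (space \<nu>)"
proof -
  have "ennreal (norm (extension \<nu> b z \<xi>)) \<le> (\<integral>\<^sup>+\<omega>. ennreal B \<partial>\<nu>)"
    unfolding extension_def using assms
    by (intro order.trans[OF norm_integral_le_nn_integral] nn_integral_mono ennreal_leI) (simp add: norm_mult)
  then show ?thesis
    by simp
qed

lemma measurable_extension:
  assumes "sigma_finite_measure \<nu>" and [measurable]: "b \<in> borel_measurable \<nu>" "z \<in> borel_measurable \<nu>"
  shows "extension \<nu> b z \<in> borel_measurable borel"
proof -
  interpret sigma_finite_measure \<nu> by fact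
  show ?thesis
    unfolding extension_def[abs_def] by measurable
qed

lemma extension_mult:
  assumes "finite_measure \<nu>" and [measurable]: "b \<in> borel_measurable \<nu>" "z \<in> borel_measurable \<nu>"
    and B: "\<And>\<omega>. norm (b \<omega>) \<le> B"
  shows "extension \<nu> b z \<xi> * extension \<nu> b z \<xi>
    = extension (\<nu> \<Otimes>\<^sub>M \<nu>) (\<lambda>p. b (fst p) * b (snd p)) (\<lambda>p. z (fst p) + z (snd p)) \<xi>"
proof -
  interpret finite_measure \<nu> by fact
  interpret pair_sigma_finite \<nu> \<nu> ..
  define f where "f \<omega> = character (z \<omega>) \<xi> * b \<omega>" for \<omega>
  have "integrable \<nu> b"
    by (rule integrable_const_bound[where B = B]) (use B in auto)
  then have f: "integrable \<nu> f"
    unfolding f_def by (rule integrable_character_mult) measurable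
  then have [measurable]: "f \<in> borel_measurable \<nu>"
    by simp
  have "integrable (\<nu> \<Otimes>\<^sub>M \<nu>) (\<lambda>(x, y). f x * f y)"
    by (rule Fubini_integrable) (auto simp: norm_mult intro!: integrable_mult_left integrable_mult_right integrable_norm f)
  then have "(LINT x|\<nu>. LINT y|\<nu>. f x * f y) = integral\<^sup>L (\<nu> \<Otimes>\<^sub>M \<nu>) (\<lambda>(x, y). f x * f y)"
    using integral_fst' by fastforce
  moreover have "extension \<nu> b z \<xi> * extension \<nu> b z \<xi> = (LINT x|\<nu>. LINT y|\<nu>. f x * f y)"
    by (simp add: extension_def f_def)
  moreover have "integral\<^sup>L (\<nu> \<Otimes>\<^sub>M \<nu>) (\<lambda>(x, y). f x * f y)
      = extension (\<nu> \<Otimes>\<^sub>M \<nu>) (\<lambda>p. b (fst p) * b (snd p)) (\<lambda>p. z (fst p) + z (snd p)) \<xi>"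
    unfolding extension_def
    by (intro Bochner_Integration.integral_cong refl) (simp add: f_def character_add split_beta' mult_ac)
  ultimately show ?thesis
    by simp
qed

text \<open>
  Multiplying out the square gives \<open>\<phi>\<close>'s transform at
  \<open>circ x + circ x' - \<tau>(x) y - \<tau>(x') y'\<close>.  The integral in \<open>y'\<close>, the other variables being fixed, is an
  average with dilation \<open>\<tau>(x')\<close> and hence at most the maximal one; the integral in \<open>y\<close> of the
  result is in turn at most a second maximal average.  Only then are the two points of the circle
  free of \<open>\<tau>\<close>, and the bound depends on them through \<open>circ x + circ x'\<close> alone.
\<close>

lemma norm_integral_mult_extension_square_le:
  fixes \<mu> :: "(real^2) measure"
  assumes \<mu>: "finite_measure \<mu>" and sets_\<mu> [measurable_cong]: "sets \<mu> = sets borel"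
    and T: "countable T"
    and \<tau> [measurable]: "\<tau> \<in> borel_measurable borel" and \<tau>T: "\<And>x. \<tau> x \<in> T"
    and g [measurable]: "g \<in> borel_measurable borel" and g0: "\<And>x. g x \<ge> 0" and gB: "\<And>x. g x \<le> B"
    and a [measurable]: "a \<in> borel_measurable (borel \<Otimes>\<^sub>M borel)" and a1: "\<And>p. norm (a p) \<le> 1"
    and \<phi>: "integrable lborel \<phi>"
  defines "E \<equiv> extension (arc \<Otimes>\<^sub>M \<mu>) (\<lambda>p. of_real (g (fst p)) * a p) (\<lambda>p. circ (fst p) - \<tau> (fst p) *\<^sub>R snd p)"
  shows "ennreal (norm (LINT \<xi>|lborel. \<phi> \<xi> * (E \<xi> * E \<xi>)))
    \<le> (\<integral>\<^sup>+x. \<integral>\<^sup>+x'. ennreal (g x * g x')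
        * maxavg T \<mu> (maxavg T \<mu> (modulus (fourier \<phi>))) (circ x + circ x') \<partial>arc \<partial>arc)"
proof -
  interpret \<mu>: finite_measure \<mu> by fact
  interpret arc: finite_measure arc by (rule finite_measure_arc)
  interpret P: pair_sigma_finite arc \<mu> ..
  define \<nu> where "\<nu> = arc \<Otimes>\<^sub>M \<mu>"
  define b where "b p = of_real (g (fst p)) * a p" for p
  define z where "z p = circ (fst p) - \<tau> (fst p) *\<^sub>R snd p" for p :: "real \<times> (real^2)"
  define h where "h = modulus (fourier \<phi>)"
  define H where "H = maxavg T \<mu> h"
  interpret \<nu>: finite_measure \<nu>
    unfolding \<nu>_def by (rule finite_measure_pair_measure) unfold_locales
  interpret \<nu>\<nu>: finite_measure "\<nu> \<Otimes>\<^sub>M \<nu>"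
    by (rule finite_measure_pair_measure) unfold_locales
  have sets_\<nu> [measurable_cong]: "sets \<nu> = sets (borel \<Otimes>\<^sub>M borel)"
    unfolding \<nu>_def by (intro sets_pair_measure_cong sets_\<mu> sets_arc)
  have [measurable]: "b \<in> borel_measurable \<nu>" "z \<in> borel_measurable \<nu>"
    unfolding b_def[abs_def] z_def[abs_def] by measurable
  have h [measurable]: "h \<in> borel_measurable borel"
    using \<phi> unfolding h_def by measurable
  have H [measurable]: "H \<in> borel_measurable borel"
    unfolding H_def by (rule measurable_maxavg[OF \<mu> sets_\<mu> T h])
  have nb: "norm (b p) \<le> g (fst p)" for p
    using mult_left_mono[OF a1[of p] g0[of "fst p"]] g0[of "fst p"] by (simp add: b_def norm_mult)
  have bB: "norm (b p) \<le> B" for p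
    using nb gB by (rule order.trans)
  have bbB: "norm (b (fst p) * b (snd p)) \<le> B * B" for p
    unfolding norm_mult using bB[of "fst p"] bB[of "snd p"]
    by (intro mult_mono) (auto intro: order.trans[OF norm_ge_zero])
  have "(LINT \<xi>|lborel. \<phi> \<xi> * (E \<xi> * E \<xi>))
      = (LINT p|(\<nu> \<Otimes>\<^sub>M \<nu>). b (fst p) * b (snd p) * fourier \<phi> (z (fst p) + z (snd p)))"
    unfolding E_def \<nu>_def[symmetric] b_def[symmetric] z_def[symmetric]
    unfolding extension_mult[OF \<nu>.finite_measure_axioms \<open>b \<in> borel_measurable \<nu>\<close> \<open>z \<in> borel_measurable \<nu>\<close> bB]
    by (rule integral_mult_extension[OF \<nu>\<nu>.finite_measure_axioms \<phi> _ _ bbB]) measurable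
  also have "ennreal (norm \<dots>) \<le> (\<integral>\<^sup>+p. ennreal (g (fst (fst p)) * g (fst (snd p))) * h (z (fst p) + z (snd p)) \<partial>(\<nu> \<Otimes>\<^sub>M \<nu>))"
    using nb g0
    by (intro order.trans[OF norm_integral_le_nn_integral] nn_integral_mono)
      (auto simp: norm_mult h_def ennreal_mult[symmetric] intro!: ennreal_leI mult_mono)
  also have "\<dots> = (\<integral>\<^sup>+p. \<integral>\<^sup>+p'. ennreal (g (fst p) * g (fst p')) * h (z p + z p') \<partial>\<nu> \<partial>\<nu>)"
    by (subst \<nu>.nn_integral_fst[symmetric]) simp_all
  also have "\<dots> \<le> (\<integral>\<^sup>+p. \<integral>\<^sup>+x'. ennreal (g (fst p) * g x') * H (z p + circ x') \<partial>arc \<partial>\<nu>)"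
  proof (rule nn_integral_mono)
    fix p
    have "(\<integral>\<^sup>+p'. ennreal (g (fst p) * g (fst p')) * h (z p + z p') \<partial>\<nu>)
        = (\<integral>\<^sup>+x'. \<integral>\<^sup>+y'. ennreal (g (fst p) * g x') * h (z p + circ x' - \<tau> x' *\<^sub>R y') \<partial>\<mu> \<partial>arc)"
      unfolding \<nu>_def z_def by (subst \<mu>.nn_integral_fst[symmetric]) (simp_all add: algebra_simps)
    also have "\<dots> = (\<integral>\<^sup>+x'. ennreal (g (fst p) * g x') * (\<integral>\<^sup>+y'. h (z p + circ x' - \<tau> x' *\<^sub>R y') \<partial>\<mu>) \<partial>arc)"
      by (intro nn_integral_cong nn_integral_cmult) measurable
    also have "\<dots> \<le> (\<integral>\<^sup>+x'. ennreal (g (fst p) * g x') * H (z p + circ x') \<partial>arc)"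
      unfolding H_def by (intro nn_integral_mono mult_left_mono average_le_maxavg \<tau>T) simp_all
    finally show "(\<integral>\<^sup>+p'. ennreal (g (fst p) * g (fst p')) * h (z p + z p') \<partial>\<nu>)
        \<le> (\<integral>\<^sup>+x'. ennreal (g (fst p) * g x') * H (z p + circ x') \<partial>arc)" .
  qed
  also have "\<dots> = (\<integral>\<^sup>+x. \<integral>\<^sup>+y. \<integral>\<^sup>+x'. ennreal (g x * g x') * H (circ x + circ x' - \<tau> x *\<^sub>R y) \<partial>arc \<partial>\<mu> \<partial>arc)"
    unfolding \<nu>_def z_def by (subst \<mu>.nn_integral_fst[symmetric]) (simp_all add: algebra_simps)
  also have "\<dots> = (\<integral>\<^sup>+x. \<integral>\<^sup>+x'. \<integral>\<^sup>+y. ennreal (g x * g x') * H (circ x + circ x' - \<tau> x *\<^sub>R y) \<partial>\<mu> \<partial>arc \<partial>arc)"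
    by (intro nn_integral_cong P.Fubini') measurable
  also have "\<dots> = (\<integral>\<^sup>+x. \<integral>\<^sup>+x'. ennreal (g x * g x') * (\<integral>\<^sup>+y. H (circ x + circ x' - \<tau> x *\<^sub>R y) \<partial>\<mu>) \<partial>arc \<partial>arc)"
    by (intro nn_integral_cong nn_integral_cmult) measurable
  also have "\<dots> \<le> (\<integral>\<^sup>+x. \<integral>\<^sup>+x'. ennreal (g x * g x') * maxavg T \<mu> H (circ x + circ x') \<partial>arc \<partial>arc)"
    by (intro nn_integral_mono mult_left_mono average_le_maxavg \<tau>T) simp_all
  finally show ?thesis
    by (simp only: H_def h_def)
qed

text \<open>
  The function \<open>\<phi>\<close> that is dual to \<open>E\<^sup>2\<close> in \<open>L\<^sup>r\<close> is \<open>cnj(E\<^sup>2) * |E| powr (2r - 4)\<close>.  Its norm in the conjugate exponent is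
  a power of the integral \<open>J\<close> of \<open>|E| powr 2r\<close> itself, so the estimate for the pairing has the form
  \<open>J \<le> c * J powr (1 - 1/r)\<close>, and \<open>J\<close> can be absorbed.  Restricting \<open>\<phi>\<close> to a ball makes \<open>J\<close> finite and \<open>\<phi>\<close>
  integrable; the bound does not depend on the radius.  The constant depends only on \<open>r\<close> and
  \<open>\<mu>\<close>, which is what makes the choice of \<open>\<tau>\<close> and \<open>a\<close> free.
\<close>

theorem extension_bounded:
  fixes \<mu> :: "(real^2) measure"
  assumes r: "r > 2" and \<mu>: "finite_measure \<mu>" and sets_\<mu>: "sets \<mu> = sets borel"
    and bounded: "bounded_on_L r (maximal \<mu>)"
  obtains C :: real where "C > 0"
    "\<And>T \<tau> g a B. countable T \<Longrightarrow> T \<subseteq> {0<..} \<Longrightarrow> \<tau> \<in> borel_measurable borel \<Longrightarrow> (\<And>x. \<tau> x \<in> T) \<Longrightarrow>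
      g \<in> borel_measurable borel \<Longrightarrow> (\<And>x. g x \<ge> 0) \<Longrightarrow> (\<And>x. g x \<le> B) \<Longrightarrow>
      a \<in> borel_measurable (borel \<Otimes>\<^sub>M borel) \<Longrightarrow> (\<And>p. norm (a p) \<le> 1) \<Longrightarrow>
      (\<integral>\<^sup>+\<xi>. enn_powr (modulus (extension (arc \<Otimes>\<^sub>M \<mu>) (\<lambda>p. of_real (g (fst p)) * a p)
        (\<lambda>p. circ (fst p) - \<tau> (fst p) *\<^sub>R snd p)) \<xi>) (2 * r) \<partial>lborel)
      \<le> ennreal C * enn_powr (\<integral>\<^sup>+x. ennreal (g x powr (2 * r / (2 * r - 3))) \<partial>arc) (2 * r - 3)"
proof -
  have "r > 0"
    using r by simp
  obtain A where A: "A > 0" and maxavg_bd: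
    "\<And>T h. T \<subseteq> {0<..} \<Longrightarrow> h \<in> borel_measurable borel \<Longrightarrow> (\<And>x. h x < top) \<Longrightarrow>
      (\<integral>\<^sup>+x. enn_powr (maxavg T \<mu> h x) r \<partial>lborel) \<le> ennreal A * (\<integral>\<^sup>+x. enn_powr (h x) r \<partial>lborel)"
    using maxavg_bounded[OF sets_\<mu> \<open>r > 0\<close> bounded] by blast
  obtain C1 where C1: "C1 > 0" and bilinear:
    "\<And>g H. g \<in> borel_measurable borel \<Longrightarrow> (\<And>x. g x \<ge> (0::real)) \<Longrightarrow> H \<in> borel_measurable borel \<Longrightarrow>
      (\<integral>\<^sup>+x. \<integral>\<^sup>+y. ennreal (g x * g y) * H (circ x + circ y) \<partial>arc \<partial>arc)
      \<le> ennreal C1 * enn_powr (\<integral>\<^sup>+x. ennreal (g x powr (2 * r / (2 * r - 3))) \<partial>arc) ((2 * r - 3) / r)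
        * enn_powr (\<integral>\<^sup>+w. enn_powr (H w) r \<partial>lborel) (1 / r)"
    using bilinear_circle_bounded[OF r] by blast
  define K where "K = 4 * r * 2 powr (r - 2) / (r - 2)"
  have K: "K > 0"
    using r by (simp add: K_def)
  define C2 where "C2 = C1 * (A * A * K) powr (1 / r)"
  have C2: "C2 > 0"
    using C1 A K by (simp add: C2_def)
  show ?thesis
  proof (rule that)
    show "C2 powr r > 0"
      using C2 by simp
    fix T :: "real set" and \<tau> g :: "real \<Rightarrow> real" and a :: "real \<times> (real^2) \<Rightarrow> complex" and B :: real
    assume T: "countable T" "T \<subseteq> {0<..}" and \<tau> [measurable]: "\<tau> \<in> borel_measurable borel" and \<tau>T: "\<And>x. \<tau> x \<in> T"
      and g [measurable]: "g \<in> borel_measurable borel" and g0: "\<And>x. g x \<ge> 0" and gB: "\<And>x. g x \<le> B"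
      and a [measurable]: "a \<in> borel_measurable (borel \<Otimes>\<^sub>M borel)" and a1: "\<And>p. norm (a p) \<le> 1"
    define E where "E = extension (arc \<Otimes>\<^sub>M \<mu>) (\<lambda>p. of_real (g (fst p)) * a p) (\<lambda>p. circ (fst p) - \<tau> (fst p) *\<^sub>R snd p)"
    define \<Gamma> where "\<Gamma> = (\<integral>\<^sup>+x. ennreal (g x powr (2 * r / (2 * r - 3))) \<partial>arc)"
    interpret \<mu>: finite_measure \<mu> by fact
    interpret arc: finite_measure arc by (rule finite_measure_arc)
    interpret \<nu>: finite_measure "arc \<Otimes>\<^sub>M \<mu>"
      by (rule finite_measure_pair_measure) unfold_locales
    have sets_\<nu> [measurable_cong]: "sets (arc \<Otimes>\<^sub>M \<mu>) = sets (borel \<Otimes>\<^sub>M borel)"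
      by (intro sets_pair_measure_cong sets_\<mu> sets_arc)
    have E [measurable]: "E \<in> borel_measurable borel"
      unfolding E_def by (intro measurable_extension \<nu>.sigma_finite_measure_axioms) measurable
    obtain M where M: "\<And>\<xi>. norm (E \<xi>) \<le> M" "M \<ge> 0"
    proof
      have "norm (of_real (g (fst p)) * a p) \<le> B" for p
        using mult_mono[OF gB[of "fst p"] a1[of p]] g0[of "fst p"] gB[of "fst p"] by (simp add: norm_mult)
      then have "ennreal (norm (E \<xi>)) \<le> ennreal B * emeasure (arc \<Otimes>\<^sub>M \<mu>) (space (arc \<Otimes>\<^sub>M \<mu>))" for \<xi>
        unfolding E_def by (rule norm_extension_le)
      then have "ennreal (norm (E \<xi>)) \<le> ennreal (B * measure (arc \<Otimes>\<^sub>M \<mu>) (space (arc \<Otimes>\<^sub>M \<mu>)))" for \<xi>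
        by (simp add: \<nu>.emeasure_eq_measure ennreal_mult'')
      moreover have "B \<ge> 0"
        using g0[of 0] gB[of 0] by simp
      ultimately show "norm (E \<xi>) \<le> B * measure (arc \<Otimes>\<^sub>M \<mu>) (space (arc \<Otimes>\<^sub>M \<mu>))"
        "B * measure (arc \<Otimes>\<^sub>M \<mu>) (space (arc \<Otimes>\<^sub>M \<mu>)) \<ge> 0" for \<xi>
        by simp_all
    qed
    have local: "(\<integral>\<^sup>+\<xi>. ennreal (norm (E \<xi>) powr (2 * r)) * indicator (ball 0 R) \<xi> \<partial>lborel)
        \<le> ennreal (C2 powr r) * enn_powr \<Gamma> (2 * r - 3)" (is "?J \<le> _") for R
    proof -
      define \<phi> where "\<phi> \<xi> = cnj (E \<xi> * E \<xi>) * of_real (norm (E \<xi>) powr (2 * r - 4) * indicator (ball 0 R) \<xi>)" for \<xi>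
      have [measurable]: "ball (0 :: real^2) R \<in> sets borel"
        by simp
      have [measurable]: "\<phi> \<in> borel_measurable borel"
        unfolding \<phi>_def[abs_def] by measurable
      have norm_\<phi>: "norm (\<phi> \<xi>) = norm (E \<xi>) powr (2 * r - 2) * indicator (ball 0 R) \<xi>" for \<xi>
      proof (cases "E \<xi> = 0")
        case False
        have "norm (\<phi> \<xi>) = (norm (E \<xi>) * norm (E \<xi>)) * norm (E \<xi>) powr (2 * r - 4) * indicator (ball 0 R) \<xi>"
          by (simp add: \<phi>_def norm_mult indicator_def)
        also have "norm (E \<xi>) * norm (E \<xi>) = norm (E \<xi>) powr 2"
          using False by (simp add: power2_eq_square)
        also have "norm (E \<xi>) powr 2 * norm (E \<xi>) powr (2 * r - 4) = norm (E \<xi>) powr (2 * r - 2)"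
          unfolding powr_add[symmetric] by simp
        finally show ?thesis .
      qed (simp add: \<phi>_def)
      have fin_ball: "emeasure lborel (ball (0::real^2) R) < top"
        using emeasure_bounded_finite[OF bounded_ball] by simp
      have J_fin: "?J < top"
      proof -
        have "?J \<le> (\<integral>\<^sup>+\<xi>. ennreal (M powr (2 * r)) * indicator (ball (0 :: real^2) R) \<xi> \<partial>lborel)"
          by (intro nn_integral_mono mult_right_mono ennreal_leI powr_mono2 M) (use r in auto)
        also have "\<dots> < top"
          using fin_ball by (simp add: nn_integral_cmult ennreal_mult_less_top)
        finally show ?thesis .
      qed
      have \<phi>: "integrable lborel \<phi>"
      proof (rule integrableI_bounded)
        have "(\<integral>\<^sup>+\<xi>. ennreal (norm (\<phi> \<xi>)) \<partial>lborel) \<le> (\<integral>\<^sup>+\<xi>. ennreal (M powr (2 * r - 2)) * indicator (ball (0 :: real^2) R) \<xi> \<partial>lborel)"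
          unfolding norm_\<phi> using r
          by (intro nn_integral_mono) (auto simp: indicator_def intro!: ennreal_leI powr_mono2 M)
        also have "\<dots> < top"
          using fin_ball by (simp add: nn_integral_cmult ennreal_mult_less_top)
        finally show "(\<integral>\<^sup>+\<xi>. ennreal (norm (\<phi> \<xi>)) \<partial>lborel) < \<infinity>"
          by simp
      qed measurable
      define h where "h = modulus (fourier \<phi>)"
      define H where "H = maxavg T \<mu> h"
      have h: "h \<in> borel_measurable borel" "h \<xi> \<le> ennreal (LINT x|lborel. norm (\<phi> x))" for \<xi>
        using \<phi> norm_fourier_le[of \<phi>] by (simp_all add: h_def)
      have H: "H \<in> borel_measurable borel" "H \<xi> < top" for \<xi>
      proof -
        show "H \<in> borel_measurable borel"
          unfolding H_def by (rule measurable_maxavg[OF \<mu> sets_\<mu> T(1) h(1)])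
        have "H \<xi> \<le> ennreal (LINT x|lborel. norm (\<phi> x)) * emeasure \<mu> (space \<mu>)"
          unfolding H_def by (rule maxavg_le) (rule h)
        also have "\<dots> < top"
          by (simp add: ennreal_mult_less_top \<mu>.emeasure_eq_measure)
        finally show "H \<xi> < top" .
      qed
      have HH: "maxavg T \<mu> H \<in> borel_measurable borel"
        by (rule measurable_maxavg[OF \<mu> sets_\<mu> T(1) H(1)])
      have HY: "(\<integral>\<^sup>+\<xi>. enn_powr (h \<xi>) r \<partial>lborel) \<le> ennreal K * enn_powr ?J (r - 1)"
      proof -
        have "(\<integral>\<^sup>+\<xi>. enn_powr (modulus \<phi> \<xi>) (r / (r - 1)) \<partial>lborel) = ?J"
        proof (rule nn_integral_cong)
          fix \<xi>
          have "(2 * r - 2) * (r / (r - 1)) = 2 * r"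
            using r by (simp add: field_simps)
          then show "enn_powr (modulus \<phi> \<xi>) (r / (r - 1)) = ennreal (norm (E \<xi>) powr (2 * r)) * indicator (ball 0 R) \<xi>"
            by (simp add: norm_\<phi> powr_powr indicator_def)
        qed
        then show ?thesis
          using Hausdorff_Young[OF r \<phi>] by (simp add: h_def K_def)
      qed
      have "(\<integral>\<^sup>+w. enn_powr (maxavg T \<mu> H w) r \<partial>lborel) \<le> ennreal A * (\<integral>\<^sup>+w. enn_powr (H w) r \<partial>lborel)"
        by (rule maxavg_bd[OF T(2) H])
      also have "\<dots> \<le> ennreal A * (ennreal A * (\<integral>\<^sup>+w. enn_powr (h w) r \<partial>lborel))"
        unfolding H_def by (intro mult_left_mono maxavg_bd[OF T(2) h(1)]) (simp_all add: h_def)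
      also have "\<dots> \<le> ennreal A * (ennreal A * (ennreal K * enn_powr ?J (r - 1)))"
        by (intro mult_left_mono HY) simp_all
      also have "\<dots> = ennreal (A * A * K) * enn_powr ?J (r - 1)"
        using A K by (simp add: ennreal_mult mult_ac)
      finally have HH_bd: "(\<integral>\<^sup>+w. enn_powr (maxavg T \<mu> H w) r \<partial>lborel) \<le> ennreal (A * A * K) * enn_powr ?J (r - 1)" .
      have pair: "\<phi> \<xi> * (E \<xi> * E \<xi>) = of_real (norm (E \<xi>) powr (2 * r) * indicator (ball 0 R) \<xi>)" for \<xi>
      proof (cases "E \<xi> = 0")
        case False
        have "\<phi> \<xi> * (E \<xi> * E \<xi>) = ((E \<xi> * E \<xi>) * cnj (E \<xi> * E \<xi>)) * of_real (norm (E \<xi>) powr (2 * r - 4) * indicator (ball 0 R) \<xi>)"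
          by (simp add: \<phi>_def mult_ac)
        also have "(E \<xi> * E \<xi>) * cnj (E \<xi> * E \<xi>) = of_real ((norm (E \<xi> * E \<xi>))\<^sup>2)"
          by (rule complex_norm_square[symmetric])
        also have "(norm (E \<xi> * E \<xi>))\<^sup>2 = norm (E \<xi>) powr 4"
          using False by (simp add: norm_mult power2_eq_square numeral_eq_Suc)
        also have "of_real (norm (E \<xi>) powr 4) * of_real (norm (E \<xi>) powr (2 * r - 4) * indicator (ball 0 R) \<xi>)
            = (of_real (norm (E \<xi>) powr 4 * norm (E \<xi>) powr (2 * r - 4) * indicator (ball 0 R) \<xi>) :: complex)"
          by (simp only: of_real_mult mult.assoc)
        also have "norm (E \<xi>) powr 4 * norm (E \<xi>) powr (2 * r - 4) = norm (E \<xi>) powr (2 * r)"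
          unfolding powr_add[symmetric] by simp
        finally show ?thesis .
      qed simp
      have "?J = (\<integral>\<^sup>+\<xi>. ennreal (norm (E \<xi>) powr (2 * r) * indicator (ball 0 R) \<xi>) \<partial>lborel)"
        by (intro nn_integral_cong) (simp add: indicator_def)
      also have "\<dots> = ennreal (LINT \<xi>|lborel. norm (E \<xi>) powr (2 * r) * indicator (ball 0 R) \<xi>)"
      proof (rule nn_integral_eq_integral)
        show "integrable lborel (\<lambda>\<xi>. norm (E \<xi>) powr (2 * r) * indicator (ball 0 R) \<xi>)"
        proof (rule integrableI_nonneg)
          have "(\<integral>\<^sup>+\<xi>. ennreal (norm (E \<xi>) powr (2 * r) * indicator (ball 0 R) \<xi>) \<partial>lborel) = ?J"
            by (intro nn_integral_cong) (simp add: indicator_def)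
          then show "(\<integral>\<^sup>+\<xi>. ennreal (norm (E \<xi>) powr (2 * r) * indicator (ball 0 R) \<xi>) \<partial>lborel) < \<infinity>"
            using J_fin by simp
        qed simp_all
      qed simp
      also have "(LINT \<xi>|lborel. norm (E \<xi>) powr (2 * r) * indicator (ball 0 R) \<xi>) = norm (LINT \<xi>|lborel. \<phi> \<xi> * (E \<xi> * E \<xi>))"
        unfolding pair integral_complex_of_real norm_of_real by simp
      also have "ennreal \<dots> \<le> (\<integral>\<^sup>+x. \<integral>\<^sup>+x'. ennreal (g x * g x') * maxavg T \<mu> H (circ x + circ x') \<partial>arc \<partial>arc)"
        unfolding E_def H_def h_def
        by (rule norm_integral_mult_extension_square_le[OF \<mu> sets_\<mu> T(1) \<tau> \<tau>T g g0 gB a a1 \<phi>])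
      also have "\<dots> \<le> ennreal C1 * enn_powr \<Gamma> ((2 * r - 3) / r) * enn_powr (\<integral>\<^sup>+w. enn_powr (maxavg T \<mu> H w) r \<partial>lborel) (1 / r)"
        unfolding \<Gamma>_def by (rule bilinear[OF g g0 HH])
      also have "\<dots> \<le> ennreal C1 * enn_powr \<Gamma> ((2 * r - 3) / r) * enn_powr (ennreal (A * A * K) * enn_powr ?J (r - 1)) (1 / r)"
        using r by (intro mult_left_mono enn_powr_mono HH_bd) simp_all
      also have "\<dots> = (ennreal C2 * enn_powr \<Gamma> ((2 * r - 3) / r)) * enn_powr ?J (1 - 1 / r)"
      proof -
        have "(r - 1) * (1 / r) = 1 - 1 / r"
          using r by (simp add: field_simps)
        then have "enn_powr (ennreal (A * A * K) * enn_powr ?J (r - 1)) (1 / r) = ennreal ((A * A * K) powr (1 / r)) * enn_powr ?J (1 - 1 / r)"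
          using A K by (simp only: enn_powr_mult enn_powr_powr) (simp add: ennreal_mult[symmetric])
        moreover have "ennreal C2 = ennreal C1 * ennreal ((A * A * K) powr (1 / r))"
          using C1 by (simp add: C2_def ennreal_mult)
        ultimately show ?thesis
          by (simp only: mult_ac)
      qed
      finally have "?J \<le> (ennreal C2 * enn_powr \<Gamma> ((2 * r - 3) / r)) * enn_powr ?J (1 - 1 / r)" .
      from enn_powr_absorb[OF J_fin this] r
      have "enn_powr ?J (1 / r) \<le> ennreal C2 * enn_powr \<Gamma> ((2 * r - 3) / r)"
        by simp
      then have "?J \<le> enn_powr (ennreal C2 * enn_powr \<Gamma> ((2 * r - 3) / r)) r"
        using r enn_powr_le_iff[of "1 / r" ?J] by simp
      also have "\<dots> = ennreal (C2 powr r) * enn_powr \<Gamma> (2 * r - 3)"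
        using C2 r by (simp add: enn_powr_mult enn_powr_powr)
      finally show ?thesis .
    qed
    have [measurable]: "ball (0 :: real^2) (real n) \<in> sets borel" for n
      by simp
    have lim: "(\<lambda>n. ennreal (norm (E \<xi>) powr (2 * r)) * indicator (ball 0 (real n)) \<xi>) \<longlonglongrightarrow> ennreal (norm (E \<xi>) powr (2 * r))" for \<xi>
    proof (rule tendsto_eventually)
      obtain n0 where "norm \<xi> < real n0"
        using reals_Archimedean2 by blast
      then have "norm \<xi> < real n" if "n \<ge> n0" for n
        using that by simp
      then show "\<forall>\<^sub>F n in sequentially. ennreal (norm (E \<xi>) powr (2 * r)) * indicator (ball 0 (real n)) \<xi> = ennreal (norm (E \<xi>) powr (2 * r))"
        unfolding eventually_sequentially by (intro exI[of _ n0]) simp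
    qed
    have "(\<integral>\<^sup>+\<xi>. enn_powr (modulus E \<xi>) (2 * r) \<partial>lborel)
        = (\<integral>\<^sup>+\<xi>. liminf (\<lambda>n. ennreal (norm (E \<xi>) powr (2 * r)) * indicator (ball 0 (real n)) \<xi>) \<partial>lborel)"
      by (intro nn_integral_cong) (simp add: lim_imp_Liminf[OF sequentially_bot lim])
    also have "\<dots> \<le> liminf (\<lambda>n. \<integral>\<^sup>+\<xi>. ennreal (norm (E \<xi>) powr (2 * r)) * indicator (ball 0 (real n)) \<xi> \<partial>lborel)"
      by (rule nn_integral_liminf) measurable
    also have "\<dots> \<le> liminf (\<lambda>n::nat. ennreal (C2 powr r) * enn_powr \<Gamma> (2 * r - 3))"
      by (intro Liminf_mono always_eventually allI local)
    also have "\<dots> = ennreal (C2 powr r) * enn_powr \<Gamma> (2 * r - 3)"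
      by (rule lim_imp_Liminf) simp_all
    finally show "(\<integral>\<^sup>+\<xi>. enn_powr (modulus (extension (arc \<Otimes>\<^sub>M \<mu>) (\<lambda>p. of_real (g (fst p)) * a p)
        (\<lambda>p. circ (fst p) - \<tau> (fst p) *\<^sub>R snd p)) \<xi>) (2 * r) \<partial>lborel)
      \<le> ennreal (C2 powr r) * enn_powr (\<integral>\<^sup>+x. ennreal (g x powr (2 * r / (2 * r - 3))) \<partial>arc) (2 * r - 3)"
      by (simp only: E_def \<Gamma>_def)
  qed
qed


section \<open>Schwartz functions on the plane\<close>

lemma schwartz_continuous:
  assumes "schwartz f"
  shows "continuous_on UNIV f"
proof -
  have "fold partial [] f differentiable (at x)" for x
    using assms unfolding schwartz_def by blast
  then show ?thesis
    by (auto intro!: continuous_at_imp_continuous_on differentiable_imp_continuous_within)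
qed

text \<open>
  Only the four weights \<open>x\<^sup>a y\<^sup>b\<close> with \<open>a\<close> and \<open>b\<close> equal to 0 or 2 enter; their sum is the product
  \<open>(1 + x\<^sup>2) (1 + y\<^sup>2)\<close>, whose reciprocal is integrable.
\<close>

lemma schwartz_decay:
  fixes f :: "real^2 \<Rightarrow> complex"
  assumes "schwartz f"
  obtains B where "\<And>x y. norm (f (vector [x, y])) \<le> B * (inverse (1 + x\<^sup>2) * inverse (1 + y\<^sup>2))"
proof -
  have "\<exists>C. \<forall>x y. \<bar>x\<bar> ^ a * \<bar>y\<bar> ^ b * norm (f (vector [x, y])) \<le> C" for a b :: nat
  proof -
    define \<alpha> where "\<alpha> i = (if i = (1::2) then a else b)" for i
    have "bounded (range (\<lambda>z. (\<Prod>i\<in>UNIV. (z $ i) ^ \<alpha> i) *\<^sub>R fold partial [] f z))"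
      using assms unfolding schwartz_def by blast
    then obtain C where C: "\<And>z. norm ((\<Prod>i\<in>UNIV. (z $ i) ^ \<alpha> i) *\<^sub>R f z) \<le> C"
      unfolding bounded_iff by auto
    have "\<bar>x\<bar> ^ a * \<bar>y\<bar> ^ b * norm (f (vector [x, y])) \<le> C" for x y
      using C[of "vector [x, y]"] by (simp add: UNIV_2 \<alpha>_def abs_mult power_abs)
    then show ?thesis
      by blast
  qed
  then obtain C where C: "\<And>a b x y. \<bar>x\<bar> ^ a * \<bar>y\<bar> ^ b * norm (f (vector [x, y])) \<le> C a b"
    by metis
  show ?thesis
  proof (rule that)
    fix x y :: real
    have "(1 + x\<^sup>2) * (1 + y\<^sup>2) * norm (f (vector [x, y])) \<le> C 0 0 + C 2 0 + C 0 2 + C 2 2"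
      using C[of x 0 y 0] C[of x 2 y 0] C[of x 0 y 2] C[of x 2 y 2] by (simp add: algebra_simps)
    moreover have "(1 + x\<^sup>2) * (1 + y\<^sup>2) > 0"
      by (intro mult_pos_pos) (simp_all add: add_pos_nonneg)
    ultimately have "norm (f (vector [x, y])) \<le> (C 0 0 + C 2 0 + C 0 2 + C 2 2) / ((1 + x\<^sup>2) * (1 + y\<^sup>2))"
      by (subst pos_le_divide_eq) (simp_all add: mult.commute)
    then show "norm (f (vector [x, y])) \<le> (C 0 0 + C 2 0 + C 0 2 + C 2 2) * (inverse (1 + x\<^sup>2) * inverse (1 + y\<^sup>2))"
      by (simp add: divide_inverse)
  qed
qed

lemma schwartz_integrable:
  fixes f :: "real^2 \<Rightarrow> complex"
  assumes "schwartz f"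
  shows "integrable lborel f"
proof (rule integrableI_bounded)
  have [measurable]: "f \<in> borel_measurable borel"
    by (rule borel_measurable_continuous_onI[OF schwartz_continuous[OF assms]])
  then show "f \<in> borel_measurable lborel"
    by simp
  obtain B where B: "\<And>x y. norm (f (vector [x, y])) \<le> B * (inverse (1 + x\<^sup>2) * inverse (1 + y\<^sup>2))"
    using schwartz_decay[OF assms] by blast
  have B0: "B \<ge> 0"
    using order.trans[OF norm_ge_zero B[of 0 0]] by simp
  define q where "q x = inverse (1 + x\<^sup>2)" for x :: real
  have q0: "q x \<ge> 0" for x
    by (simp add: q_def)
  have [measurable]: "q \<in> borel_measurable borel"
    unfolding q_def by measurable
  have "integrable lborel q"
    using integrable_inverse_1_plus_square by (simp add: set_integrable_def q_def[abs_def])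
  then have "(\<integral>\<^sup>+x. ennreal (q x) \<partial>lborel) = ennreal (LINT x|lborel. q x)"
    by (rule nn_integral_eq_integral) (simp add: q0)
  then obtain c where c: "(\<integral>\<^sup>+x. ennreal (q x) \<partial>lborel) = ennreal c"
    by blast
  have "(\<integral>\<^sup>+z. ennreal (norm (f z)) \<partial>lborel) = (\<integral>\<^sup>+x. \<integral>\<^sup>+y. ennreal (norm (f (vector [x, y]))) \<partial>lborel \<partial>lborel)"
    by (rule nn_integral_plane) measurable
  also have "\<dots> \<le> (\<integral>\<^sup>+x. \<integral>\<^sup>+y. ennreal B * (ennreal (q x) * ennreal (q y)) \<partial>lborel \<partial>lborel)"
    using B B0 q0 by (intro nn_integral_mono) (simp add: ennreal_mult[symmetric] q_def ennreal_leI)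
  also have "\<dots> = ennreal B * (ennreal c * ennreal c)"
    by (simp add: nn_integral_cmult nn_integral_multc c)
  also have "\<dots> < top"
    by (simp add: ennreal_mult_less_top)
  finally show "(\<integral>\<^sup>+z. ennreal (norm (f z)) \<partial>lborel) < \<infinity>"
    by simp
qed

section \<open>Maximal functions of the Fourier transform on the circle\<close>

lemma measurable_selection_of_max:
  fixes u :: "real \<Rightarrow> 'a \<Rightarrow> ennreal"
  assumes "finite T" "T \<noteq> {}" and "\<And>t. t \<in> T \<Longrightarrow> u t \<in> borel_measurable M"
  shows "\<exists>\<tau>. \<tau> \<in> borel_measurable M \<and> (\<forall>x. \<tau> x \<in> T \<and> u (\<tau> x) x = (SUP t\<in>T. u t x))"
  using assms
proof (induction T rule: finite_ne_induct)
  case (singleton t)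
  then show ?case
    by (intro exI[of _ "\<lambda>_. t"]) simp
next
  case (insert t T)
  then obtain \<tau> where \<tau> [measurable]: "\<tau> \<in> borel_measurable M"
    and max: "\<And>x. \<tau> x \<in> T" "\<And>x. u (\<tau> x) x = (SUP t\<in>T. u t x)"
    by auto
  have [measurable]: "u t \<in> borel_measurable M" "(\<lambda>x. SUP t\<in>T. u t x) \<in> borel_measurable M"
    using insert by (auto intro!: borel_measurable_SUP countable_finite)
  define \<tau>' where "\<tau>' x = (if (SUP t\<in>T. u t x) \<le> u t x then t else \<tau> x)" for x
  have "\<tau>' \<in> borel_measurable M"
    unfolding \<tau>'_def by measurable
  moreover have "\<tau>' x \<in> insert t T \<and> u (\<tau>' x) x = (SUP t\<in>insert t T. u t x)" for x
    using max by (auto simp: \<tau>'_def sup_absorb1 sup_absorb2)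
  ultimately show ?case
    by blast
qed

text \<open>
  Duality in explicit form.  With \<open>m\<close> the maximal function on the circle, test it against
  \<open>g = m powr (q - 1)\<close>: the pairing is the integral \<open>X\<close> of \<open>m powr q\<close>, and the conjugate norm of \<open>g\<close> is a power of
  \<open>X\<close>.  The finitely many dilations ensure that the maximum is attained, measurably, and that the
  linearisation is an equality.
\<close>

lemma maxavg_fourier_bounded:
  fixes \<mu> :: "(real^2) measure"
  assumes r: "r > 2" and \<mu>: "finite_measure \<mu>" and sets_\<mu> [measurable_cong]: "sets \<mu> = sets borel"
    and bounded: "bounded_on_L r (maximal \<mu>)"
  obtains C :: real where "C > 0"
    "\<And>T f. finite T \<Longrightarrow> T \<noteq> {} \<Longrightarrow> T \<subseteq> {0<..} \<Longrightarrow> integrable lborel f \<Longrightarrow>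
      enn_powr (\<integral>\<^sup>+x. enn_powr (maxavg T \<mu> (modulus (fourier f)) (circ x)) (2 * r / 3) \<partial>arc) (1 / (2 * r / 3))
      \<le> ennreal C * enn_powr (\<integral>\<^sup>+\<xi>. enn_powr (modulus f \<xi>) (2 * r / (2 * r - 1)) \<partial>lborel) (1 / (2 * r / (2 * r - 1)))"
proof -
  obtain C where C: "C > 0" and ext:
    "\<And>T \<tau> g a B. countable T \<Longrightarrow> T \<subseteq> {0<..} \<Longrightarrow> \<tau> \<in> borel_measurable borel \<Longrightarrow> (\<And>x. \<tau> x \<in> T) \<Longrightarrow>
      g \<in> borel_measurable borel \<Longrightarrow> (\<And>x. g x \<ge> 0) \<Longrightarrow> (\<And>x. g x \<le> B) \<Longrightarrow>
      a \<in> borel_measurable (borel \<Otimes>\<^sub>M borel) \<Longrightarrow> (\<And>p. norm (a p) \<le> 1) \<Longrightarrow>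
      (\<integral>\<^sup>+\<xi>. enn_powr (modulus (extension (arc \<Otimes>\<^sub>M \<mu>) (\<lambda>p. of_real (g (fst p)) * a p)
        (\<lambda>p. circ (fst p) - \<tau> (fst p) *\<^sub>R snd p)) \<xi>) (2 * r) \<partial>lborel)
      \<le> ennreal C * enn_powr (\<integral>\<^sup>+x. ennreal (g x powr (2 * r / (2 * r - 3))) \<partial>arc) (2 * r - 3)"
    using extension_bounded[OF r \<mu> sets_\<mu> bounded] by blast
  define q where "q = 2 * r / 3"
  define P where "P = 2 * r / (2 * r - 1)"
  have q: "q > 1" and P: "P > 1" "1 / P + 1 / (2 * r) = 1"
    using r by (simp_all add: q_def P_def field_simps)
  show ?thesis
  proof (rule that)
    show "C powr (1 / (2 * r)) > 0"
      using C by simp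
    fix T :: "real set" and f :: "real^2 \<Rightarrow> complex"
    assume T: "finite T" "T \<noteq> {}" "T \<subseteq> {0<..}" and f: "integrable lborel f"
    interpret \<mu>: finite_measure \<mu> by fact
    interpret arc: finite_measure arc by (rule finite_measure_arc)
    define F where "F = fourier f"
    define h where "h = modulus F"
    define m where "m x = maxavg T \<mu> h (circ x)" for x
    define u where "u t x = (\<integral>\<^sup>+y. h (circ x - t *\<^sub>R y) \<partial>\<mu>)" for t x
    define I where "I = enn_powr (\<integral>\<^sup>+\<xi>. enn_powr (modulus f \<xi>) P \<partial>lborel) (1 / P)"
    have f_meas [measurable]: "f \<in> borel_measurable borel"
      using borel_measurable_integrable[OF f] by simp
    have F [measurable]: "F \<in> borel_measurable borel"
      using f unfolding F_def by measurable
    have h [measurable]: "h \<in> borel_measurable borel"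
      unfolding h_def by measurable
    have [measurable]: "u t \<in> borel_measurable borel" for t
      unfolding u_def by measurable
    have mf: "maxavg T \<mu> h \<in> borel_measurable borel"
      by (rule measurable_maxavg[OF \<mu> sets_\<mu> countable_finite[OF T(1)] h])
    have m_meas [measurable]: "m \<in> borel_measurable borel"
      unfolding m_def using measurable_compose[OF measurable_circ mf] .
    obtain \<tau> where \<tau> [measurable]: "\<tau> \<in> borel_measurable borel" and \<tau>T: "\<And>x. \<tau> x \<in> T" and "\<And>x. u (\<tau> x) x = (SUP t\<in>T. u t x)"
      using measurable_selection_of_max[OF T(1,2), of u borel] by auto
    then have m_eq: "m x = (\<integral>\<^sup>+y. h (circ x - \<tau> x *\<^sub>R y) \<partial>\<mu>)" for x
      by (simp add: m_def maxavg_def u_def)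
    obtain B where B: "\<And>x. m x \<le> ennreal B" "B \<ge> 0"
    proof
      have "h z \<le> ennreal (LINT x|lborel. norm (f x))" for z
        using norm_fourier_le[of f] by (simp add: h_def F_def)
      then have "m x \<le> ennreal (LINT x|lborel. norm (f x)) * emeasure \<mu> (space \<mu>)" for x
        unfolding m_def by (rule maxavg_le)
      then show "m x \<le> ennreal ((LINT x|lborel. norm (f x)) * measure \<mu> (space \<mu>))" for x
        by (simp add: \<mu>.emeasure_eq_measure ennreal_mult)
    qed simp
    have m_top: "m x < top" for x
      using B(1)[of x] by (rule order.strict_trans1) simp
    define X where "X = (\<integral>\<^sup>+x. enn_powr (m x) q \<partial>arc)"
    have X_fin: "X < top"
    proof -
      have "X \<le> (\<integral>\<^sup>+x. enn_powr (ennreal B) q \<partial>arc)"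
        unfolding X_def using q by (intro nn_integral_mono enn_powr_mono B) simp
      also have "\<dots> < top"
        using B(2) by (simp add: emeasure_arc ennreal_mult_less_top)
      finally show ?thesis .
    qed
    define g where "g x = enn2real (m x) powr (q - 1)" for x
    have g [measurable]: "g \<in> borel_measurable borel" and g0: "\<And>x. g x \<ge> 0"
      unfolding g_def by simp_all
    have gB: "g x \<le> B powr (q - 1)" for x
    proof -
      have "enn2real (m x) \<le> B"
        using B by (simp add: enn2real_leI)
      then show ?thesis
        unfolding g_def using q by (intro powr_mono2) auto
    qed
    have g_m: "ennreal (g x) * m x = enn_powr (m x) q" for x
      using m_top[of x] enn_powr_add[of "m x" "q - 1" 1] by (simp add: g_def enn_powr_def less_top)
    have g_powr: "ennreal (g x powr (2 * r / (2 * r - 3))) = enn_powr (m x) q" for x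
    proof -
      have "(q - 1) * (2 * r / (2 * r - 3)) = q"
        using r by (simp add: q_def field_simps)
      then show ?thesis
        using m_top[of x] by (simp add: g_def powr_powr enn_powr_def less_top)
    qed
    define z where "z p = circ (fst p) - \<tau> (fst p) *\<^sub>R snd p" for p :: "real \<times> (real^2)"
    \<comment> \<open>The conjugate phase of \<open>F (z p)\<close>; where \<open>F (z p)\<close> vanishes, division by zero makes it zero.\<close>
    define a where "a p = cnj (F (z p)) / of_real (norm (F (z p)))" for p
    define E where "E = extension (arc \<Otimes>\<^sub>M \<mu>) (\<lambda>p. of_real (g (fst p)) * a p) z"
    interpret \<nu>: finite_measure "arc \<Otimes>\<^sub>M \<mu>"
      by (rule finite_measure_pair_measure) unfold_locales
    have sets_\<nu> [measurable_cong]: "sets (arc \<Otimes>\<^sub>M \<mu>) = sets (borel \<Otimes>\<^sub>M borel)"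
      by (intro sets_pair_measure_cong sets_\<mu> sets_arc)
    have z [measurable]: "z \<in> borel_measurable (borel \<Otimes>\<^sub>M borel)"
      unfolding z_def[abs_def] by measurable
    have a [measurable]: "a \<in> borel_measurable (borel \<Otimes>\<^sub>M borel)"
      unfolding a_def[abs_def] by measurable
    have a1: "norm (a p) \<le> 1" for p
      by (simp add: a_def norm_divide)
    have aF: "a p * F (z p) = of_real (norm (F (z p)))" for p
      using complex_norm_square[of "F (z p)"]
      by (cases "F (z p) = 0") (simp_all add: a_def nonzero_divide_eq_eq power2_eq_square mult.commute)
    have E_meas [measurable]: "E \<in> borel_measurable borel"
      unfolding E_def by (intro measurable_extension \<nu>.sigma_finite_measure_axioms) measurable
    have E_bd: "(\<integral>\<^sup>+\<xi>. enn_powr (modulus E \<xi>) (2 * r) \<partial>lborel) \<le> ennreal C * enn_powr X (2 * r - 3)"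
      using ext[OF countable_finite[OF T(1)] T(3) \<tau> \<tau>T g g0 gB a a1]
      unfolding E_def z_def X_def g_powr .
    have X_eq: "X = (\<integral>\<^sup>+p. ennreal (g (fst p) * norm (F (z p))) \<partial>(arc \<Otimes>\<^sub>M \<mu>))"
    proof -
      have "(\<integral>\<^sup>+p. ennreal (g (fst p) * norm (F (z p))) \<partial>(arc \<Otimes>\<^sub>M \<mu>))
          = (\<integral>\<^sup>+x. \<integral>\<^sup>+y. ennreal (g x) * h (circ x - \<tau> x *\<^sub>R y) \<partial>\<mu> \<partial>arc)"
        by (subst \<mu>.nn_integral_fst[symmetric]) (simp_all add: z_def h_def ennreal_mult g0)
      also have "\<dots> = (\<integral>\<^sup>+x. ennreal (g x) * m x \<partial>arc)"
        unfolding m_eq by (intro nn_integral_cong nn_integral_cmult) measurable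
      finally show ?thesis
        by (simp add: X_def g_m)
    qed
    also have "\<dots> = ennreal (LINT p|(arc \<Otimes>\<^sub>M \<mu>). g (fst p) * norm (F (z p)))"
    proof (rule nn_integral_eq_integral)
      show "integrable (arc \<Otimes>\<^sub>M \<mu>) (\<lambda>p. g (fst p) * norm (F (z p)))"
        using X_fin unfolding X_eq by (intro integrableI_nonneg) (simp_all add: g0)
    qed (simp add: g0)
    also have "(LINT p|(arc \<Otimes>\<^sub>M \<mu>). g (fst p) * norm (F (z p)))
        = norm (LINT p|(arc \<Otimes>\<^sub>M \<mu>). complex_of_real (g (fst p) * norm (F (z p))))"
      unfolding integral_complex_of_real by (simp add: g0)
    also have "(LINT p|(arc \<Otimes>\<^sub>M \<mu>). complex_of_real (g (fst p) * norm (F (z p))))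
        = (LINT p|(arc \<Otimes>\<^sub>M \<mu>). of_real (g (fst p)) * a p * F (z p))"
      by (simp add: aF mult.assoc)
    also have "\<dots> = (LINT \<xi>|lborel. f \<xi> * E \<xi>)"
      unfolding E_def F_def
    proof (rule integral_mult_extension[symmetric, OF \<nu>.finite_measure_axioms f])
      show "norm (complex_of_real (g (fst p)) * a p) \<le> B powr (q - 1)" for p
        using mult_mono[OF gB[of "fst p"] a1[of p]] g0[of "fst p"] by (simp add: norm_mult)
    qed measurable
    also have "ennreal (norm \<dots>) \<le> (\<integral>\<^sup>+\<xi>. modulus f \<xi> * modulus E \<xi> \<partial>lborel)"
      by (rule order.trans[OF norm_integral_le_nn_integral]) (simp add: norm_mult ennreal_mult)
    also have "\<dots> \<le> I * enn_powr (\<integral>\<^sup>+\<xi>. enn_powr (modulus E \<xi>) (2 * r) \<partial>lborel) (1 / (2 * r))"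
      unfolding I_def using r P by (intro Hoelder_nn_integral) simp_all
    also have "\<dots> \<le> I * enn_powr (ennreal C * enn_powr X (2 * r - 3)) (1 / (2 * r))"
      using r by (intro mult_left_mono enn_powr_mono E_bd) simp_all
    also have "\<dots> = (ennreal (C powr (1 / (2 * r))) * I) * enn_powr X (1 - 1 / q)"
    proof -
      have "(2 * r - 3) * (1 / (2 * r)) = 1 - 1 / q"
        using r by (simp add: q_def field_simps)
      then show ?thesis
        using C by (simp only: enn_powr_mult enn_powr_powr enn_powr_ennreal less_imp_le mult_ac)
    qed
    finally have "X \<le> (ennreal (C powr (1 / (2 * r))) * I) * enn_powr X (1 - 1 / q)" .
    from enn_powr_absorb[OF X_fin this] q
    have "enn_powr X (1 / q) \<le> ennreal (C powr (1 / (2 * r))) * I"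
      by simp
    then show "enn_powr (\<integral>\<^sup>+x. enn_powr (maxavg T \<mu> (modulus (fourier f)) (circ x)) (2 * r / 3) \<partial>arc) (1 / (2 * r / 3))
      \<le> ennreal (C powr (1 / (2 * r))) * enn_powr (\<integral>\<^sup>+\<xi>. enn_powr (modulus f \<xi>) (2 * r / (2 * r - 1)) \<partial>lborel) (1 / (2 * r / (2 * r - 1)))"
      by (simp only: X_def I_def m_def h_def F_def q_def P_def)
  qed
qed

text \<open>
  Finite sets that increase to the positive rationals.
\<close>

definition dilations :: "nat \<Rightarrow> real set" where
  "dilations n = from_nat_into (\<rat> \<inter> {0<..}) ` {..n}"

lemma
  shows finite_dilations: "finite (dilations n)"
    and dilations_ne: "dilations n \<noteq> {}"
    and dilations_pos: "dilations n \<subseteq> {0<..}"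
    and dilations_mono: "m \<le> n \<Longrightarrow> dilations m \<subseteq> dilations n"
    and UN_dilations: "(\<Union>n. dilations n) = \<rat> \<inter> {0<..}"
proof -
  have ne: "\<rat> \<inter> {0<..} \<noteq> ({} :: real set)"
    using Rats_1 by (auto intro!: exI[of _ 1])
  have cnt: "countable (\<rat> \<inter> {0<..} :: real set)"
    by (simp add: countable_rat)
  show "finite (dilations n)" "dilations n \<noteq> {}" "m \<le> n \<Longrightarrow> dilations m \<subseteq> dilations n"
    by (auto simp: dilations_def)
  show "dilations n \<subseteq> {0<..}"
    using from_nat_into[OF ne] by (auto simp: dilations_def)
  have "(\<Union>n. dilations n) = range (from_nat_into (\<rat> \<inter> {0<..}))"
    by (auto simp: dilations_def)
  then show "(\<Union>n. dilations n) = \<rat> \<inter> {0<..}"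
    using range_from_nat_into[OF ne cnt] by simp
qed

text \<open>
  A positive \<open>t\<close> is a limit of positive rationals.  Since \<open>F\<close> is continuous, Fatou's lemma bounds the
  average at \<open>t\<close> by the lower limit of the averages at these rationals.
\<close>

lemma maximal_eq_SUP_dilations:
  fixes F :: "real^'n::finite \<Rightarrow> complex"
  assumes sets_\<mu> [measurable_cong]: "sets \<mu> = sets borel" and F: "continuous_on UNIV F"
  shows "maximal \<mu> F x = (SUP n. maxavg (dilations n) \<mu> (modulus F) x)"
proof (rule antisym)
  have [measurable]: "F \<in> borel_measurable borel"
    by (rule borel_measurable_continuous_onI[OF F])
  let ?S = "SUP n. maxavg (dilations n) \<mu> (modulus F) x"
  have avg_le: "(\<integral>\<^sup>+y. modulus F (x - t *\<^sub>R y) \<partial>\<mu>) \<le> ?S" if "t \<in> \<rat> \<inter> {0<..}" for t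
  proof -
    obtain n where "t \<in> dilations n"
      using \<open>t \<in> \<rat> \<inter> {0<..}\<close> unfolding UN_dilations[symmetric] by blast
    then have "(\<integral>\<^sup>+y. modulus F (x - t *\<^sub>R y) \<partial>\<mu>) \<le> maxavg (dilations n) \<mu> (modulus F) x"
      by (rule average_le_maxavg)
    then show ?thesis
      by (rule SUP_upper2[OF UNIV_I])
  qed
  have "(\<integral>\<^sup>+y. modulus F (x - t *\<^sub>R y) \<partial>\<mu>) \<le> ?S" if "t > 0" for t
  proof -
    have "\<exists>s\<in>\<rat>. t < s \<and> s < t + inverse (real (Suc k))" for k
      by (intro Rats_dense_in_real) simp
    then obtain s where s: "\<And>k. s k \<in> \<rat>" "\<And>k. t < s k" "\<And>k. s k < t + inverse (real (Suc k))"
      by metis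
    have "s \<longlonglongrightarrow> t"
    proof (rule tendsto_sandwich[where f = "\<lambda>_. t" and h = "\<lambda>k. t + inverse (real (Suc k))"])
      show "\<forall>\<^sub>F k in sequentially. t \<le> s k" "\<forall>\<^sub>F k in sequentially. s k \<le> t + inverse (real (Suc k))"
        by (intro always_eventually allI less_imp_le s)+
      show "(\<lambda>k. t + inverse (real (Suc k))) \<longlonglongrightarrow> t"
        using tendsto_add[OF tendsto_const LIMSEQ_inverse_real_of_nat, of t] by simp
    qed simp
    then have lim: "(\<lambda>k. modulus F (x - s k *\<^sub>R y)) \<longlonglongrightarrow> modulus F (x - t *\<^sub>R y)" for y
      by (intro tendsto_ennrealI tendsto_norm continuous_on_tendsto_compose[OF F] tendsto_intros) auto
    have "(\<integral>\<^sup>+y. modulus F (x - t *\<^sub>R y) \<partial>\<mu>) = (\<integral>\<^sup>+y. liminf (\<lambda>k. modulus F (x - s k *\<^sub>R y)) \<partial>\<mu>)"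
      by (intro nn_integral_cong) (simp add: lim_imp_Liminf[OF sequentially_bot lim])
    also have "\<dots> \<le> liminf (\<lambda>k. \<integral>\<^sup>+y. modulus F (x - s k *\<^sub>R y) \<partial>\<mu>)"
      by (rule nn_integral_liminf) measurable
    also have "\<dots> \<le> liminf (\<lambda>k::nat. ?S)"
      using s \<open>t > 0\<close> by (intro Liminf_mono always_eventually allI avg_le) (auto intro: order.strict_trans)
    also have "\<dots> = ?S"
      by (rule lim_imp_Liminf) simp_all
    finally show ?thesis .
  qed
  then show "maximal \<mu> F x \<le> ?S"
    unfolding maximal_def by (intro SUP_least) (simp add: conv_dilate[OF sets_\<mu>])
  show "?S \<le> maximal \<mu> F x"
    by (intro SUP_least maxavg_le_maximal sets_\<mu> dilations_pos) measurable
qed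

lemma nn_integral_circle_measure:
  assumes [measurable]: "F \<in> borel_measurable borel"
  shows "(\<integral>\<^sup>+x. F x \<partial>circle_measure) = (\<integral>\<^sup>+\<theta>. F (circ \<theta>) \<partial>arc)"
proof -
  have F: "F \<in> borel_measurable (restrict_space borel (sphere 0 1))"
    by (rule measurable_restrict_space1) measurable
  have "(\<integral>\<^sup>+x. F x \<partial>circle_measure) = (\<integral>\<^sup>+\<theta>. F (circ \<theta>) \<partial>restrict_space lborel {0..<2 * pi})"
    unfolding circle_measure_def by (subst nn_integral_distr[OF measurable_circle_param]) (simp_all add: F circ_def)
  also have "\<dots> = (\<integral>\<^sup>+\<theta>. F (circ \<theta>) \<partial>arc)"
    by (subst nn_integral_restrict_space) (simp_all add: nn_integral_arc)
  finally show ?thesis .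
qed

lemma nn_integral_enn_powr_mono_exponent:
  assumes "0 < q" and less: "q < Q" and [measurable]: "F \<in> borel_measurable M"
  shows "enn_powr (\<integral>\<^sup>+x. enn_powr (F x) q \<partial>M) (1 / q)
    \<le> enn_powr (emeasure M (space M)) (1 / q - 1 / Q) * enn_powr (\<integral>\<^sup>+x. enn_powr (F x) Q \<partial>M) (1 / Q)"
proof -
  \<comment> \<open>The exponent conjugate to \<open>Q / q\<close>.\<close>
  define s where "s = Q / (Q - q)"
  have s: "Q / q > 1" "s > 1" "1 / (Q / q) + 1 / s = 1"
    using assms less by (simp_all add: s_def field_simps)
  have "(\<integral>\<^sup>+x. enn_powr (F x) q \<partial>M) = (\<integral>\<^sup>+x. enn_powr (F x) q * 1 \<partial>M)"
    by simp
  also have "\<dots> \<le> enn_powr (\<integral>\<^sup>+x. enn_powr (enn_powr (F x) q) (Q / q) \<partial>M) (1 / (Q / q)) * enn_powr (\<integral>\<^sup>+x. enn_powr 1 s \<partial>M) (1 / s)"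
    by (rule Hoelder_nn_integral[OF s]) simp_all
  also have "\<dots> = enn_powr (emeasure M (space M)) (1 / s) * enn_powr (\<integral>\<^sup>+x. enn_powr (F x) Q \<partial>M) (q / Q)"
  proof -
    have "enn_powr 1 s = 1"
      by (simp add: enn_powr_def)
    then show ?thesis
      using assms by (simp add: enn_powr_powr mult.commute)
  qed
  finally have "enn_powr (\<integral>\<^sup>+x. enn_powr (F x) q \<partial>M) (1 / q)
      \<le> enn_powr (enn_powr (emeasure M (space M)) (1 / s) * enn_powr (\<integral>\<^sup>+x. enn_powr (F x) Q \<partial>M) (q / Q)) (1 / q)"
    using assms by (intro enn_powr_mono) simp_all
  also have "\<dots> = enn_powr (emeasure M (space M)) (1 / q - 1 / Q) * enn_powr (\<integral>\<^sup>+x. enn_powr (F x) Q \<partial>M) (1 / Q)"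
  proof -
    have "1 / s * (1 / q) = 1 / q - 1 / Q" "q / Q * (1 / q) = 1 / Q"
      using assms less by (simp_all add: s_def field_simps)
    then show ?thesis
      by (simp only: enn_powr_mult enn_powr_powr)
  qed
  finally show ?thesis .
qed


lemma measurable_maximal:
  assumes "finite_measure \<mu>" and sets_\<mu>: "sets \<mu> = sets borel" and F: "continuous_on UNIV F"
  shows "maximal \<mu> F \<in> borel_measurable borel"
proof -
  have "modulus F \<in> borel_measurable borel"
    using borel_measurable_continuous_onI[OF F] by measurable
  then have "maxavg (dilations n) \<mu> (modulus F) \<in> borel_measurable borel" for n
    by (intro measurable_maxavg assms countable_finite finite_dilations)
  then have "(\<lambda>x. SUP n. maxavg (dilations n) \<mu> (modulus F) x) \<in> borel_measurable borel"
    by (intro borel_measurable_SUP) auto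
  then show ?thesis
    unfolding maximal_eq_SUP_dilations[OF sets_\<mu> F, symmetric] .
qed

text \<open>
  A bound for all powers of the length of the circle that occur, so that the constant does not
  depend on \<open>q\<close>.
\<close>

lemma enn_powr_two_pi_le:
  assumes "0 \<le> a" "a \<le> 1"
  shows "enn_powr (ennreal (2 * pi)) a \<le> ennreal (2 * pi)"
proof -
  have "(2 * pi) powr a \<le> (2 * pi) powr 1"
    using assms pi_gt3 by (intro powr_mono) auto
  then show ?thesis
    by (simp add: ennreal_leI)
qed

lemma Lnorm_circle_le_const:
  assumes F: "F \<in> borel_measurable borel" and c: "\<And>x. F x \<le> c" and q: "1 \<le> q"
  shows "Lnorm q circle_measure F \<le> ennreal (2 * pi) * c"
proof (cases "q = top")
  case True
  have "F \<in> borel_measurable (restrict_space borel (sphere 0 1))"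
    by (rule measurable_restrict_space1[OF F])
  then have "F \<in> borel_measurable circle_measure"
    by (simp add: circle_measure_def)
  then have "esssup circle_measure F \<le> c"
    by (rule esssup_I) (simp add: c)
  also have "\<dots> \<le> ennreal (2 * pi) * c"
    using mult_right_mono[of 1 "ennreal (2 * pi)" c] pi_gt3 by simp
  finally show ?thesis
    using True by (simp add: Lnorm_def)
next
  case False
  then obtain q0 where q0: "q = ennreal q0" "q0 \<ge> 1"
    using q by (cases q) auto
  have "Lnorm q circle_measure F = enn_powr (\<integral>\<^sup>+\<theta>. enn_powr (F (circ \<theta>)) q0 \<partial>arc) (1 / q0)"
    using q0 F by (simp add: Lnorm_ennreal nn_integral_circle_measure)
  also have "\<dots> \<le> enn_powr (\<integral>\<^sup>+\<theta>. enn_powr c q0 \<partial>arc) (1 / q0)"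
    using q0 by (intro enn_powr_mono nn_integral_mono c) auto
  also have "\<dots> = c * enn_powr (ennreal (2 * pi)) (1 / q0)"
    using q0(2) by (simp add: emeasure_arc enn_powr_mult enn_powr_powr del: enn_powr_ennreal)
  also have "\<dots> \<le> c * ennreal (2 * pi)"
    using q0(2) by (intro mult_left_mono enn_powr_two_pi_le) auto
  finally show ?thesis
    by (simp add: mult.commute)
qed

theorem maximal_restriction_critical:
  fixes \<mu> :: "(real^2) measure"
  assumes r: "r > 2" and \<mu>: "finite_measure \<mu>" and sets_\<mu>: "sets \<mu> = sets borel"
    and bounded: "bounded_on_L r (maximal \<mu>)"
  obtains C :: real where "C > 0"
    "\<And>f. integrable lborel f \<Longrightarrow>
      Lnorm (ennreal (2 * r / 3)) circle_measure (maximal \<mu> (fourier f))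
      \<le> ennreal C * Lnorm (ennreal (2 * r / (2 * r - 1))) lborel (modulus f)"
proof -
  define q where "q = 2 * r / 3"
  define P where "P = 2 * r / (2 * r - 1)"
  have q: "q > 0" and P: "P > 0"
    using r by (simp_all add: q_def P_def)
  obtain C where C: "C > 0" and bd:
    "\<And>T f. finite T \<Longrightarrow> T \<noteq> {} \<Longrightarrow> T \<subseteq> {0<..} \<Longrightarrow> integrable lborel f \<Longrightarrow>
      enn_powr (\<integral>\<^sup>+x. enn_powr (maxavg T \<mu> (modulus (fourier f)) (circ x)) q \<partial>arc) (1 / q)
      \<le> ennreal C * enn_powr (\<integral>\<^sup>+\<xi>. enn_powr (modulus f \<xi>) P \<partial>lborel) (1 / P)"
    unfolding q_def P_def using maxavg_fourier_bounded[OF r \<mu> sets_\<mu> bounded] by blast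
  show ?thesis
  proof (rule that[OF C])
    fix f :: "real^2 \<Rightarrow> complex"
    assume f: "integrable lborel f"
    define I where "I = enn_powr (\<integral>\<^sup>+\<xi>. enn_powr (modulus f \<xi>) P \<partial>lborel) (1 / P)"
    define M where "M n x = maxavg (dilations n) \<mu> (modulus (fourier f)) (circ x)" for n x
    note cont = continuous_fourier[OF f]
    have "modulus (fourier f) \<in> borel_measurable borel"
      using f by measurable
    then have "maxavg (dilations n) \<mu> (modulus (fourier f)) \<in> borel_measurable borel" for n
      by (intro measurable_maxavg \<mu> sets_\<mu> countable_finite finite_dilations)
    from measurable_compose[OF measurable_circ this] have [measurable]: "M n \<in> borel_measurable borel" for n
      unfolding M_def .
    have inc: "incseq (\<lambda>n x. enn_powr (M n x) q)"
      unfolding M_def maxavg_def using q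
      by (intro incseq_SucI le_funI enn_powr_mono SUP_subset_mono dilations_mono order.refl) simp_all
    have bdM: "(\<integral>\<^sup>+x. enn_powr (M n x) q \<partial>arc) \<le> enn_powr (ennreal C * I) q" for n
      using bd[OF finite_dilations dilations_ne dilations_pos f, of n] q
        enn_powr_le_iff[of "1 / q" "\<integral>\<^sup>+x. enn_powr (M n x) q \<partial>arc" "ennreal C * I"]
      by (simp add: M_def I_def)
    have "(\<integral>\<^sup>+x. enn_powr (maximal \<mu> (fourier f) (circ x)) q \<partial>arc) = (\<integral>\<^sup>+x. (SUP n. enn_powr (M n x) q) \<partial>arc)"
      unfolding maximal_eq_SUP_dilations[OF sets_\<mu> cont] M_def enn_powr_SUP[OF q] ..
    also have "\<dots> = (SUP n. \<integral>\<^sup>+x. enn_powr (M n x) q \<partial>arc)"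
      by (intro nn_integral_monotone_convergence_SUP inc) measurable
    also have "\<dots> \<le> enn_powr (ennreal C * I) q"
      by (intro SUP_least bdM)
    finally have "enn_powr (\<integral>\<^sup>+x. enn_powr (maximal \<mu> (fourier f) (circ x)) q \<partial>arc) (1 / q) \<le> ennreal C * I"
      using q enn_powr_le_iff[of "1 / q" "\<integral>\<^sup>+x. enn_powr (maximal \<mu> (fourier f) (circ x)) q \<partial>arc"] by simp
    then have "Lnorm (ennreal q) circle_measure (maximal \<mu> (fourier f)) \<le> ennreal C * Lnorm (ennreal P) lborel (modulus f)"
      using q P measurable_maximal[OF \<mu> sets_\<mu> cont]
      by (simp add: Lnorm_ennreal I_def nn_integral_circle_measure)
    then show "Lnorm (ennreal (2 * r / 3)) circle_measure (maximal \<mu> (fourier f))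
      \<le> ennreal C * Lnorm (ennreal (2 * r / (2 * r - 1))) lborel (modulus f)"
      by (simp only: q_def P_def)
  qed
qed

lemma Lnorm_circle_mono_exponent:
  assumes F: "F \<in> borel_measurable borel" and q: "1 \<le> q" "q \<le> Q"
  shows "Lnorm (ennreal q) circle_measure F \<le> ennreal (2 * pi) * Lnorm (ennreal Q) circle_measure F"
proof (cases "q = Q")
  case True
  then show ?thesis
    using mult_right_mono[of 1 "ennreal (2 * pi)" "Lnorm (ennreal Q) circle_measure F"] pi_gt3 by simp
next
  case False
  have "(\<lambda>\<theta>. F (circ \<theta>)) \<in> borel_measurable arc"
    using measurable_compose[OF measurable_circ F] by (simp cong: measurable_cong_sets)
  then have "Lnorm (ennreal q) circle_measure F
      \<le> enn_powr (ennreal (2 * pi)) (1 / q - 1 / Q) * Lnorm (ennreal Q) circle_measure F"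
    using nn_integral_enn_powr_mono_exponent[of q Q "\<lambda>\<theta>. F (circ \<theta>)" arc] q False F
    by (simp add: Lnorm_ennreal nn_integral_circle_measure emeasure_arc del: enn_powr_ennreal)
  also have "\<dots> \<le> ennreal (2 * pi) * Lnorm (ennreal Q) circle_measure F"
  proof (intro mult_right_mono enn_powr_two_pi_le)
    show "1 / q - 1 / Q \<ge> 0"
      using q by (simp add: frac_le)
    have "1 / q \<le> 1" "1 / Q \<ge> 0"
      using q by simp_all
    then show "1 / q - 1 / Q \<le> 1"
      by linarith
  qed simp
  finally show ?thesis .
qed

theorem theorem1:
  fixes \<mu> :: "(real^2) measure" and p p' :: ennreal
  assumes "sets \<mu> = sets borel" and "finite_measure \<mu>"
    and "\<forall>r>2. bounded_on_L r (maximal \<mu>)"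
    and "1 \<le> p" and "p < 4 / 3" and "1 / p + 1 / p' = 1"
  shows "\<exists>C::real. C \<ge> 0 \<and>
    (\<forall>q. 1 \<le> q \<and> 3 * q \<le> p' \<longrightarrow>
      (\<forall>f. schwartz f \<longrightarrow>
        Lnorm q circle_measure (maximal \<mu> (fourier f)) \<le> ennreal C * Lnorm p lborel (modulus f)))"
proof -
  note sets_\<mu> = assms(1) and \<mu> = assms(2)
  have four_thirds: "(4 / 3 :: ennreal) = ennreal (4 / 3)"
    using ennreal_divide_numeral[of 4 "num.One"] by (simp add: divide_ennreal[symmetric])
  obtain s where s: "p = ennreal s" "1 \<le> s" "s < 4 / 3"
    using assms(4,5) unfolding four_thirds by (cases p) (auto simp: ennreal_less_iff)
  show ?thesis
  proof (cases "s = 1")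
    case True
    show ?thesis
    proof (intro exI[of _ "2 * pi * measure \<mu> (space \<mu>)"] conjI allI impI)
      fix q and f :: "real^2 \<Rightarrow> complex"
      assume q: "1 \<le> q \<and> 3 * q \<le> p'" and "schwartz f"
      interpret \<mu>: finite_measure \<mu> by fact
      have f: "integrable lborel f"
        using \<open>schwartz f\<close> by (rule schwartz_integrable)
      note cont = continuous_fourier[OF f]
      have [measurable]: "fourier f \<in> borel_measurable borel"
        using f by measurable
      define N where "N = ennreal (LINT x|lborel. norm (f x))"
      have N: "N = Lnorm p lborel (modulus f)"
        using f True s unfolding N_def
        by (simp add: Lnorm_def nn_integral_eq_integral[symmetric])
      have "maximal \<mu> (fourier f) x \<le> N * emeasure \<mu> (space \<mu>)" for x
        unfolding maximal_eq_SUP_dilations[OF sets_\<mu> cont]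
        by (intro SUP_least maxavg_le) (simp add: N_def norm_fourier_le)
      then have "Lnorm q circle_measure (maximal \<mu> (fourier f)) \<le> ennreal (2 * pi) * (N * emeasure \<mu> (space \<mu>))"
        using q by (intro Lnorm_circle_le_const measurable_maximal[OF \<mu> sets_\<mu> cont]) auto
      also have "\<dots> = ennreal (2 * pi * measure \<mu> (space \<mu>)) * Lnorm p lborel (modulus f)"
        by (simp add: N \<mu>.emeasure_eq_measure ennreal_mult mult_ac)
      finally show "Lnorm q circle_measure (maximal \<mu> (fourier f))
          \<le> ennreal (2 * pi * measure \<mu> (space \<mu>)) * Lnorm p lborel (modulus f)" .
    qed simp
  next
    case False
    \<comment> \<open>Half of the exponent conjugate to \<open>s\<close>.\<close>
    define r where "r = s / (2 * (s - 1))"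
    have r: "r > 2" and s_eq: "2 * r / (2 * r - 1) = s" and conj_eq: "1 / s + 1 / (2 * r) = 1"
      using s False by (simp_all add: r_def field_simps)
    have p': "p' = ennreal (2 * r)"
    proof (cases p')
      case (real b)
      have "b \<noteq> 0"
        using assms(6) real by auto
      then have b: "b > 0"
        using real by simp
      have "ennreal (1 / s + 1 / b) = 1"
        using assms(6) s b divide_ennreal[of 1 s] divide_ennreal[of 1 b] by (simp add: real)
      then have "1 / s + 1 / b = 1"
        unfolding ennreal_1[symmetric] using s b by (subst (asm) ennreal_inj) simp_all
      then have "1 / b = 1 / (2 * r)"
        using conj_eq by linarith
      then show ?thesis
        using real by simp
    next
      case top
      have "1 / p < 1"
        using s False divide_ennreal[of 1 s] by (simp flip: ennreal_1 add: ennreal_less_iff)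
      then show ?thesis
        using assms(6) top by simp
    qed
    obtain C where C: "C > 0" and bd: "\<And>f. integrable lborel f \<Longrightarrow>
        Lnorm (ennreal (2 * r / 3)) circle_measure (maximal \<mu> (fourier f)) \<le> ennreal C * Lnorm p lborel (modulus f)"
      using maximal_restriction_critical[OF r \<mu> sets_\<mu>] assms(3) r unfolding s_eq s(1) by blast
    show ?thesis
    proof (intro exI[of _ "2 * pi * C"] conjI allI impI)
      fix q and f :: "real^2 \<Rightarrow> complex"
      assume q: "1 \<le> q \<and> 3 * q \<le> p'" and "schwartz f"
      have f: "integrable lborel f"
        using \<open>schwartz f\<close> by (rule schwartz_integrable)
      obtain q0 where q0: "q = ennreal q0" "1 \<le> q0" "q0 \<le> 2 * r / 3"
      proof -
        have "q \<noteq> top"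
          using q by (auto simp: p' ennreal_mult_top top_unique)
        then obtain q0 where q0: "q = ennreal q0" "q0 \<ge> 0"
          by (cases q) auto
        have "ennreal (3 * q0) \<le> ennreal (2 * r)"
          using q q0 by (simp add: p' ennreal_mult)
        then have "q0 \<le> 2 * r / 3"
          using r by simp
        then show ?thesis
          using that q q0 by simp
      qed
      have "Lnorm q circle_measure (maximal \<mu> (fourier f))
          \<le> ennreal (2 * pi) * Lnorm (ennreal (2 * r / 3)) circle_measure (maximal \<mu> (fourier f))"
        unfolding q0(1)
        by (intro Lnorm_circle_mono_exponent measurable_maximal \<mu> sets_\<mu> continuous_fourier f q0)
      also have "\<dots> \<le> ennreal (2 * pi) * (ennreal C * Lnorm p lborel (modulus f))"
        by (intro mult_left_mono bd f) simp
      also have "\<dots> = ennreal (2 * pi * C) * Lnorm p lborel (modulus f)"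
        using C by (simp add: ennreal_mult mult.assoc)
      finally show "Lnorm q circle_measure (maximal \<mu> (fourier f)) \<le> ennreal (2 * pi * C) * Lnorm p lborel (modulus f)" .
    qed (use C in simp)
  qed
qed

end
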